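(* Let $E$ be a graph, $v,w\in E^0$ be two vertices such that $v$ is regular and does not emit a loop, and $\theta\colon s_E^{-1}(v)\to s_E^{-1}(w)$ be an injection with the property $t_E(e)=t_E(\theta(e))$ for all $e\in s_E^{-1}(v)$. Let $E_{(v,w)}$ be the corresponding shift and $f_*\colon C^*(E)\to C^*(E_{(v,w)})$ the $*$-isomorphism given by $f_*(S_u)=S_u$ for $u\in E^0$, $f_*(S_e)=S_e$ for $e\in E^1\setminus\theta(s_E^{-1}(v))$, and $f_*(S_e)=S_{x_{w,v}}S_{\theta^{-1}(e)}$ for $e\in\theta(s_E^{-1}(v))$. Then the inverse of $f_*$, which is given by $(f_* )^{-1}(S_e)=S_e$ for all vertices and all edges $e\neq x_{w,v}$ and $(f_* )^{-1}(S_{x_{w,v}})=\sum_{y\in s_E^{-1}(v)}S_{\theta(y)}S_y^*$, can be realized as a composition $$(f_* )^{-1}=g^*\circ\varphi_*,$$ where $g$ is an admissible graph homomorphism and $\varphi$ is a regular extended path homomorphism.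
   Context: A graph $E=(E^0,E^1,s_E,t_E)$ consists of arbitrary sets of vertices and edges with source and target maps. A vertex $v$ is regular if $s_E^{-1}(v)$ is finite and nonempty; $\mathrm{reg}(E)$ is the set of regular vertices. A loop is an edge $e$ with $s_E(e)=t_E(e)$. $\mathrm{FP}(E)$ is the set of finite paths (vertices, of length $0$, and sequences $e_1\ldots e_n$ of edges with $t_E(e_i)=s_E(e_{i+1})$); vertices act as units for concatenation. Shift: $E_{(v,w)}^0=E^0$, $E_{(v,w)}^1=(E^1\setminus\theta(s_E^{-1}(v)))\sqcup\{x_{w,v}\}$, sources and targets of the edges in $E^1\setminus\theta(s_E^{-1}(v))$ are as in $E$, and the new edge $x_{w,v}$ has source $w$ and target $v$. A graph homomorphism $g\colon H\to F$ (maps on vertices and edges commuting with sources and targets) is admissible if (1) $g^{-1}(v)$, $g^{-1}(e)$ are finite for all $v\in F^0$, $e\in F^1$; (2) for every $x\in F^1$ the map $t_H\colon g^{-1}(x)\to g^{-1}(t_F(x))$ is bijective; (3) $g^{-1}(\mathrm{reg}(F))\subseteq\mathrm{reg}(H)$. It contravariantly induces a $*$-homomorphism $g^*\colon C^*(F)\to C^*(H)$, $S_v\mapsto\sum_{u\in g^{-1}(v)}S_u$, $S_e\mapsto\sum_{x\in g^{-1}(e)}S_x$. $C^*(E)$ is the universal C*-algebra generated by mutually orthogonal projections $S_v$ ($v\in E^0$) and elements $S_e$ ($e\in E^1$) with $S_e^*S_{e'}=\delta_{e,e'}S_{t_E(e)}$, $S_{s_E(e)}S_e=S_e$, and $S_v=\sum_{e\in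 s_E^{-1}(v)}S_eS_e^*$ for $v\in\mathrm{reg}(E)$. For paths, $S_{e_1\ldots e_n}=S_{e_1}\cdots S_{e_n}$; put $S_{(\alpha,\beta)}=S_\alpha S_\beta^*$, $S_0=0$. That $f_*$ in the claim is a $*$-isomorphism with the stated inverse is quoted from the literature. The graph inverse semigroup is $S(E)=\{(\alpha,\beta)\in \mathrm{FP}(E)^2\mid t_E(\alpha)=t_E(\beta)\}\cup\{0\}$ with $(\alpha,\beta)(\gamma,\delta)=(\alpha\gamma',\delta)$ if $\gamma=\beta\gamma'$, $=(\alpha,\delta\beta')$ if $\beta=\gamma\beta'$, and $=0$ otherwise; $0$ is a zero element; $(\alpha,\beta)^*=(\beta,\alpha)$; $s\le t\iff ss^*t=s$. An extended path homomorphism from $E$ to $F$ is a semigroup homomorphism $\varphi\colon S(E)\to S(F)$ with $\varphi(0)=0$; it is regular if whenever $u\in\mathrm{reg}(E)$, $0\ne t\in S(F)$ and $t\le\varphi(u,u)$, there exists $e\in s_E^{-1}(u)$ with $t\varphi(e,e)\neq0$. A regular $\varphi$ covariantly induces the $*$-homomorphism $\varphi_*\colon C^*(E)\to C^*(F)$, $S_v\mapsto S_{\varphi(v,v)}$, $S_e\mapsto S_{\varphi(e,t_E(e))}$.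
   Formalization: The composition is proved in the order φ_*∘g^* (g^* first, through a graph G with g: G→E_(v,w) and φ from G to E), since g^*∘φ_* with φ_* first fails when v and w each emit two edges to a common sink; v and w are assumed distinct, as the formula for f_* is undefined for v=w. *)

theory Defs
  imports
    "Graph_Theory.Arc_Walk"
    "HOL-Algebra.Module"
    "HOL-Library.Poly_Mapping"
    "HOL-Library.Sublist"
    Complex_Main
begin

section \<open>Universal C*-algebras given by generators and relations\<close>

text \<open>
  The free *-algebra on \<open>X\<close> is the span of the nonempty words in the letters \<open>x\<close>, \<open>x\<^sup>*\<close>
  for \<open>x \<in> X\<close>; the letter \<open>x\<^sup>*\<close> is encoded as \<open>(x, True)\<close>. Words form a monoid, so the
  finitely supported complex functions on them are a ring under convolution. The empty word is
  excluded from \<open>star_polys\<close>, since C*-algebras of graphs need not be unital.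
\<close>

datatype 'g star_word = Star_Word (letters: "('g \<times> bool) list")

instantiation star_word :: (type) monoid_add
begin

definition zero_star_word :: "'a star_word" where
  "zero_star_word = Star_Word []"

definition plus_star_word :: "'a star_word \<Rightarrow> 'a star_word \<Rightarrow> 'a star_word" where
  "plus_star_word w w' = Star_Word (letters w @ letters w')"

instance
  by standard (auto simp: zero_star_word_def plus_star_word_def)

end

type_synonym 'g star_poly = "'g star_word \<Rightarrow>\<^sub>0 complex"

definition star_polys :: "'g set \<Rightarrow> 'g star_poly set" where
  "star_polys X = {a. \<forall>w \<in> Poly_Mapping.keys a. letters w \<noteq> [] \<and> fst ` set (letters w) \<subseteq> X}"

definition gen :: "'g \<Rightarrow> 'g star_poly" where
  "gen x = Poly_Mapping.single (Star_Word [(x, False)]) 1"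

definition word_star :: "'g star_word \<Rightarrow> 'g star_word" where
  "word_star w = Star_Word (rev (map (\<lambda>(x, b). (x, \<not> b)) (letters w)))"

definition poly_star :: "'g star_poly \<Rightarrow> 'g star_poly" where
  "poly_star a = Poly_Mapping.map cnj (Poly_Mapping.map_key word_star a)"

definition poly_scale :: "complex \<Rightarrow> 'g star_poly \<Rightarrow> 'g star_poly" where
  "poly_scale c a = Poly_Mapping.map ((*) c) a"

definition cstar_seminorm :: "'g set \<Rightarrow> ('g star_poly \<Rightarrow> real) \<Rightarrow> bool" where
  "cstar_seminorm X p \<longleftrightarrow>
     (\<forall>a \<in> star_polys X. 0 \<le> p a) \<and>
     (\<forall>a \<in> star_polys X. \<forall>b \<in> star_polys X. p (a + b) \<le> p a + p b) \<and>
     (\<forall>c. \<forall>a \<in> star_polys X. p (poly_scale c a) = cmod c * p a) \<and>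
     (\<forall>a \<in> star_polys X. \<forall>b \<in> star_polys X. p (a * b) \<le> p a * p b) \<and>
     (\<forall>a \<in> star_polys X. p (poly_star a * a) = (p a)\<^sup>2)"

text \<open>
  The supremum is a real number only if the values are bounded. For the relations of a graph
  they are: the generators are sent to projections and partial isometries, so \<open>p (gen x) \<le> 1\<close>.
\<close>

definition universal_norm :: "'g set \<Rightarrow> 'g star_poly set \<Rightarrow> 'g star_poly \<Rightarrow> real" where
  "universal_norm X R a = Sup {p a | p. cstar_seminorm X p \<and> (\<forall>r \<in> R. p r = 0)}"

text \<open>
  The universal C*-algebra on generators \<open>X\<close> subject to \<open>r = 0\<close> for \<open>r \<in> R\<close> is the
  Hausdorff completion of the free *-algebra for \<open>universal_norm\<close>: Cauchy sequences modulo
  sequences converging to \<open>0\<close>.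
\<close>

definition cauchy_seqs :: "'g set \<Rightarrow> 'g star_poly set \<Rightarrow> (nat \<Rightarrow> 'g star_poly) set" where
  "cauchy_seqs X R = {s. (\<forall>n. s n \<in> star_polys X) \<and>
     (\<forall>\<epsilon>>0. \<exists>N. \<forall>m\<ge>N. \<forall>n\<ge>N. universal_norm X R (s m - s n) < \<epsilon>)}"

definition cauchy_rel ::
    "'g set \<Rightarrow> 'g star_poly set \<Rightarrow> ((nat \<Rightarrow> 'g star_poly) \<times> (nat \<Rightarrow> 'g star_poly)) set" where
  "cauchy_rel X R = {(s, t). s \<in> cauchy_seqs X R \<and> t \<in> cauchy_seqs X R \<and>
     (\<lambda>n. universal_norm X R (s n - t n)) \<longlonglongrightarrow> 0}"

text \<open>
  As in \<open>module\<close> records generally, the field \<open>one\<close> is present but carries no meaning.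
\<close>

record 'a star_algebra = "(complex, 'a) module" +
  adj :: "'a \<Rightarrow> 'a"
  cstar_norm :: "'a \<Rightarrow> real"

type_synonym 'g cstar_elem = "(nat \<Rightarrow> 'g star_poly) set"

definition universal_cstar :: "'g set \<Rightarrow> 'g star_poly set \<Rightarrow> 'g cstar_elem star_algebra" where
  "universal_cstar X R =
    \<lparr> carrier = cauchy_seqs X R // cauchy_rel X R,
      mult = (\<lambda>A B. \<Union>s\<in>A. \<Union>t\<in>B. cauchy_rel X R `` {\<lambda>n. s n * t n}),
      one = undefined,
      zero = cauchy_rel X R `` {\<lambda>_. 0},
      add = (\<lambda>A B. \<Union>s\<in>A. \<Union>t\<in>B. cauchy_rel X R `` {\<lambda>n. s n + t n}),
      smult = (\<lambda>c A. \<Union>s\<in>A. cauchy_rel X R `` {\<lambda>n. poly_scale c (s n)}),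
      adj = (\<lambda>A. \<Union>s\<in>A. cauchy_rel X R `` {\<lambda>n. poly_star (s n)}),
      cstar_norm = (\<lambda>A. THE l. \<forall>s\<in>A. (\<lambda>n. universal_norm X R (s n)) \<longlonglongrightarrow> l) \<rparr>"

definition universal_gen :: "'g set \<Rightarrow> 'g star_poly set \<Rightarrow> 'g \<Rightarrow> 'g cstar_elem" where
  "universal_gen X R x = cauchy_rel X R `` {\<lambda>_. gen x}"

definition star_hom ::
    "('a, 'm) star_algebra_scheme \<Rightarrow> ('b, 'n) star_algebra_scheme \<Rightarrow> ('a \<Rightarrow> 'b) \<Rightarrow> bool" where
  "star_hom A B h \<longleftrightarrow>
     h \<in> carrier A \<rightarrow> carrier B \<and>
     (\<forall>a \<in> carrier A. \<forall>b \<in> carrier A. h (a \<oplus>\<^bsub>A\<^esub> b) = h a \<oplus>\<^bsub>B\<^esub> h b) \<and>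
     (\<forall>c. \<forall>a \<in> carrier A. h (c \<odot>\<^bsub>A\<^esub> a) = c \<odot>\<^bsub>B\<^esub> h a) \<and>
     (\<forall>a \<in> carrier A. \<forall>b \<in> carrier A. h (a \<otimes>\<^bsub>A\<^esub> b) = h a \<otimes>\<^bsub>B\<^esub> h b) \<and>
     (\<forall>a \<in> carrier A. h (adj A a) = adj B (h a))"

definition star_iso ::
    "('a, 'm) star_algebra_scheme \<Rightarrow> ('b, 'n) star_algebra_scheme \<Rightarrow> ('a \<Rightarrow> 'b) \<Rightarrow> bool" where
  "star_iso A B h \<longleftrightarrow> star_hom A B h \<and> bij_betw h (carrier A) (carrier B)"


section \<open>Graph C*-algebras\<close>

definition reg :: "('v, 'e) pre_digraph \<Rightarrow> 'v set" where
  "reg E = {v \<in> verts E. finite (out_arcs E v) \<and> out_arcs E v \<noteq> {}}"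

definition graph_gens :: "('v, 'e) pre_digraph \<Rightarrow> ('v + 'e) set" where
  "graph_gens E = Inl ` verts E \<union> Inr ` arcs E"

definition graph_rels :: "('v, 'e) pre_digraph \<Rightarrow> ('v + 'e) star_poly set" where
  "graph_rels E =
     {poly_star (gen (Inl v)) - gen (Inl v) | v. v \<in> verts E} \<union>
     {gen (Inl v) * gen (Inl v) - gen (Inl v) | v. v \<in> verts E} \<union>
     {gen (Inl v) * gen (Inl w) | v w. v \<in> verts E \<and> w \<in> verts E \<and> v \<noteq> w} \<union>
     {poly_star (gen (Inr e)) * gen (Inr e) - gen (Inl (head E e)) | e. e \<in> arcs E} \<union>
     {poly_star (gen (Inr e)) * gen (Inr e') | e e'. e \<in> arcs E \<and> e' \<in> arcs E \<and> e \<noteq> e'} \<union>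
     {gen (Inl (tail E e)) * gen (Inr e) - gen (Inr e) | e. e \<in> arcs E} \<union>
     {gen (Inl v) - (\<Sum>e \<in> out_arcs E v. gen (Inr e) * poly_star (gen (Inr e))) | v. v \<in> reg E}"

definition graph_cstar :: "('v, 'e) pre_digraph \<Rightarrow> ('v + 'e) cstar_elem star_algebra" where
  "graph_cstar E = universal_cstar (graph_gens E) (graph_rels E)"

definition S_vert :: "('v, 'e) pre_digraph \<Rightarrow> 'v \<Rightarrow> ('v + 'e) cstar_elem" where
  "S_vert E v = universal_gen (graph_gens E) (graph_rels E) (Inl v)"

definition S_arc :: "('v, 'e) pre_digraph \<Rightarrow> 'e \<Rightarrow> ('v + 'e) cstar_elem" where
  "S_arc E e = universal_gen (graph_gens E) (graph_rels E) (Inr e)"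


section \<open>Admissible graph homomorphisms\<close>

definition graph_hom ::
    "('a, 'b) pre_digraph \<Rightarrow> ('c, 'd) pre_digraph \<Rightarrow> ('a \<Rightarrow> 'c) \<Rightarrow> ('b \<Rightarrow> 'd) \<Rightarrow> bool" where
  "graph_hom H F gv ge \<longleftrightarrow>
     gv \<in> verts H \<rightarrow> verts F \<and> ge \<in> arcs H \<rightarrow> arcs F \<and>
     (\<forall>e \<in> arcs H. tail F (ge e) = gv (tail H e) \<and> head F (ge e) = gv (head H e))"

abbreviation vfibre :: "('a, 'b) pre_digraph \<Rightarrow> ('a \<Rightarrow> 'c) \<Rightarrow> 'c \<Rightarrow> 'a set" where
  "vfibre H gv v \<equiv> {u \<in> verts H. gv u = v}"

abbreviation afibre :: "('a, 'b) pre_digraph \<Rightarrow> ('b \<Rightarrow> 'd) \<Rightarrow> 'd \<Rightarrow> 'b set" where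
  "afibre H ge e \<equiv> {x \<in> arcs H. ge x = e}"

definition admissible ::
    "('a, 'b) pre_digraph \<Rightarrow> ('c, 'd) pre_digraph \<Rightarrow> ('a \<Rightarrow> 'c) \<Rightarrow> ('b \<Rightarrow> 'd) \<Rightarrow> bool" where
  "admissible H F gv ge \<longleftrightarrow>
     graph_hom H F gv ge \<and>
     (\<forall>v \<in> verts F. finite (vfibre H gv v)) \<and>
     (\<forall>e \<in> arcs F. finite (afibre H ge e)) \<and>
     (\<forall>x \<in> arcs F. bij_betw (head H) (afibre H ge x) (vfibre H gv (head F x))) \<and>
     (\<forall>u \<in> verts H. gv u \<in> reg F \<longrightarrow> u \<in> reg H)"

definition is_pullback ::
    "('a, 'b) pre_digraph \<Rightarrow> ('c, 'd) pre_digraph \<Rightarrow> ('a \<Rightarrow> 'c) \<Rightarrow> ('b \<Rightarrow> 'd) \<Rightarrow>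
     (('c + 'd) cstar_elem \<Rightarrow> ('a + 'b) cstar_elem) \<Rightarrow> bool" where
  "is_pullback H F gv ge h \<longleftrightarrow>
     star_hom (graph_cstar F) (graph_cstar H) h \<and>
     (\<forall>v \<in> verts F. h (S_vert F v) = (\<Oplus>\<^bsub>graph_cstar H\<^esub> u \<in> vfibre H gv v. S_vert H u)) \<and>
     (\<forall>e \<in> arcs F. h (S_arc F e) = (\<Oplus>\<^bsub>graph_cstar H\<^esub> x \<in> afibre H ge e. S_arc H x))"


section \<open>Graph inverse semigroups and extended path homomorphisms\<close>

text \<open>
  A finite path is a pair of its initial vertex and its list of edges; the initial vertex is
  redundant unless the list is empty, in which case the pair is a path of length \<open>0\<close>.
\<close>

type_synonym ('v, 'e) fpath = "'v \<times> 'e list"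

definition path_target :: "('v, 'e) pre_digraph \<Rightarrow> ('v, 'e) fpath \<Rightarrow> 'v" where
  "path_target E \<alpha> = pre_digraph.awlast E (fst \<alpha>) (snd \<alpha>)"

definition FP :: "('v, 'e) pre_digraph \<Rightarrow> ('v, 'e) fpath set" where
  "FP E = {\<alpha>. pre_digraph.awalk E (fst \<alpha>) (snd \<alpha>) (path_target E \<alpha>)}"

abbreviation vpath :: "'v \<Rightarrow> ('v, 'e) fpath" where
  "vpath v \<equiv> (v, [])"

abbreviation epath :: "('v, 'e) pre_digraph \<Rightarrow> 'e \<Rightarrow> ('v, 'e) fpath" where
  "epath E e \<equiv> (tail E e, [e])"

text \<open>The zero of the graph inverse semigroup is \<open>None\<close>.\<close>

type_synonym ('v, 'e) gis = "(('v, 'e) fpath \<times> ('v, 'e) fpath) option"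

definition gis :: "('v, 'e) pre_digraph \<Rightarrow> ('v, 'e) gis set" where
  "gis E = insert None
     {Some (\<alpha>, \<beta>) | \<alpha> \<beta>. \<alpha> \<in> FP E \<and> \<beta> \<in> FP E \<and> path_target E \<alpha> = path_target E \<beta>}"

text \<open>
  For finite paths, \<open>\<gamma> = \<beta>\<gamma>'\<close> for some \<open>\<gamma>'\<close> iff \<open>\<beta>\<close> and \<open>\<gamma>\<close> have the same initial vertex and
  the edges of \<open>\<beta>\<close> are a prefix of those of \<open>\<gamma>\<close>; \<open>\<gamma>'\<close> then consists of the remaining edges.
\<close>

fun gis_mult :: "('v, 'e) gis \<Rightarrow> ('v, 'e) gis \<Rightarrow> ('v, 'e) gis" where
  "gis_mult (Some (\<alpha>, \<beta>)) (Some (\<gamma>, \<delta>)) =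
     (if fst \<beta> = fst \<gamma> \<and> prefix (snd \<beta>) (snd \<gamma>)
        then Some ((fst \<alpha>, snd \<alpha> @ drop (length (snd \<beta>)) (snd \<gamma>)), \<delta>)
      else if fst \<beta> = fst \<gamma> \<and> prefix (snd \<gamma>) (snd \<beta>)
        then Some (\<alpha>, (fst \<delta>, snd \<delta> @ drop (length (snd \<gamma>)) (snd \<beta>)))
      else None)"
| "gis_mult _ _ = None"

fun gis_star :: "('v, 'e) gis \<Rightarrow> ('v, 'e) gis" where
  "gis_star (Some (\<alpha>, \<beta>)) = Some (\<beta>, \<alpha>)"
| "gis_star None = None"

definition gis_le :: "('v, 'e) gis \<Rightarrow> ('v, 'e) gis \<Rightarrow> bool" where
  "gis_le s t \<longleftrightarrow> gis_mult (gis_mult s (gis_star s)) t = s"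

definition ext_path_hom ::
    "('a, 'b) pre_digraph \<Rightarrow> ('c, 'd) pre_digraph \<Rightarrow> (('a, 'b) gis \<Rightarrow> ('c, 'd) gis) \<Rightarrow> bool" where
  "ext_path_hom E F \<phi> \<longleftrightarrow>
     \<phi> \<in> gis E \<rightarrow> gis F \<and>
     (\<forall>s \<in> gis E. \<forall>t \<in> gis E. \<phi> (gis_mult s t) = gis_mult (\<phi> s) (\<phi> t)) \<and>
     \<phi> None = None"

definition regular_ext_path_hom ::
    "('a, 'b) pre_digraph \<Rightarrow> ('c, 'd) pre_digraph \<Rightarrow> (('a, 'b) gis \<Rightarrow> ('c, 'd) gis) \<Rightarrow> bool" where
  "regular_ext_path_hom E F \<phi> \<longleftrightarrow>
     ext_path_hom E F \<phi> \<and>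
     (\<forall>u \<in> reg E. \<forall>t \<in> gis F. t \<noteq> None \<and> gis_le t (\<phi> (Some (vpath u, vpath u))) \<longrightarrow>
        (\<exists>e \<in> out_arcs E u. gis_mult t (\<phi> (Some (epath E e, epath E e))) \<noteq> None))"

fun S_path :: "('v, 'e) pre_digraph \<Rightarrow> ('v, 'e) fpath \<Rightarrow> ('v + 'e) cstar_elem" where
  "S_path E (u, []) = S_vert E u"
| "S_path E (u, [e]) = S_arc E e"
| "S_path E (u, e # e' # p) = S_arc E e \<otimes>\<^bsub>graph_cstar E\<^esub> S_path E (head E e, e' # p)"

fun S_gis :: "('v, 'e) pre_digraph \<Rightarrow> ('v, 'e) gis \<Rightarrow> ('v + 'e) cstar_elem" where
  "S_gis E (Some (\<alpha>, \<beta>)) = S_path E \<alpha> \<otimes>\<^bsub>graph_cstar E\<^esub> adj (graph_cstar E) (S_path E \<beta>)"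
| "S_gis E None = \<zero>\<^bsub>graph_cstar E\<^esub>"

definition is_pushforward ::
    "('a, 'b) pre_digraph \<Rightarrow> ('c, 'd) pre_digraph \<Rightarrow> (('a, 'b) gis \<Rightarrow> ('c, 'd) gis) \<Rightarrow>
     (('a + 'b) cstar_elem \<Rightarrow> ('c + 'd) cstar_elem) \<Rightarrow> bool" where
  "is_pushforward E F \<phi> h \<longleftrightarrow>
     star_hom (graph_cstar E) (graph_cstar F) h \<and>
     (\<forall>v \<in> verts E. h (S_vert E v) = S_gis F (\<phi> (Some (vpath v, vpath v)))) \<and>
     (\<forall>e \<in> arcs E. h (S_arc E e) = S_gis F (\<phi> (Some (epath E e, vpath (head E e)))))"


section \<open>Shifts\<close>

text \<open>
  The edges of the shifted graph live in an option type: \<open>Some e\<close> is the old edge \<open>e\<close>, and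
  \<open>None\<close> is the new edge from \<open>w\<close> to \<open>v\<close>.
\<close>

definition shift_graph ::
    "('v, 'e) pre_digraph \<Rightarrow> 'v \<Rightarrow> 'v \<Rightarrow> ('e \<Rightarrow> 'e) \<Rightarrow> ('v, 'e option) pre_digraph" where
  "shift_graph E v w \<theta> =
    \<lparr> verts = verts E,
      arcs = Some ` (arcs E - \<theta> ` out_arcs E v) \<union> {None},
      tail = case_option w (tail E),
      head = case_option v (head E) \<rparr>"

end

theory Submission
  imports Defs
begin

text \<open>
  Split \<open>v\<close> into copies \<open>v\<^sub>y\<close>, one for each edge \<open>y\<close> emitted by \<open>v\<close>, let \<open>y\<close> be the only edge that
  \<open>v\<^sub>y\<close> emits, and split the edges ending at \<open>v\<close> accordingly. The resulting graph \<open>G\<close> maps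
  admissibly onto the shifted graph, and the extended path homomorphism with \<open>v\<^sub>y \<mapsto> (y, y)\<close>,
  \<open>x\<^sub>y \<mapsto> (\<theta>(y), y)\<close> and \<open>e\<^sub>y \<mapsto> (ey, y)\<close> turns the sum \<open>\<Sum>\<^sub>y S\<^bsub>x\<^sub>y\<^esub>\<close>, which is the pullback of the new
  generator, into \<open>\<Sum>\<^sub>y S\<^bsub>\<theta>(y)\<^esub> S\<^sub>y\<^sup>*\<close>. So the composition agrees with \<open>f\<^sup>-\<^sup>1\<close> on generators. Since
  *-homomorphisms are only assumed to be algebraic, agreement everywhere needs that they are
  automatically continuous. For this, a *-homomorphism \<open>\<pi>\<close> satisfies \<open>\<parallel>\<pi>(x)\<parallel> \<le> 1\<close> whenever
  \<open>x = a\<^sup>* a\<close> has norm less than \<open>1\<close>: iterating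
  \<open>z \<mapsto> (x\<^sup>2 + z\<^sup>2)/2\<close> gives a self-adjoint \<open>z\<close> commuting with \<open>x\<close> such that
  \<open>x\<^sup>2 + (1 - z)\<^sup>2 = 1\<close>, an algebraic identity that \<open>\<pi>\<close> preserves and that exhibits \<open>\<pi>(x)\<close> as the
  mean of two unitaries.
\<close>

section \<open>The free *-algebra\<close>

text \<open>An extended path homomorphism sends an edge to a single element
  \<open>(\<alpha>, \<beta>)\<close>, whereas the inverse sends the new edge to a sum with one term
  per edge emitted by \<open>v\<close>. Pullbacks are what creates sums, so \<open>v\<close> needs
  one preimage per summand. As \<open>v\<close> is regular, its projection is the sum of the range
  projections of its edges, which dictates the image of each copy. Bijectivity of targets on fibres
  then forces every edge ending at \<open>v\<close> to be split, while \<open>y\<close> itself stays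
  a single edge because \<open>v\<close> emits no loop. The iteration aims at z = 1 - sqrt(1 - x^2).
  It needs neither a unit nor spectral theory: all iterates are polynomials without constant term,
  and the identity can be written x^2 + z^2 = 2z. Elements of the completion are accessible only
  through Cauchy sequences, on which such identities hold up to null sequences; the estimates are
  therefore stated with an error that tends to 0.\<close>

abbreviation sconst :: "complex \<Rightarrow> 'g star_poly" where
  "sconst c \<equiv> Poly_Mapping.single 0 c"

lemma star_poly_eq_sum:
  "(a :: 'g star_poly) = (\<Sum>w \<in> Poly_Mapping.keys a. Poly_Mapping.single w (Poly_Mapping.lookup a w))"
proof (rule poly_mapping_eqI)
  fix k
  show "Poly_Mapping.lookup a k = Poly_Mapping.lookup
    (\<Sum>w \<in> Poly_Mapping.keys a. Poly_Mapping.single w (Poly_Mapping.lookup a w)) k"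
    by (auto simp: lookup_sum lookup_single when_def in_keys_iff)
qed

text \<open>In the \<open>single\<close> case \<open>w\<close> is a word of \<open>a\<close> itself,
  so support conditions such as \<open>a \<in> star_polys X\<close> remain usable during the
  induction.\<close>

lemma star_poly_induct [case_names zero single add]:
  fixes a :: "'g star_poly"
  assumes "P 0"
    and "\<And>w c. w \<in> Poly_Mapping.keys a \<Longrightarrow> P (Poly_Mapping.single w c)"
    and "\<And>b c. P b \<Longrightarrow> P c \<Longrightarrow> P (b + c)"
  shows "P a"
proof -
  have "P (\<Sum>w \<in> W. Poly_Mapping.single w (Poly_Mapping.lookup a w))"
    if "finite W" "W \<subseteq> Poly_Mapping.keys a" for W
    using that by (induction W) (use assms in auto)
  then show ?thesis
    by (subst star_poly_eq_sum) simp
qed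

lemma sconst_central: "sconst c * a = a * sconst c"
proof (induction a rule: star_poly_induct)
  case (add b c)
  then show ?case by (simp add: algebra_simps)
qed (simp_all add: mult_single mult.commute)

lemma sconst_left_commute: "a * (sconst c * b) = sconst c * (a * b)"
  by (metis mult.assoc sconst_central)

text \<open>The constant sits at the empty word and is central, so scalar multiplication becomes
  ring multiplication and ring identities apply, although nonzero constants lie outside
  \<open>star_polys\<close>.\<close>

lemma poly_scale_conv: "poly_scale c a = sconst c * a"
  unfolding poly_scale_def by (rule mult_map_scale_conv_mult)

lemma poly_scale_simps [simp]:
  "poly_scale c 0 = 0" "poly_scale 0 a = 0" "poly_scale 1 a = a"
  "poly_scale (-1) a = - a"
  "poly_scale c (poly_scale d a) = poly_scale (c * d) a"
  by (simp_all add: poly_scale_conv single_uminus mult_single flip: mult.assoc)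

lemma poly_scale_diff: "poly_scale c (a - b) = poly_scale c a - poly_scale c b"
  and poly_scale_mult_left: "poly_scale c a * b = poly_scale c (a * b)"
  and poly_scale_mult_right: "a * poly_scale c b = poly_scale c (a * b)"
  by (simp_all add: poly_scale_conv algebra_simps sconst_left_commute)

lemma word_star_word_star [simp]: "word_star (word_star w) = w"
  by (cases w) (simp add: word_star_def rev_map o_def case_prod_beta)

lemma inj_word_star: "inj word_star"
  by (metis injI word_star_word_star)

lemma word_star_add: "word_star (w + w') = word_star w' + word_star w"
  by (simp add: word_star_def plus_star_word_def)

lemma lookup_poly_star:
  "Poly_Mapping.lookup (poly_star a) w = cnj (Poly_Mapping.lookup a (word_star w))"
  by (simp add: poly_star_def map.rep_eq map_key.rep_eq[OF inj_word_star] when_def)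

lemma poly_star_add: "poly_star (a + b) = poly_star a + poly_star b"
  and poly_star_diff: "poly_star (a - b) = poly_star a - poly_star b"
  and poly_star_0 [simp]: "poly_star 0 = 0"
  and poly_star_poly_star [simp]: "poly_star (poly_star a) = a"
  by (rule poly_mapping_eqI, simp add: lookup_poly_star lookup_add lookup_minus)+

lemma poly_star_single:
  "poly_star (Poly_Mapping.single w c) = Poly_Mapping.single (word_star w) (cnj c)"
  by (rule poly_mapping_eqI)
    (use inj_word_star in \<open>auto simp: lookup_poly_star lookup_single when_def\<close>)

lemma poly_star_sum: "poly_star (\<Sum>i \<in> I. a i) = (\<Sum>i \<in> I. poly_star (a i))"
  by (induction I rule: infinite_finite_induct) (simp_all add: poly_star_add)

lemma poly_star_mult: "poly_star (a * b) = poly_star b * poly_star a"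
proof (induction a rule: star_poly_induct)
  case (single w c)
  show ?case
    by (induction b rule: star_poly_induct)
      (simp_all add: poly_star_add poly_star_single mult_single word_star_add algebra_simps)
qed (simp_all add: poly_star_add algebra_simps)

lemma poly_star_sconst: "poly_star (sconst c) = sconst (cnj c)"
  by (simp add: poly_star_single word_star_def zero_star_word_def)

lemma poly_star_scale: "poly_star (poly_scale c a) = poly_scale (cnj c) (poly_star a)"
  by (simp add: poly_scale_conv poly_star_mult poly_star_sconst sconst_central)

definition star_words :: "'g set \<Rightarrow> 'g star_word set" where
  "star_words X = {w. letters w \<noteq> [] \<and> fst ` set (letters w) \<subseteq> X}"

lemma star_polys_iff: "a \<in> star_polys X \<longleftrightarrow> Poly_Mapping.keys a \<subseteq> star_words X"
  by (auto simp: star_polys_def star_words_def)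

lemma star_polys_0 [simp]: "0 \<in> star_polys X"
  by (simp add: star_polys_def)

lemma star_polys_add [intro]: "a \<in> star_polys X \<Longrightarrow> b \<in> star_polys X \<Longrightarrow> a + b \<in> star_polys X"
  using keys_add[of a b] by (auto simp: star_polys_iff)

lemma star_polys_minus [intro]: "a \<in> star_polys X \<Longrightarrow> - a \<in> star_polys X"
  by (simp add: star_polys_def in_keys_iff)

lemma star_polys_diff [intro]: "a \<in> star_polys X \<Longrightarrow> b \<in> star_polys X \<Longrightarrow> a - b \<in> star_polys X"
  by (metis star_polys_add star_polys_minus diff_conv_add_uminus)

lemma star_polys_mult [intro]: "a \<in> star_polys X \<Longrightarrow> b \<in> star_polys X \<Longrightarrow> a * b \<in> star_polys X"
  using keys_mult[of a b] unfolding star_polys_iff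
  by (fastforce simp: star_words_def plus_star_word_def)

lemma star_polys_scale [intro]: "a \<in> star_polys X \<Longrightarrow> poly_scale c a \<in> star_polys X"
  by (force simp: star_polys_def in_keys_iff poly_scale_def map.rep_eq when_def split: if_splits)

lemma star_words_word_star: "word_star w \<in> star_words X \<Longrightarrow> w \<in> star_words X"
  by (force simp: star_words_def word_star_def)

lemma star_polys_star [intro]: "a \<in> star_polys X \<Longrightarrow> poly_star a \<in> star_polys X"
  by (auto simp: star_polys_iff in_keys_iff lookup_poly_star intro: star_words_word_star)

lemma star_polys_sum [intro]: "(\<And>i. i \<in> I \<Longrightarrow> a i \<in> star_polys X) \<Longrightarrow> (\<Sum>i \<in> I. a i) \<in> star_polys X"
  by (induction I rule: infinite_finite_induct) auto

lemma star_polys_gen [intro]: "x \<in> X \<Longrightarrow> gen x \<in> star_polys X"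
  by (simp add: star_polys_def gen_def)

section \<open>Evaluation of star polynomials\<close>

definition letter_poly :: "('g \<Rightarrow> 'h star_poly) \<Rightarrow> 'g \<times> bool \<Rightarrow> 'h star_poly" where
  "letter_poly y = (\<lambda>(x, b). if b then poly_star (y x) else y x)"

definition word_subst :: "('g \<Rightarrow> 'h star_poly) \<Rightarrow> 'g star_word \<Rightarrow> 'h star_poly" where
  "word_subst y w = prod_list (map (letter_poly y) (letters w))"

text \<open>This is the star homomorphism of the free algebra extending \<open>y\<close>. The empty
  word evaluates to 1, which makes it multiplicative on the whole convolution ring, constants
  included.\<close>

definition subst :: "('g \<Rightarrow> 'h star_poly) \<Rightarrow> 'g star_poly \<Rightarrow> 'h star_poly" where
  "subst y a = (\<Sum>w \<in> Poly_Mapping.keys a. poly_scale (Poly_Mapping.lookup a w) (word_subst y w))"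

lemma subst_superset:
  assumes "finite W" "Poly_Mapping.keys a \<subseteq> W"
  shows "subst y a = (\<Sum>w \<in> W. poly_scale (Poly_Mapping.lookup a w) (word_subst y w))"
  unfolding subst_def using assms by (intro sum.mono_neutral_left) (auto simp: in_keys_iff)

lemma subst_0 [simp]: "subst y 0 = 0"
  by (simp add: subst_def)

lemma subst_add: "subst y (a + b) = subst y a + subst y b"
proof -
  let ?W = "Poly_Mapping.keys a \<union> Poly_Mapping.keys b"
  have "subst y c = (\<Sum>w \<in> ?W. poly_scale (Poly_Mapping.lookup c w) (word_subst y w))"
    if "c \<in> {a, b, a + b}" for c
    by (rule subst_superset) (use that keys_add[of a b] in auto)
  then show ?thesis
    by (simp add: lookup_add sum.distrib poly_scale_conv single_add algebra_simps)
qed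

lemma subst_single: "subst y (Poly_Mapping.single w c) = poly_scale c (word_subst y w)"
  by (subst subst_superset[of "{w}"]) auto

lemma subst_mult: "subst y (a * b) = subst y a * subst y b"
proof (induction a rule: star_poly_induct)
  case (single w c)
  show ?case
    by (induction b rule: star_poly_induct)
      (simp_all add: subst_add subst_single mult_single word_subst_def plus_star_word_def
        poly_scale_mult_left poly_scale_mult_right algebra_simps)
qed (simp_all add: subst_add algebra_simps)

lemma subst_scale: "subst y (poly_scale c a) = poly_scale c (subst y a)"
  by (simp add: poly_scale_conv subst_mult subst_single word_subst_def zero_star_word_def)

lemma subst_diff: "subst y (a - b) = subst y a - subst y b"
  by (metis add_diff_cancel diff_add_cancel subst_add)

lemma subst_sum: "subst y (\<Sum>i \<in> I. a i) = (\<Sum>i \<in> I. subst y (a i))"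
  by (induction I rule: infinite_finite_induct) (simp_all add: subst_add)

lemma subst_gen [simp]: "subst y (gen x) = y x"
  by (simp add: gen_def subst_single word_subst_def letter_poly_def)

lemma word_subst_star: "word_subst y (word_star w) = poly_star (word_subst y w)"
proof -
  have "prod_list (map (letter_poly y) (rev (map (\<lambda>(x, b). (x, \<not> b)) l)))
      = poly_star (prod_list (map (letter_poly y) l))" for l
    by (induction l) (auto simp: letter_poly_def poly_star_mult poly_star_sconst[of 1, simplified])
  then show ?thesis
    by (simp add: word_subst_def word_star_def)
qed

lemma subst_star: "subst y (poly_star a) = poly_star (subst y a)"
  by (induction a rule: star_poly_induct)
    (simp_all add: subst_add poly_star_add poly_star_single subst_single word_subst_star
      poly_star_scale)

text \<open>An empty product would be 1, which \<open>star_polys\<close> excludes; hence the case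
  split on the tail.\<close>

lemma prod_list_star_polys:
  "l \<noteq> [] \<Longrightarrow> set l \<subseteq> star_polys X \<Longrightarrow> prod_list l \<in> star_polys X"
proof (induction l)
  case (Cons a l)
  then show ?case by (cases l) auto
qed simp

lemma subst_star_polys:
  assumes "\<And>x. x \<in> X \<Longrightarrow> y x \<in> star_polys Y" and "a \<in> star_polys X"
  shows "subst y a \<in> star_polys Y"
  unfolding subst_def
proof (intro star_polys_sum star_polys_scale)
  fix w assume "w \<in> Poly_Mapping.keys a"
  with assms show "word_subst y w \<in> star_polys Y"
    unfolding word_subst_def
    by (intro prod_list_star_polys) (fastforce simp: star_polys_def[of X] letter_poly_def)+
qed

lemma star_polys_induct [consumes 1, case_names gen star mult scale add zero]:
  assumes "a \<in> star_polys X"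
    and "\<And>x. x \<in> X \<Longrightarrow> P (gen x)"
    and "\<And>a. a \<in> star_polys X \<Longrightarrow> P a \<Longrightarrow> P (poly_star a)"
    and "\<And>a b. a \<in> star_polys X \<Longrightarrow> b \<in> star_polys X \<Longrightarrow> P a \<Longrightarrow> P b \<Longrightarrow> P (a * b)"
    and "\<And>c a. a \<in> star_polys X \<Longrightarrow> P a \<Longrightarrow> P (poly_scale c a)"
    and "\<And>a b. a \<in> star_polys X \<Longrightarrow> b \<in> star_polys X \<Longrightarrow> P a \<Longrightarrow> P b \<Longrightarrow> P (a + b)"
    and "P 0"
  shows "P a"
proof -
  \<comment> \<open>Membership is carried along with \<open>P\<close> because the product and sum
    hypotheses ask for it on both operands.\<close>
  define Q where "Q a \<longleftrightarrow> a \<in> star_polys X \<and> P a" for a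
  have letter: "Q (Poly_Mapping.single (Star_Word [l]) 1)" if "fst l \<in> X" for l
  proof -
    obtain x b where l: "l = (x, b)" by force
    have "poly_star (gen x) = Poly_Mapping.single (Star_Word [(x, True)]) 1"
      by (simp add: gen_def poly_star_single word_star_def)
    with that l show ?thesis
      using assms(2)[of x] assms(3)[of "gen x"] star_polys_gen[of x X] star_polys_star[of "gen x" X]
      by (cases b) (auto simp: Q_def gen_def)
  qed
  have word: "Q (Poly_Mapping.single (Star_Word l) 1)" if "l \<noteq> []" "fst ` set l \<subseteq> X" for l
    using that
  proof (induction l rule: list_nonempty_induct)
    case (cons x xs)
    have "Poly_Mapping.single (Star_Word (x # xs)) 1
        = Poly_Mapping.single (Star_Word [x]) 1 * Poly_Mapping.single (Star_Word xs) (1::complex)"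
      by (simp add: mult_single plus_star_word_def)
    then show ?case
      using cons letter[of x] assms(4) by (auto simp: Q_def)
  qed (use letter in auto)
  have "Q a"
  proof (induction a rule: star_poly_induct)
    case (single w c)
    then have "Q (Poly_Mapping.single w 1)"
      using word[of "letters w"] assms(1) by (auto simp: star_polys_def)
    then have "Q (poly_scale c (Poly_Mapping.single w 1))"
      using assms(5) by (auto simp: Q_def)
    then show ?case by (simp add: poly_scale_conv mult_single)
  qed (use assms in \<open>auto simp: Q_def\<close>)
  then show ?thesis by (simp add: Q_def)
qed

section \<open>Universal C*-algebras\<close>

locale star_seminorm =
  fixes X :: "'g set" and p :: "'g star_poly \<Rightarrow> real"
  assumes seminorm: "cstar_seminorm X p"
begin

lemma nonneg: "a \<in> star_polys X \<Longrightarrow> 0 \<le> p a"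
  and triangle: "a \<in> star_polys X \<Longrightarrow> b \<in> star_polys X \<Longrightarrow> p (a + b) \<le> p a + p b"
  and scale: "a \<in> star_polys X \<Longrightarrow> p (poly_scale c a) = cmod c * p a"
  and submult: "a \<in> star_polys X \<Longrightarrow> b \<in> star_polys X \<Longrightarrow> p (a * b) \<le> p a * p b"
  and cstar: "a \<in> star_polys X \<Longrightarrow> p (poly_star a * a) = (p a)\<^sup>2"
  using seminorm by (simp_all add: cstar_seminorm_def)

lemma zero [simp]: "p 0 = 0"
  using scale[of 0 0] by simp

lemma minus: "a \<in> star_polys X \<Longrightarrow> p (- a) = p a"
  using scale[of a "-1"] by simp

lemma minus_commute:
  "a \<in> star_polys X \<Longrightarrow> b \<in> star_polys X \<Longrightarrow> p (a - b) = p (b - a)"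
  using minus[of "a - b"] by (simp add: star_polys_diff)

lemma triangle_diff:
  assumes "a \<in> star_polys X" "b \<in> star_polys X" "c \<in> star_polys X"
  shows "p (a - c) \<le> p (a - b) + p (b - c)"
  using triangle[of "a - b" "b - c"] assms by (simp add: star_polys_diff)

lemma diff_le:
  assumes "a \<in> star_polys X" "b \<in> star_polys X"
  shows "p (a - b) \<le> p a + p b"
  using triangle[of a "- b"] assms by (simp add: minus star_polys_minus)

lemma reverse_triangle:
  assumes "a \<in> star_polys X" "b \<in> star_polys X"
  shows "\<bar>p a - p b\<bar> \<le> p (a - b)"
  using triangle[of "a - b" b] triangle[of "b - a" a] minus_commute[of a b] assms
  by (simp add: star_polys_diff abs_le_iff)

lemma star [simp]:
  assumes "a \<in> star_polys X"
  shows "p (poly_star a) = p a"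
proof -
  \<comment> \<open>The C*-identity bounds the square of \<open>p b\<close> by
    \<open>p (poly_star b) * p b\<close>; using this for \<open>poly_star b\<close> as well gives
    equality.\<close>
  have le: "p b \<le> p (poly_star b)" if b: "b \<in> star_polys X" for b
  proof (cases "p b = 0")
    case False
    then have "p b > 0" using nonneg[OF b] by simp
    moreover have "p b * p b \<le> p (poly_star b) * p b"
      using cstar[OF b] submult[of "poly_star b" b] b by (simp add: power2_eq_square star_polys_star)
    ultimately show ?thesis by simp
  qed (use nonneg b star_polys_star in auto)
  show ?thesis
    using le[OF assms] le[OF star_polys_star[OF assms]] by simp
qed

lemma mult_diff_le:
  assumes "a \<in> star_polys X" "b \<in> star_polys X" "a' \<in> star_polys X" "b' \<in> star_polys X"
  shows "p (a * b - a' * b') \<le> p a * p (b - b') + p (a - a') * p b'"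
proof -
  have "a * b - a' * b' = a * (b - b') + (a - a') * b'"
    by (simp add: algebra_simps)
  then have "p (a * b - a' * b') \<le> p (a * (b - b')) + p ((a - a') * b')"
    using triangle[of "a * (b - b')" "(a - a') * b'"] assms by (simp add: star_polys_diff star_polys_mult)
  also have "\<dots> \<le> p a * p (b - b') + p (a - a') * p b'"
    using assms by (intro add_mono submult) (auto simp: star_polys_diff)
  finally show ?thesis .
qed

text \<open>Equality modulo the kernel of \<open>p\<close>. Building in membership lets the
  congruence and transitivity rules propagate it without extra premises.\<close>

definition eqv :: "'g star_poly \<Rightarrow> 'g star_poly \<Rightarrow> bool" (infix \<open>\<approx>\<close> 50) where
  "a \<approx> b \<longleftrightarrow> a \<in> star_polys X \<and> b \<in> star_polys X \<and> p (a - b) = 0"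

lemma eqv_refl [simp, intro]: "a \<in> star_polys X \<Longrightarrow> a \<approx> a"
  by (simp add: eqv_def)

lemma eqv_sym: "a \<approx> b \<Longrightarrow> b \<approx> a"
  by (simp add: eqv_def minus_commute)

lemma eqv_trans [trans]: "a \<approx> b \<Longrightarrow> b \<approx> c \<Longrightarrow> a \<approx> c"
  using triangle_diff[of a b c] nonneg[of "a - c"] by (simp add: eqv_def star_polys_diff)

lemma eqv_add:
  assumes "a \<approx> a'" "b \<approx> b'" shows "a + b \<approx> a' + b'"
  using triangle[of "a - a'" "b - b'"] nonneg[of "a + b - (a' + b')"] assms
  by (simp add: eqv_def star_polys_diff star_polys_add algebra_simps)

lemma eqv_mult:
  assumes "a \<approx> a'" "b \<approx> b'" shows "a * b \<approx> a' * b'"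
  using mult_diff_le[of a b a' b'] nonneg[of "a * b - a' * b'"] assms
  by (simp add: eqv_def star_polys_diff star_polys_mult)

lemma eqv_star: "a \<approx> b \<Longrightarrow> poly_star a \<approx> poly_star b"
  using star[of "a - b"] by (simp add: eqv_def poly_star_diff star_polys_diff star_polys_star)

lemma eqv_sum: "(\<And>i. i \<in> I \<Longrightarrow> a i \<approx> b i) \<Longrightarrow> (\<Sum>i \<in> I. a i) \<approx> (\<Sum>i \<in> I. b i)"
  by (induction I rule: infinite_finite_induct) (auto intro: eqv_add)

lemma eqv_0_sum: "(\<And>i. i \<in> I \<Longrightarrow> a i \<approx> 0) \<Longrightarrow> (\<Sum>i \<in> I. a i) \<approx> 0"
  using eqv_sum[of I a "\<lambda>_. 0"] by simp

lemma eqv_mult_0_left: "a \<approx> 0 \<Longrightarrow> b \<in> star_polys X \<Longrightarrow> a * b \<approx> 0"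
  and eqv_mult_0_right: "b \<approx> 0 \<Longrightarrow> a \<in> star_polys X \<Longrightarrow> a * b \<approx> 0"
  using eqv_mult[of a 0 b b] eqv_mult[of a a b 0] by auto

lemma eqv_diff_0: "a \<approx> b \<Longrightarrow> p (a - b) = 0"
  by (simp add: eqv_def)

lemma eqvI: "a \<in> star_polys X \<Longrightarrow> b \<in> star_polys X \<Longrightarrow> p (a - b) = 0 \<Longrightarrow> a \<approx> b"
  by (simp add: eqv_def)

end

definition cstar_class :: "'g set \<Rightarrow> 'g star_poly set \<Rightarrow> (nat \<Rightarrow> 'g star_poly) \<Rightarrow> 'g cstar_elem" where
  "cstar_class X R s = cauchy_rel X R `` {s}"

definition cstar_const :: "'g set \<Rightarrow> 'g star_poly set \<Rightarrow> 'g star_poly \<Rightarrow> 'g cstar_elem" where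
  "cstar_const X R a = cstar_class X R (\<lambda>_. a)"

lemma universal_gen_eq_const: "universal_gen X R x = cstar_const X R (gen x)"
  by (simp add: universal_gen_def cstar_const_def cstar_class_def)

locale cstar_presentation =
  fixes X :: "'g set" and R :: "'g star_poly set"
  assumes bounded: "\<And>a. a \<in> star_polys X \<Longrightarrow>
    bdd_above {p a | p. cstar_seminorm X p \<and> (\<forall>r \<in> R. p r = 0)}"
begin

abbreviation "N \<equiv> universal_norm X R"
abbreviation "A \<equiv> universal_cstar X R"

lemma le_universal_norm:
  "a \<in> star_polys X \<Longrightarrow> cstar_seminorm X p \<Longrightarrow> (\<And>r. r \<in> R \<Longrightarrow> p r = 0) \<Longrightarrow> p a \<le> N a"
  unfolding universal_norm_def by (rule cSup_upper[OF _ bounded]) auto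

text \<open>A real supremum is meaningful only for a nonempty set, and the zero seminorm satisfies
  all relations; it also shows that the universal norm is nonnegative.\<close>

lemma cstar_seminorm_0: "cstar_seminorm X (\<lambda>_. 0)"
  by (simp add: cstar_seminorm_def)

lemma universal_norm_le:
  assumes "\<And>p. cstar_seminorm X p \<Longrightarrow> (\<And>r. r \<in> R \<Longrightarrow> p r = 0) \<Longrightarrow> p a \<le> c"
  shows "N a \<le> c"
  unfolding universal_norm_def using cstar_seminorm_0 assms by (intro cSup_least) auto

lemma universal_norm_rel:
  assumes "r \<in> R" shows "N r = 0"
proof -
  have "{p r | p. cstar_seminorm X p \<and> (\<forall>r \<in> R. p r = 0)} = {0}"
    using assms cstar_seminorm_0 by force
  then show ?thesis by (simp add: universal_norm_def)
qed

text \<open>Inequalities pass to the supremum directly. The two axioms that are equalities need a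
  converse estimate: scaling back by the inverse scalar, and taking square roots before the supremum
  in the C*-identity.\<close>

lemma cstar_seminorm_universal_norm: "cstar_seminorm X N"
  unfolding cstar_seminorm_def
proof (intro conjI ballI allI)
  fix a assume a: "a \<in> star_polys X"
  show N0: "0 \<le> N a"
    using le_universal_norm[OF a cstar_seminorm_0] by simp
  have scale: "N (poly_scale c b) \<le> cmod c * N b" if "b \<in> star_polys X" for c b
    by (rule universal_norm_le)
      (use that in \<open>simp add: star_seminorm.scale star_seminorm_def le_universal_norm mult_left_mono\<close>)
  show "N (poly_scale c a) = cmod c * N a" for c
  proof (cases "c = 0")
    case True
    have "0 \<le> N 0" using le_universal_norm[OF star_polys_0 cstar_seminorm_0] by simp
    then show ?thesis
      using scale[OF a, of 0] True by simp
  next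
    case False
    have "N a \<le> cmod (inverse c) * N (poly_scale c a)"
      using scale[of "poly_scale c a" "inverse c"] a False by (simp add: star_polys_scale)
    then have "cmod c * N a \<le> N (poly_scale c a)"
      using False by (simp add: norm_divide field_simps)
    with scale[OF a, of c] show ?thesis by simp
  qed
  have "N (poly_star a * a) \<le> (N a)\<^sup>2"
    by (rule universal_norm_le)
      (use a in \<open>auto simp: star_seminorm.cstar star_seminorm.nonneg star_seminorm_def
        le_universal_norm power_mono\<close>)
  moreover have "N a \<le> sqrt (N (poly_star a * a))"
  proof (rule universal_norm_le)
    fix p assume p: "cstar_seminorm X p" "\<And>r. r \<in> R \<Longrightarrow> p r = 0"
    interpret star_seminorm X p using p by unfold_locales
    have "(p a)\<^sup>2 \<le> N (poly_star a * a)"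
      using le_universal_norm[of "poly_star a * a" p] p a cstar[OF a]
      by (auto simp: star_polys_mult star_polys_star)
    then show "p a \<le> sqrt (N (poly_star a * a))" by (rule real_le_rsqrt)
  qed
  ultimately show "N (poly_star a * a) = (N a)\<^sup>2"
    using N0 by (metis antisym real_sqrt_ge_0_iff order_trans real_sqrt_le_iff real_sqrt_abs abs_of_nonneg)
  fix b assume b: "b \<in> star_polys X"
  show "N (a + b) \<le> N a + N b"
  proof (rule universal_norm_le)
    fix p assume p: "cstar_seminorm X p" "\<And>r. r \<in> R \<Longrightarrow> p r = 0"
    then show "p (a + b) \<le> N a + N b"
      using star_seminorm.triangle[of X p a b] le_universal_norm[of a p] le_universal_norm[of b p] a b
      by (force simp: star_seminorm_def)
  qed
  show "N (a * b) \<le> N a * N b"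
  proof (rule universal_norm_le)
    fix p assume p: "cstar_seminorm X p" "\<And>r. r \<in> R \<Longrightarrow> p r = 0"
    interpret star_seminorm X p using p by unfold_locales
    have "p (a * b) \<le> p a * p b" using submult a b .
    also have "\<dots> \<le> N a * N b"
      using p a b N0 nonneg by (auto intro!: mult_mono le_universal_norm)
    finally show "p (a * b) \<le> N a * N b" .
  qed
qed

sublocale star_seminorm X N
  by unfold_locales (rule cstar_seminorm_universal_norm)

notation eqv (infix \<open>\<approx>\<close> 50)

section \<open>Cauchy sequences and the operations of the completion\<close>

abbreviation "C \<equiv> cauchy_seqs X R"
abbreviation "cls \<equiv> cstar_class X R"
abbreviation "cst \<equiv> cstar_const X R"

lemma seqs_polys: "s \<in> C \<Longrightarrow> s n \<in> star_polys X"
  by (simp add: cauchy_seqs_def)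

lemma seqs_Cauchy: "s \<in> C \<Longrightarrow> 0 < \<epsilon> \<Longrightarrow> \<exists>M. \<forall>m\<ge>M. \<forall>n\<ge>M. N (s m - s n) < \<epsilon>"
  by (simp add: cauchy_seqs_def)

lemma seqsI:
  assumes "\<And>n. s n \<in> star_polys X"
    and "\<And>\<epsilon>. 0 < \<epsilon> \<Longrightarrow> \<exists>M. \<forall>m\<ge>M. \<forall>n\<ge>M. N (s m - s n) < \<epsilon>"
  shows "s \<in> C"
  using assms by (simp add: cauchy_seqs_def)

lemma seqs_const [intro]: "a \<in> star_polys X \<Longrightarrow> (\<lambda>_. a) \<in> C"
  by (rule seqsI) auto

lemma seqs_bounded:
  assumes "s \<in> C"
  obtains B where "0 < B" "\<And>n. N (s n) \<le> B"
proof -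
  obtain M where M: "\<forall>m\<ge>M. \<forall>n\<ge>M. N (s m - s n) < 1"
    using seqs_Cauchy[OF assms, of 1] by auto
  define B where "B = Max ((\<lambda>n. N (s n)) ` {..M}) + 1"
  have B: "N (s n) \<le> B - 1" if "n \<le> M" for n
    unfolding B_def using that by (auto intro!: Max_ge)
  have "N (s n) \<le> B" for n
  proof (cases "n \<le> M")
    case False
    then have "N (s n - s M) < 1" using M by auto
    then show ?thesis
      using reverse_triangle[of "s n" "s M"] B[of M] seqs_polys[OF assms] by force
  qed (use B in force)
  moreover have "0 < B"
    using B[of 0] nonneg[OF seqs_polys[OF assms, of 0]] by simp
  ultimately show ?thesis using that by blast
qed

lemma seqs_norm_convergent:
  assumes "s \<in> C"
  obtains l where "(\<lambda>n. N (s n)) \<longlonglongrightarrow> l"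
proof -
  have "Cauchy (\<lambda>n. N (s n))"
  proof (rule metric_CauchyI)
    fix e :: real assume "0 < e"
    with seqs_Cauchy[OF assms] obtain M where M: "\<forall>m\<ge>M. \<forall>n\<ge>M. N (s m - s n) < e"
      by blast
    have "dist (N (s m)) (N (s n)) \<le> N (s m - s n)" for m n
      using reverse_triangle seqs_polys[OF assms] by (simp add: dist_real_def)
    with M show "\<exists>M. \<forall>m\<ge>M. \<forall>n\<ge>M. dist (N (s m)) (N (s n)) < e"
      by (meson le_less_trans)
  qed
  then show ?thesis using that by (auto simp: Cauchy_convergent_iff convergent_def)
qed

text \<open>A joint Lipschitz bound suffices; unary operations are covered by letting
  \<open>t\<close> be constantly 0.\<close>

lemma seqs_map2:
  assumes "s \<in> C" "t \<in> C" and "0 \<le> K"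
    and "\<And>n. F n \<in> star_polys X"
    and "\<And>m n. N (F m - F n) \<le> K * (N (s m - s n) + N (t m - t n))"
  shows "F \<in> C"
proof (rule seqsI)
  fix \<epsilon> :: real assume "0 < \<epsilon>"
  \<comment> \<open>The summand 1 keeps the denominator positive when \<open>K = 0\<close>; the
    factor 2 serves the two differences.\<close>
  define \<delta> where "\<delta> = \<epsilon> / (2 * (K + 1))"
  have d: "0 < \<delta>" using \<open>0 < \<epsilon>\<close> assms(3) by (simp add: \<delta>_def)
  obtain M1 M2 where M: "\<forall>m\<ge>M1. \<forall>n\<ge>M1. N (s m - s n) < \<delta>" "\<forall>m\<ge>M2. \<forall>n\<ge>M2. N (t m - t n) < \<delta>"
    using seqs_Cauchy d assms by metis
  have "N (F m - F n) < \<epsilon>" if "m \<ge> max M1 M2" "n \<ge> max M1 M2" for m n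
  proof -
    have "N (F m - F n) \<le> K * (N (s m - s n) + N (t m - t n))" by (rule assms)
    also have "N (s m - s n) + N (t m - t n) \<le> 2 * \<delta>"
      using M that by (smt (verit) max.boundedE)
    then have "K * (N (s m - s n) + N (t m - t n)) \<le> K * (2 * \<delta>)"
      using assms(3) by (rule mult_left_mono)
    also have "\<dots> < (K + 1) * (2 * \<delta>)" using d by simp
    also have "\<dots> = \<epsilon>"
      using assms(3) by (simp add: \<delta>_def divide_eq_eq)
    finally show ?thesis .
  qed
  then show "\<exists>M. \<forall>m\<ge>M. \<forall>n\<ge>M. N (F m - F n) < \<epsilon>" by blast
qed (rule assms)

lemma seqs_add [intro]:
  assumes "s \<in> C" "t \<in> C" shows "(\<lambda>n. s n + t n) \<in> C"
proof (rule seqs_map2[OF assms, of 1])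
  show "N (s m + t m - (s n + t n)) \<le> 1 * (N (s m - s n) + N (t m - t n))" for m n
    using triangle[of "s m - s n" "t m - t n"] assms
    by (simp add: seqs_polys star_polys_diff algebra_simps)
qed (auto simp: assms seqs_polys)

lemma seqs_mult [intro]:
  assumes "s \<in> C" "t \<in> C" shows "(\<lambda>n. s n * t n) \<in> C"
proof -
  obtain B B' where B: "0 < B" "\<And>n. N (s n) \<le> B" "0 < B'" "\<And>n. N (t n) \<le> B'"
    using seqs_bounded assms by metis
  show ?thesis
  proof (rule seqs_map2[OF assms, of "max B B'"])
    fix m n
    have "N (s m * t m - s n * t n) \<le> N (s m) * N (t m - t n) + N (s m - s n) * N (t n)"
      by (rule mult_diff_le) (auto simp: assms seqs_polys)
    also have "\<dots> \<le> max B B' * N (t m - t n) + N (s m - s n) * max B B'"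
      using B assms by (intro add_mono mult_right_mono mult_left_mono)
        (auto simp: seqs_polys star_polys_diff nonneg le_max_iff_disj)
    finally show "N (s m * t m - s n * t n) \<le> max B B' * (N (s m - s n) + N (t m - t n))"
      by (simp add: algebra_simps)
  qed (use B assms in \<open>auto simp: seqs_polys\<close>)
qed

lemma seqs_scale [intro]:
  assumes "s \<in> C" shows "(\<lambda>n. poly_scale c (s n)) \<in> C"
  by (rule seqs_map2[OF assms seqs_const[OF star_polys_0], of "cmod c"])
    (auto simp: assms seqs_polys star_polys_diff scale simp flip: poly_scale_diff)

lemma seqs_star [intro]:
  assumes "s \<in> C" shows "(\<lambda>n. poly_star (s n)) \<in> C"
  by (rule seqs_map2[OF assms seqs_const[OF star_polys_0], of 1])
    (auto simp: assms seqs_polys star_polys_diff simp flip: poly_star_diff)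

lemma seqs_minus [intro]:
  assumes "s \<in> C" shows "(\<lambda>n. - s n) \<in> C"
  using seqs_scale[OF assms, of "-1"] by simp

lemma seqs_diff [intro]:
  assumes "s \<in> C" "t \<in> C" shows "(\<lambda>n. s n - t n) \<in> C"
  using seqs_add[OF assms(1) seqs_minus[OF assms(2)]] by simp

lemma rel_iff: "(s, t) \<in> cauchy_rel X R \<longleftrightarrow> s \<in> C \<and> t \<in> C \<and> (\<lambda>n. N (s n - t n)) \<longlonglongrightarrow> 0"
  by (simp add: cauchy_rel_def)

lemma null_squeeze:
  assumes "\<And>n. s n \<in> star_polys X" "\<And>n. N (s n) \<le> f n" "f \<longlonglongrightarrow> 0"
  shows "(\<lambda>n. N (s n)) \<longlonglongrightarrow> 0"
  by (rule real_tendsto_sandwich[OF _ _ tendsto_const assms(3)])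
    (use assms nonneg in \<open>auto intro!: always_eventually\<close>)

lemma equiv_rel: "equiv C (cauchy_rel X R)"
proof (rule equivI)
  show "cauchy_rel X R \<subseteq> C \<times> C" by (auto simp: cauchy_rel_def)
  show "refl_on C (cauchy_rel X R)" by (auto simp: refl_on_def rel_iff)
  show "sym (cauchy_rel X R)"
    by (rule symI) (simp add: rel_iff minus_commute seqs_polys)
  show "trans (cauchy_rel X R)"
  proof (rule transI)
    fix s t u assume *: "(s, t) \<in> cauchy_rel X R" "(t, u) \<in> cauchy_rel X R"
    have "(\<lambda>n. N (s n - t n) + N (t n - u n)) \<longlonglongrightarrow> 0"
      using * by (auto simp: rel_iff intro: tendsto_add_zero)
    then have "(\<lambda>n. N (s n - u n)) \<longlonglongrightarrow> 0"
      using * triangle_diff by (intro null_squeeze) (auto simp: rel_iff seqs_polys)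
    with * show "(s, u) \<in> cauchy_rel X R" by (simp add: rel_iff)
  qed
qed

lemma cls_eq_iff:
  "s \<in> C \<Longrightarrow> t \<in> C \<Longrightarrow> cls s = cls t \<longleftrightarrow> (\<lambda>n. N (s n - t n)) \<longlonglongrightarrow> 0"
  using eq_equiv_class_iff[OF equiv_rel] by (simp add: cstar_class_def rel_iff)

lemma carrierE:
  assumes "x \<in> carrier A"
  obtains s where "s \<in> C" "x = cls s"
  using assms by (auto simp: universal_cstar_def cstar_class_def elim: quotientE)

lemma cls_carrier [intro]: "s \<in> C \<Longrightarrow> cls s \<in> carrier A"
  by (auto simp: universal_cstar_def cstar_class_def intro: quotientI)

lemma cst_carrier [intro]: "a \<in> star_polys X \<Longrightarrow> cst a \<in> carrier A"
  by (auto simp: cstar_const_def)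

text \<open>The operations of \<open>universal_cstar\<close> are unions over all representatives;
  once they are well defined, the union collapses to the value at one representative.\<close>

lemma cls_UN:
  assumes "s \<in> C" and "\<And>t. t \<in> C \<Longrightarrow> cls s = cls t \<Longrightarrow> F t = F s"
  shows "(\<Union>t \<in> cls s. F t) = F s"
proof -
  have "s \<in> cls s" using assms(1) equiv_class_self[OF equiv_rel] by (simp add: cstar_class_def)
  moreover have "F t = F s" if "t \<in> cls s" for t
  proof (rule assms(2))
    have "(s, t) \<in> cauchy_rel X R" using that by (simp add: cstar_class_def)
    then show "t \<in> C" "cls s = cls t"
      using equiv_class_eq[OF equiv_rel] by (simp_all add: rel_iff cstar_class_def)
  qed
  ultimately show ?thesis by blast
qed

lemma smult_cls: "s \<in> C \<Longrightarrow> c \<odot>\<^bsub>A\<^esub> cls s = cls (\<lambda>n. poly_scale c (s n))"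
  unfolding universal_cstar_def module.simps cstar_class_def[symmetric]
proof (rule cls_UN)
  fix t assume s: "s \<in> C" and t: "t \<in> C" "cls s = cls t"
  have "(\<lambda>n. cmod c * N (t n - s n)) \<longlonglongrightarrow> 0"
    using s t cls_eq_iff[of t s] by (auto intro: tendsto_mult_right_zero)
  then show "cls (\<lambda>n. poly_scale c (t n)) = cls (\<lambda>n. poly_scale c (s n))"
    using s t by (auto simp: cls_eq_iff seqs_scale scale seqs_polys star_polys_diff
        simp flip: poly_scale_diff)
qed

lemma adj_cls: "s \<in> C \<Longrightarrow> adj A (cls s) = cls (\<lambda>n. poly_star (s n))"
  unfolding universal_cstar_def star_algebra.simps cstar_class_def[symmetric]
proof (rule cls_UN)
  fix t assume s: "s \<in> C" and t: "t \<in> C" "cls s = cls t"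
  then show "cls (\<lambda>n. poly_star (t n)) = cls (\<lambda>n. poly_star (s n))"
    by (auto simp: cls_eq_iff seqs_star seqs_polys star_polys_diff minus_commute
        simp flip: poly_star_diff)
qed

lemma add_cong:
  assumes "s \<in> C" "t \<in> C" "s' \<in> C" "t' \<in> C" "cls s = cls s'" "cls t = cls t'"
  shows "cls (\<lambda>n. s n + t n) = cls (\<lambda>n. s' n + t' n)"
proof -
  have "(\<lambda>n. N (s n - s' n) + N (t n - t' n)) \<longlonglongrightarrow> 0"
    using assms by (auto simp: cls_eq_iff intro: tendsto_add_zero)
  then have "(\<lambda>n. N (s n + t n - (s' n + t' n))) \<longlonglongrightarrow> 0"
  proof (rule null_squeeze[rotated 2])
    show "N (s n + t n - (s' n + t' n)) \<le> N (s n - s' n) + N (t n - t' n)" for n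
      using triangle[of "s n - s' n" "t n - t' n"] assms
      by (simp add: seqs_polys star_polys_diff algebra_simps)
  qed (auto simp: assms seqs_polys intro!: star_polys_diff star_polys_add star_polys_mult)
  then show ?thesis using assms by (subst cls_eq_iff) auto
qed

lemma mult_cong:
  assumes "s \<in> C" "t \<in> C" "s' \<in> C" "t' \<in> C" "cls s = cls s'" "cls t = cls t'"
  shows "cls (\<lambda>n. s n * t n) = cls (\<lambda>n. s' n * t' n)"
proof -
  obtain B B' where B: "0 < B" "\<And>n. N (s n) \<le> B" "0 < B'" "\<And>n. N (t' n) \<le> B'"
    using seqs_bounded assms by metis
  have "(\<lambda>n. B * N (t n - t' n) + N (s n - s' n) * B') \<longlonglongrightarrow> 0"
    using assms by (auto simp: cls_eq_iff
        intro!: tendsto_add_zero tendsto_mult_right_zero tendsto_mult_left_zero)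
  then have "(\<lambda>n. N (s n * t n - s' n * t' n)) \<longlonglongrightarrow> 0"
  proof (rule null_squeeze[rotated 2])
    fix n
    have "N (s n * t n - s' n * t' n) \<le> N (s n) * N (t n - t' n) + N (s n - s' n) * N (t' n)"
      by (rule mult_diff_le) (auto simp: assms seqs_polys)
    also have "\<dots> \<le> B * N (t n - t' n) + N (s n - s' n) * B'"
      using B assms by (intro add_mono mult_right_mono mult_left_mono)
        (auto simp: seqs_polys star_polys_diff nonneg)
    finally show "N (s n * t n - s' n * t' n) \<le> B * N (t n - t' n) + N (s n - s' n) * B'" .
  qed (auto simp: assms seqs_polys intro!: star_polys_diff star_polys_add star_polys_mult)
  then show ?thesis using assms by (subst cls_eq_iff) auto
qed

lemma add_cls: "s \<in> C \<Longrightarrow> t \<in> C \<Longrightarrow> cls s \<oplus>\<^bsub>A\<^esub> cls t = cls (\<lambda>n. s n + t n)"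
proof -
  assume s: "s \<in> C" and t: "t \<in> C"
  have "(\<Union>s' \<in> cls s. \<Union>t' \<in> cls t. cls (\<lambda>n. s' n + t' n)) = (\<Union>t' \<in> cls t. cls (\<lambda>n. s n + t' n))"
  proof (rule cls_UN[OF s])
    fix s' assume s': "s' \<in> C" "cls s = cls s'"
    have "cls (\<lambda>n. s' n + t' n) = cls (\<lambda>n. s n + t' n)" if "t' \<in> cls t" for t'
      using that s s' by (intro add_cong) (auto simp: cstar_class_def rel_iff)
    then show "(\<Union>t' \<in> cls t. cls (\<lambda>n. s' n + t' n)) = (\<Union>t' \<in> cls t. cls (\<lambda>n. s n + t' n))" by simp
  qed
  also have "\<dots> = cls (\<lambda>n. s n + t n)"
    by (rule cls_UN[OF t]) (rule add_cong, simp_all add: s t)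
  finally show ?thesis
    by (simp add: universal_cstar_def cstar_class_def)
qed

lemma mult_cls: "s \<in> C \<Longrightarrow> t \<in> C \<Longrightarrow> cls s \<otimes>\<^bsub>A\<^esub> cls t = cls (\<lambda>n. s n * t n)"
proof -
  assume s: "s \<in> C" and t: "t \<in> C"
  have "(\<Union>s' \<in> cls s. \<Union>t' \<in> cls t. cls (\<lambda>n. s' n * t' n)) = (\<Union>t' \<in> cls t. cls (\<lambda>n. s n * t' n))"
  proof (rule cls_UN[OF s])
    fix s' assume s': "s' \<in> C" "cls s = cls s'"
    have "cls (\<lambda>n. s' n * t' n) = cls (\<lambda>n. s n * t' n)" if "t' \<in> cls t" for t'
      using that s s' by (intro mult_cong) (auto simp: cstar_class_def rel_iff)
    then show "(\<Union>t' \<in> cls t. cls (\<lambda>n. s' n * t' n)) = (\<Union>t' \<in> cls t. cls (\<lambda>n. s n * t' n))" by simp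
  qed
  also have "\<dots> = cls (\<lambda>n. s n * t n)"
    by (rule cls_UN[OF t]) (rule mult_cong, simp_all add: s t)
  finally show ?thesis
    by (simp add: universal_cstar_def cstar_class_def)
qed

lemma zero_cls: "\<zero>\<^bsub>A\<^esub> = cst 0"
  by (simp add: universal_cstar_def cstar_class_def cstar_const_def)

text \<open>This provides the laws of \<open>finsum\<close>, in which the sums over fibres are
  expressed.\<close>

sublocale cstar: abelian_monoid A
proof (rule abelian_monoidI)
  fix x y z assume "x \<in> carrier A" "y \<in> carrier A" "z \<in> carrier A"
  then obtain s t u where *: "s \<in> C" "t \<in> C" "u \<in> C" "x = cls s" "y = cls t" "z = cls u"
    by (metis carrierE)
  then show "x \<oplus>\<^bsub>A\<^esub> y \<in> carrier A" "x \<oplus>\<^bsub>A\<^esub> y \<oplus>\<^bsub>A\<^esub> z = x \<oplus>\<^bsub>A\<^esub> (y \<oplus>\<^bsub>A\<^esub> z)"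
    "x \<oplus>\<^bsub>A\<^esub> y = y \<oplus>\<^bsub>A\<^esub> x" "\<zero>\<^bsub>A\<^esub> \<oplus>\<^bsub>A\<^esub> x = x"
    by (simp_all add: add_cls seqs_add cls_carrier zero_cls cstar_const_def seqs_const add_ac)
qed (simp add: zero_cls cst_carrier)

lemma add_cst: "a \<in> star_polys X \<Longrightarrow> b \<in> star_polys X \<Longrightarrow> cst a \<oplus>\<^bsub>A\<^esub> cst b = cst (a + b)"
  and mult_cst: "a \<in> star_polys X \<Longrightarrow> b \<in> star_polys X \<Longrightarrow> cst a \<otimes>\<^bsub>A\<^esub> cst b = cst (a * b)"
  and smult_cst: "a \<in> star_polys X \<Longrightarrow> c \<odot>\<^bsub>A\<^esub> cst a = cst (poly_scale c a)"
  and adj_cst: "a \<in> star_polys X \<Longrightarrow> adj A (cst a) = cst (poly_star a)"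
  by (simp_all add: cstar_const_def add_cls mult_cls smult_cls adj_cls seqs_const)

lemma cst_eq: "a \<approx> b \<Longrightarrow> cst a = cst b"
  by (auto simp: cstar_const_def cls_eq_iff seqs_const eqv_def)

lemma finsum_cst:
  "finite I \<Longrightarrow> (\<And>i. i \<in> I \<Longrightarrow> a i \<in> star_polys X) \<Longrightarrow>
    (\<Oplus>\<^bsub>A\<^esub>i \<in> I. cst (a i)) = cst (\<Sum>i \<in> I. a i)"
proof (induction I rule: finite_induct)
  case (insert i I)
  then show ?case
    using star_polys_sum[of I a X] by (subst cstar.finsum_insert) (auto simp: add_cst)
qed (simp add: zero_cls)

end

section \<open>Homomorphisms between universal C*-algebras\<close>

lemma star_homD:
  assumes "star_hom A B h"
  shows "a \<in> carrier A \<Longrightarrow> h a \<in> carrier B"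
    and "a \<in> carrier A \<Longrightarrow> b \<in> carrier A \<Longrightarrow> h (a \<oplus>\<^bsub>A\<^esub> b) = h a \<oplus>\<^bsub>B\<^esub> h b"
    and "a \<in> carrier A \<Longrightarrow> h (c \<odot>\<^bsub>A\<^esub> a) = c \<odot>\<^bsub>B\<^esub> h a"
    and "a \<in> carrier A \<Longrightarrow> b \<in> carrier A \<Longrightarrow> h (a \<otimes>\<^bsub>A\<^esub> b) = h a \<otimes>\<^bsub>B\<^esub> h b"
    and "a \<in> carrier A \<Longrightarrow> h (adj A a) = adj B (h a)"
  using assms by (auto simp: star_hom_def)

lemma star_hom_comp: "star_hom A B h \<Longrightarrow> star_hom B D k \<Longrightarrow> star_hom A D (k \<circ> h)"
  by (simp add: star_hom_def Pi_iff)

lemma star_hom_sum: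
  assumes AX: "cstar_presentation X R" and BY: "cstar_presentation Y Q"
    and h: "star_hom (universal_cstar X R) (universal_cstar Y Q) h"
    and I: "finite I" "\<And>i. i \<in> I \<Longrightarrow> a i \<in> star_polys X" "\<And>i. i \<in> I \<Longrightarrow> b i \<in> star_polys Y"
    and eq: "\<And>i. i \<in> I \<Longrightarrow> h (cstar_const X R (a i)) = cstar_const Y Q (b i)"
  shows "h (cstar_const X R (\<Sum>i \<in> I. a i)) = cstar_const Y Q (\<Sum>i \<in> I. b i)"
proof -
  interpret A: cstar_presentation X R by fact
  interpret B: cstar_presentation Y Q by fact
  have "h (A.cst 0) \<in> carrier B.A" using star_homD(1)[OF h] A.cst_carrier by simp
  then obtain s where s: "s \<in> B.C" "h (A.cst 0) = B.cls s" by (rule B.carrierE)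
  \<comment> \<open>With additive monoids there is no cancellation to show that zero is preserved;
    homogeneity at the scalar 0 does it.\<close>
  have "h (A.cst 0) = 0 \<odot>\<^bsub>B.A\<^esub> h (A.cst 0)"
    using star_homD(3)[OF h, of "A.cst 0" 0] A.smult_cst[of 0 0] A.cst_carrier by simp
  also have "\<dots> = B.cst 0" using s by (simp add: B.smult_cls cstar_const_def)
  finally have zero: "h (A.cst 0) = B.cst 0" .
  from I eq show ?thesis
  proof (induction I rule: finite_induct)
    case (insert i I)
    then have "a i \<in> star_polys X" "sum a I \<in> star_polys X" "b i \<in> star_polys Y" "sum b I \<in> star_polys Y"
      by (auto intro: star_polys_sum)
    with insert show ?case
      using star_homD(2)[OF h, of "A.cst (a i)" "A.cst (sum a I)"]
      by (simp add: A.cst_carrier A.add_cst B.add_cst)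
  qed (simp add: zero)
qed

text \<open>Pulling the universal norm of the target back along \<open>subst y\<close> gives a
  C*-seminorm that kills \<open>R\<close>, hence one dominated by the universal norm of the source.
  So \<open>subst y\<close> is contractive and extends to Cauchy sequences.\<close>

lemma star_hom_subst:
  assumes AX: "cstar_presentation X R" and BY: "cstar_presentation Y Q"
    and y: "\<And>x. x \<in> X \<Longrightarrow> y x \<in> star_polys Y"
    and rels: "\<And>r. r \<in> R \<Longrightarrow> universal_norm Y Q (subst y r) = 0"
  obtains h where "star_hom (universal_cstar X R) (universal_cstar Y Q) h"
    and "\<And>a. a \<in> star_polys X \<Longrightarrow> h (cstar_const X R a) = cstar_const Y Q (subst y a)"
proof -
  interpret A: cstar_presentation X R by fact
  interpret B: cstar_presentation Y Q by fact
  note polys = subst_star_polys[of X y Y, OF y]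
  have "cstar_seminorm X (\<lambda>a. B.N (subst y a))"
    by (auto simp: cstar_seminorm_def subst_add subst_scale subst_mult subst_star polys
        B.nonneg B.triangle B.scale B.submult B.cstar)
  then have le: "B.N (subst y a) \<le> A.N a" if "a \<in> star_polys X" for a
    using A.le_universal_norm[OF that] rels by blast
  have seqs: "(\<lambda>n. subst y (s n)) \<in> B.C" if "s \<in> A.C" for s
  proof (rule B.seqsI)
    fix \<epsilon> :: real assume "0 < \<epsilon>"
    with that obtain M where "\<forall>m\<ge>M. \<forall>n\<ge>M. A.N (s m - s n) < \<epsilon>"
      using A.seqs_Cauchy by blast
    then show "\<exists>M. \<forall>m\<ge>M. \<forall>n\<ge>M. B.N (subst y (s m) - subst y (s n)) < \<epsilon>"
      using le[OF star_polys_diff[OF A.seqs_polys[OF that] A.seqs_polys[OF that]]]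
      by (simp add: subst_diff) (meson le_less_trans)
  qed (simp add: polys A.seqs_polys that)
  define h where "h x = (\<Union>s \<in> x. B.cls (\<lambda>n. subst y (s n)))" for x
  have h: "h (A.cls s) = B.cls (\<lambda>n. subst y (s n))" if s: "s \<in> A.C" for s
    unfolding h_def
  proof (rule A.cls_UN[OF s])
    fix t assume t: "t \<in> A.C" "A.cls s = A.cls t"
    then have "(\<lambda>n. A.N (t n - s n)) \<longlonglongrightarrow> 0" using s A.cls_eq_iff[of t s] by auto
    then have "(\<lambda>n. B.N (subst y (t n - s n))) \<longlonglongrightarrow> 0"
      using le s t by (intro B.null_squeeze) (auto simp: A.seqs_polys star_polys_diff polys)
    then show "B.cls (\<lambda>n. subst y (t n)) = B.cls (\<lambda>n. subst y (s n))"
      using s t seqs by (simp add: B.cls_eq_iff subst_diff)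
  qed
  have "star_hom A.A B.A h"
    unfolding star_hom_def
  proof (intro conjI funcsetI ballI allI)
    fix a c assume "a \<in> carrier A.A"
    then obtain s where s: "s \<in> A.C" "a = A.cls s" by (rule A.carrierE)
    then show "h a \<in> carrier B.A" "h (c \<odot>\<^bsub>A.A\<^esub> a) = c \<odot>\<^bsub>B.A\<^esub> h a"
        "h (adj A.A a) = adj B.A (h a)"
      by (simp_all add: h seqs B.cls_carrier A.smult_cls B.smult_cls A.seqs_scale
          A.adj_cls B.adj_cls A.seqs_star subst_scale subst_star)
    fix b assume "b \<in> carrier A.A"
    then obtain t where "t \<in> A.C" "b = A.cls t" by (rule A.carrierE)
    with s show "h (a \<oplus>\<^bsub>A.A\<^esub> b) = h a \<oplus>\<^bsub>B.A\<^esub> h b" "h (a \<otimes>\<^bsub>A.A\<^esub> b) = h a \<otimes>\<^bsub>B.A\<^esub> h b"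
      by (simp_all add: h seqs A.add_cls B.add_cls A.seqs_add A.mult_cls B.mult_cls A.seqs_mult
          subst_add subst_mult)
  qed
  moreover have "h (A.cst a) = B.cst (subst y a)" if "a \<in> star_polys X" for a
    using that by (simp add: cstar_const_def h A.seqs_const)
  ultimately show ?thesis using that by blast
qed

section \<open>Automatic continuity\<close>

context star_seminorm
begin

text \<open>
  If \<open>p\<^sup>2 + (1 - q)\<^sup>2 = 1\<close> for commuting self-adjoint \<open>p\<close>, \<open>q\<close>, then \<open>p + \<i>(1 - q)\<close> and
  \<open>p - \<i>(1 - q)\<close> are unitary and \<open>p\<close> is their mean. The approximate version below avoids the
  unit by letting these elements act on \<open>b\<close>.
\<close>

lemma approximately_unitary:
  assumes S: "a \<in> star_polys X" "q \<in> star_polys X" "b \<in> star_polys X"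
    and sa: "poly_star a = a" "poly_star q = q" and c: "c = \<i> \<or> c = - \<i>"
  defines "e \<equiv> p (a * a + q * q - (q + q)) + p (a * q - q * a)"
  shows "p (a * b + poly_scale c (b - q * b)) \<le> p b * sqrt (1 + e)"
proof -
  define u where "u = a * b + poly_scale c (b - q * b)"
  define r where "r = a * a + q * q - (q + q)"
  define r' where "r' = a * q - q * a"
  have cc: "cnj c = - c" "c * c = - 1" "cmod c = 1" using c by auto
  have neg: "sconst (- c) = - sconst c" "sconst c * sconst c = - 1"
    using cc(2) by (simp_all add: single_uminus mult_single)
  \<comment> \<open>The expansion of \<open>poly_star u * u\<close> needs of \<open>J\<close> only
    that it is central with square -1, so it is kept opaque.\<close>
  define J :: "'g star_poly" where "J = sconst c"
  have J2: "J * (J * x) = - x" for x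
    by (simp add: J_def neg flip: mult.assoc)
  have comm: "x * J = J * x" "x * (J * y) = J * (x * y)" for x y
    unfolding J_def by (rule sconst_central[symmetric], rule sconst_left_commute)
  have u_star: "poly_star u = poly_star b * a - J * (poly_star b - poly_star b * q)"
    by (simp add: u_def poly_star_add poly_star_diff poly_star_mult poly_star_scale sa cc)
      (simp add: poly_scale_conv J_def neg)
  \<comment> \<open>Formally \<open>u\<close> is (a + c(1 - q)) b, and the adjoint of the first
    factor times that factor is 1 + r - c r'. The error is thus linear in the defect
    \<open>r\<close> of the circle identity and in the commutator \<open>r'\<close>.\<close>
  have "poly_star u * u = poly_star b * b + poly_star b * ((r - poly_scale c r') * b)"
    unfolding u_star
    by (simp add: u_def r_def r'_def poly_scale_conv algebra_simps J2 comm[of a] comm[of q]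
        comm[of "poly_star b"] flip: J_def)
  moreover have S': "u \<in> star_polys X" "r \<in> star_polys X" "r' \<in> star_polys X"
    using S by (auto simp: u_def r_def r'_def)
  ultimately have "(p u)\<^sup>2 \<le> p (poly_star b * b) + p (poly_star b * ((r - poly_scale c r') * b))"
    using cstar[of u] triangle S by (metis star_polys_mult star_polys_star star_polys_diff star_polys_scale)
  also have "p (poly_star b * ((r - poly_scale c r') * b)) \<le> p b * (p (r - poly_scale c r') * p b)"
    using submult[of "poly_star b" "(r - poly_scale c r') * b"] submult[of "r - poly_scale c r'" b]
      nonneg[of b] S S'
    by (smt (verit) star star_polys_mult star_polys_star star_polys_diff star_polys_scale mult_left_mono)
  also have "p (r - poly_scale c r') \<le> e"
    using diff_le[of r "poly_scale c r'"] S' scale[of r' c] cc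
    by (simp add: e_def r_def r'_def star_polys_scale)
  finally have "(p u)\<^sup>2 \<le> p (poly_star b * b) + p b * (e * p b)"
    using nonneg[OF S(3)] by (simp add: mult_left_mono mult_right_mono)
  also have "\<dots> = (p b)\<^sup>2 * (1 + e)"
    using cstar[OF S(3)] by (simp add: power2_eq_square algebra_simps)
  finally have "p u \<le> sqrt ((p b)\<^sup>2 * (1 + e))" by (rule real_le_rsqrt)
  then show ?thesis
    using nonneg[OF S(3)] by (simp add: u_def real_sqrt_mult)
qed

text \<open>For \<open>b = a\<close>, twice the square of \<open>a\<close> is the sum of the images
  of \<open>a\<close> under the two approximate unitaries; one factor \<open>p a\<close> then
  cancels.\<close>

lemma approximately_contractive:
  assumes S: "a \<in> star_polys X" "q \<in> star_polys X"
    and sa: "poly_star a = a" "poly_star q = q"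
  shows "p a \<le> sqrt (1 + (p (a * a + q * q - (q + q)) + p (a * q - q * a)))" (is "_ \<le> ?e")
proof -
  define u where "u c = a * a + poly_scale c (a - q * a)" for c
  have U: "u c \<in> star_polys X" for c using S by (auto simp: u_def)
  have "poly_scale 2 (a * a) = u \<i> + u (- \<i>)"
    by (simp add: u_def poly_scale_conv single_uminus algebra_simps flip: mult_2)
  then have "2 * p (a * a) \<le> p (u \<i>) + p (u (- \<i>))"
    using triangle[OF U U] scale[of "a * a" 2] S by (metis norm_numeral star_polys_mult)
  also have "\<dots> \<le> p a * ?e + p a * ?e"
    unfolding u_def by (intro add_mono approximately_unitary S sa) auto
  finally have "p a * p a \<le> p a * ?e"
    using cstar[OF S(1)] by (simp add: sa power2_eq_square)
  moreover have "0 \<le> ?e"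
    using nonneg[of "a * a + q * q - (q + q)"] nonneg[of "a * q - q * a"] S
    by (simp add: star_polys_diff star_polys_add star_polys_mult)
  ultimately show ?thesis
    using nonneg[OF S(1)] by (cases "p a = 0") (auto simp: less_le)
qed

end

section \<open>The iteration for the square root\<close>

lemma poly_scale_half: "poly_scale (1/2) (a + a) = a"
  by (simp add: poly_scale_conv distrib_left flip: distrib_right single_add)

lemma poly_scale_neg_two: "poly_scale (-2) a = - (a + a)"
  by (simp add: poly_scale_conv single_uminus mult_2)

fun root_iter :: "'g star_poly \<Rightarrow> nat \<Rightarrow> 'g star_poly" where
  "root_iter x 0 = 0"
| "root_iter x (Suc n) = poly_scale (1/2) (x * x + root_iter x n * root_iter x n)"

lemma root_iter_star: "poly_star x = x \<Longrightarrow> poly_star (root_iter x n) = root_iter x n"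
  by (induction n) (simp_all add: poly_star_scale poly_star_add poly_star_mult)

lemma root_iter_commute: "x * root_iter x n = root_iter x n * x"
proof (induction n)
  case (Suc n)
  have "x * (root_iter x n * root_iter x n) = root_iter x n * root_iter x n * x"
    by (metis Suc mult.assoc)
  then show ?case
    by (simp add: poly_scale_mult_left poly_scale_mult_right distrib_left distrib_right mult.assoc)
qed simp

context star_seminorm
begin

lemma root_iter_polys: "x \<in> star_polys X \<Longrightarrow> root_iter x n \<in> star_polys X"
  by (induction n) auto

text \<open>On the ball of radius \<open>r\<close> squaring has Lipschitz constant
  \<open>2 * r\<close>, and the factor 1/2 turns this into \<open>r\<close>: the iteration step
  contracts in each argument when \<open>r < 1\<close>.\<close>

lemma half_mult_diff_le:
  assumes "a \<in> star_polys X" "b \<in> star_polys X" "a' \<in> star_polys X" "b' \<in> star_polys X"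
    and "p a \<le> r" "p b \<le> r" "p a' \<le> r" "p b' \<le> r"
  shows "p (poly_scale (1/2) (a * a + b * b) - poly_scale (1/2) (a' * a' + b' * b'))
    \<le> r * p (a - a') + r * p (b - b')"
proof -
  have sq: "p (c * c - c' * c') \<le> 2 * r * p (c - c')"
    if "c \<in> star_polys X" "c' \<in> star_polys X" "p c \<le> r" "p c' \<le> r" for c c'
  proof -
    have "p (c * c - c' * c') \<le> p c * p (c - c') + p (c - c') * p c'"
      using that by (intro mult_diff_le)
    also have "\<dots> \<le> r * p (c - c') + p (c - c') * r"
      using that nonneg[of "c - c'"] by (intro add_mono mult_left_mono mult_right_mono) auto
    finally show ?thesis by simp
  qed
  have "poly_scale (1/2) (a * a + b * b) - poly_scale (1/2) (a' * a' + b' * b')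
      = poly_scale (1/2) ((a * a - a' * a') + (b * b - b' * b'))"
    by (simp add: poly_scale_conv algebra_simps)
  then have "p (poly_scale (1/2) (a * a + b * b) - poly_scale (1/2) (a' * a' + b' * b'))
      = 1/2 * p ((a * a - a' * a') + (b * b - b' * b'))"
    using assms scale[of "(a * a - a' * a') + (b * b - b' * b')" "1/2"]
    by (simp add: star_polys_add star_polys_diff star_polys_mult)
  also have "\<dots> \<le> 1/2 * (p (a * a - a' * a') + p (b * b - b' * b'))"
    using triangle[of "a * a - a' * a'" "b * b - b' * b'"] assms
    by (simp add: star_polys_diff star_polys_mult)
  also have "\<dots> \<le> 1/2 * (2 * r * p (a - a') + 2 * r * p (b - b'))"
    using sq[of a a'] sq[of b b'] assms by simp
  finally show ?thesis by simp
qed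

context
  fixes r :: real assumes r: "0 \<le> r" "r < 1"
begin

lemma root_iter_le:
  assumes "x \<in> star_polys X" "p x \<le> r"
  shows "p (root_iter x n) \<le> r"
proof (induction n)
  case (Suc n)
  let ?z = "root_iter x n"
  have z: "?z \<in> star_polys X" using assms by (simp add: root_iter_polys)
  have "p (x * x + ?z * ?z) \<le> p x * p x + p ?z * p ?z"
    using triangle[of "x * x" "?z * ?z"] submult[of x x] submult[of ?z ?z] z assms
    by (force intro: star_polys_mult)
  also have "\<dots> \<le> r * r + r * r"
    using assms Suc r nonneg z by (intro add_mono mult_mono) auto
  also have "\<dots> \<le> 2 * r"
    using r by (simp add: mult_left_le)
  finally show ?case
    using scale[of "x * x + ?z * ?z" "1/2"] assms z by (simp add: star_polys_add star_polys_mult)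
qed (simp add: r)

text \<open>The distance shrinks by \<open>r\<close> in each step, and the start at 0 leaves at most
  \<open>r \<le> 1\<close> for \<open>n = 0\<close>. The bound is uniform in \<open>d\<close>, which
  is what makes the iterates Cauchy.\<close>

lemma root_iter_diff_index:
  assumes "x \<in> star_polys X" "p x \<le> r"
  shows "p (root_iter x n - root_iter x (n + d)) \<le> r ^ n"
proof (induction n)
  case 0
  then show ?case
    using root_iter_le[OF assms, of d] r minus[OF root_iter_polys[OF assms(1), of d]] by simp
next
  case (Suc n)
  have "p (root_iter x (Suc n) - root_iter x (Suc n + d))
      \<le> r * p (x - x) + r * p (root_iter x n - root_iter x (n + d))"
    unfolding add_Suc root_iter.simps
    by (intro half_mult_diff_le root_iter_le) (auto simp: assms root_iter_polys)
  also have "\<dots> \<le> r * r ^ n"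
    using Suc r by (simp add: mult_left_mono)
  finally show ?case by simp
qed

lemma root_iter_diff:
  assumes "x \<in> star_polys X" "p x \<le> r" "y \<in> star_polys X" "p y \<le> r"
  shows "p (root_iter x n - root_iter y n) \<le> p (x - y) / (1 - r)"
proof (induction n)
  case 0
  then show ?case using r assms nonneg[of "x - y"] by (simp add: star_polys_diff)
next
  case (Suc n)
  have "p (root_iter x (Suc n) - root_iter y (Suc n))
      \<le> r * p (x - y) + r * p (root_iter x n - root_iter y n)"
    unfolding root_iter.simps
    by (intro half_mult_diff_le root_iter_le) (auto simp: assms root_iter_polys)
  \<comment> \<open>Enlarging the first factor \<open>r\<close> to 1 makes
    \<open>p (x - y) / (1 - r)\<close> the fixed point of the resulting recursion.\<close>
  also have "\<dots> \<le> 1 * p (x - y) + r * (p (x - y) / (1 - r))"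
    using Suc r nonneg[of "x - y"] assms
    by (intro add_mono mult_left_mono mult_right_mono) (auto simp: star_polys_diff)
  also have "\<dots> = p (x - y) / (1 - r)"
    using r by (simp add: field_simps)
  finally show ?case .
qed

text \<open>An element of the completion is only approximated by \<open>s n\<close>, and the
  iteration needs a limit of its own; the diagonal sequence takes both limits at once, and the two
  errors add up.\<close>

lemma root_iter_diagonal:
  assumes s: "\<And>n. s n \<in> star_polys X" "\<And>n. p (s n) \<le> r"
  shows "p (root_iter (s m) m - root_iter (s n) n) \<le> p (s m - s n) / (1 - r) + r ^ min m n"
proof -
  have *: "p (root_iter (s m) m - root_iter (s n) n) \<le> p (s m - s n) / (1 - r) + r ^ m"
    if "m \<le> n" for m n
  proof -
    have "p (root_iter (s m) m - root_iter (s n) n)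
        \<le> p (root_iter (s m) m - root_iter (s n) m) + p (root_iter (s n) m - root_iter (s n) n)"
      by (intro triangle_diff root_iter_polys s)
    then show ?thesis
      using root_iter_diff[OF s(1)[of m] s(2)[of m] s(1)[of n] s(2)[of n], of m] root_iter_diff_index[OF s, of n m "n - m"] that by simp
  qed
  show ?thesis
    using *[of m n] *[of n m] minus_commute[of "root_iter (s m) m" "root_iter (s n) n"]
      minus_commute[of "s m" "s n"] s
    by (cases "m \<le> n") (auto simp: min_def root_iter_polys)
qed

end

end

context cstar_presentation
begin

lemma seqs_root_iter:
  assumes s: "s \<in> C" "\<And>n. N (s n) \<le> r" and r: "0 \<le> r" "r < 1"
  shows "(\<lambda>n. root_iter (s n) n) \<in> C"
proof (rule seqsI)
  fix \<epsilon> :: real assume \<epsilon>: "0 < \<epsilon>"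
  obtain M1 where M1: "\<forall>m\<ge>M1. \<forall>n\<ge>M1. N (s m - s n) < (1 - r) * (\<epsilon> / 2)"
    using seqs_Cauchy[OF s(1), of "(1 - r) * (\<epsilon> / 2)"] \<epsilon> r by auto
  have "(\<lambda>n. r ^ n) \<longlonglongrightarrow> 0" using r by (intro LIMSEQ_realpow_zero)
  from order_tendstoD(2)[OF this, of "\<epsilon> / 2"] obtain M2 where M2: "\<forall>n\<ge>M2. r ^ n < \<epsilon> / 2"
    using \<epsilon> by (auto simp: eventually_sequentially)
  have "N (root_iter (s m) m - root_iter (s n) n) < \<epsilon>"
    if "m \<ge> max M1 M2" "n \<ge> max M1 M2" for m n
  proof -
    have "N (s m - s n) / (1 - r) < \<epsilon> / 2"
      using M1 that r by (simp add: divide_less_eq mult.commute)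
    moreover have "r ^ min m n < \<epsilon> / 2" using M2 that by simp
    ultimately show ?thesis
      using root_iter_diagonal[OF r, of s m n, OF seqs_polys[OF s(1)] s(2)] by linarith
  qed
  then show "\<exists>M. \<forall>m\<ge>M. \<forall>n\<ge>M. N (root_iter (s m) m - root_iter (s n) n) < \<epsilon>" by blast
qed (use s seqs_polys root_iter_polys in blast)

text \<open>Dropping initial terms turns a bound that holds eventually into one that holds for every
  index, as \<open>star_hom_le_1\<close> requires.\<close>

lemma seqs_shift:
  assumes "s \<in> C"
  shows "(\<lambda>n. s (n + k)) \<in> C" and "cls (\<lambda>n. s (n + k)) = cls s"
proof -
  show *: "(\<lambda>n. s (n + k)) \<in> C"
  proof (rule seqsI)
    fix \<epsilon> :: real assume "0 < \<epsilon>"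
    then show "\<exists>M. \<forall>m\<ge>M. \<forall>n\<ge>M. N (s (m + k) - s (n + k)) < \<epsilon>"
      using seqs_Cauchy[OF assms] by (meson trans_le_add1)
  qed (simp add: assms seqs_polys)
  have "(\<lambda>n. N (s (n + k) - s n)) \<longlonglongrightarrow> 0"
  proof (rule LIMSEQ_I)
    fix \<epsilon> :: real assume "0 < \<epsilon>"
    then obtain M where "\<forall>m\<ge>M. \<forall>n\<ge>M. N (s m - s n) < \<epsilon>"
      using seqs_Cauchy[OF assms] by blast
    then have "norm (N (s (n + k) - s n) - 0) < \<epsilon>" if "n \<ge> M" for n
      using that nonneg[of "s (n + k) - s n"] assms by (simp add: seqs_polys star_polys_diff)
    then show "\<exists>M. \<forall>n\<ge>M. norm (N (s (n + k) - s n) - 0) < \<epsilon>" by blast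
  qed
  with * show "cls (\<lambda>n. s (n + k)) = cls s"
    using assms by (simp add: cls_eq_iff)
qed

end

section \<open>Contractivity and uniqueness of star homomorphisms\<close>

locale cstar_presentation_pair =
  A: cstar_presentation X R + B: cstar_presentation Y Q
  for X :: "'g set" and R and Y :: "'h set" and Q
begin

lemma star_hom_image:
  assumes "star_hom A.A B.A h" "s \<in> A.C"
  obtains t where "t \<in> B.C" "h (A.cls s) = B.cls t"
  using star_homD(1)[OF assms(1) A.cls_carrier[OF assms(2)]] B.carrierE by blast

text \<open>The relations \<open>rel1\<close>, \<open>rel2\<close> and \<open>rel3\<close> are
  algebraic statements about \<open>x\<close> and \<open>z\<close>, so \<open>h\<close> transports
  them; all remaining estimates take place in \<open>B\<close>.\<close>

lemma star_hom_le_1: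
  assumes h: "star_hom A.A B.A h"
    and s: "s \<in> A.C" "\<And>n. A.N (s n) \<le> k" and k: "k < 1"
    and t: "t \<in> B.C" "h (A.cls s) = B.cls t" and l: "(\<lambda>n. B.N (t n)) \<longlonglongrightarrow> l"
  shows "l \<le> 1"
proof -
  define x where "x n = poly_star (s n) * s n" for n
  define z where "z n = root_iter (x n) n" for n
  define r where "r = k\<^sup>2"
  have k0: "0 \<le> k" using s A.nonneg[OF A.seqs_polys[OF s(1), of 0]] by (meson order_trans)
  have r: "0 \<le> r" "r < 1" using k k0 by (simp_all add: r_def power_less_one_iff)
  have x: "x \<in> A.C" unfolding x_def using s by auto
  have xr: "A.N (x n) \<le> r" for n
    using s A.nonneg A.seqs_polys[OF s(1)] by (simp add: x_def r_def A.cstar power_mono)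
  have x_star: "poly_star (x n) = x n" for n by (simp add: x_def poly_star_mult)
  have z: "z \<in> A.C" unfolding z_def using x xr r by (rule A.seqs_root_iter)
  have rel1: "A.cls z = (1/2) \<odot>\<^bsub>A.A\<^esub> (A.cls x \<otimes>\<^bsub>A.A\<^esub> A.cls x \<oplus>\<^bsub>A.A\<^esub> A.cls z \<otimes>\<^bsub>A.A\<^esub> A.cls z)"
  proof -
    \<comment> \<open>One further iteration step changes the n-th term by at most
      \<open>r ^ n\<close>, so in the limit \<open>z\<close> is a fixed point.\<close>
    have "(\<lambda>n. A.N (z n - root_iter (x n) (Suc n))) \<longlonglongrightarrow> 0"
    proof (rule A.null_squeeze)
      show "A.N (z n - root_iter (x n) (Suc n)) \<le> r ^ n" for n
        using A.root_iter_diff_index[OF r A.seqs_polys[OF x] xr, of n n 1] by (simp add: z_def)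
      show "(\<lambda>n. r ^ n) \<longlonglongrightarrow> 0" using r by (intro LIMSEQ_realpow_zero)
    qed (use A.seqs_polys[OF x] A.seqs_polys[OF z] A.root_iter_polys in blast)
    then have "(\<lambda>n. A.N (z n - poly_scale (1/2) (x n * x n + z n * z n))) \<longlonglongrightarrow> 0"
      by (simp add: z_def)
    then show ?thesis
      using x z by (simp add: A.mult_cls A.add_cls A.smult_cls A.seqs_mult A.seqs_add A.seqs_scale
          A.cls_eq_iff)
  qed
  have rel2: "A.cls x \<otimes>\<^bsub>A.A\<^esub> A.cls z = A.cls z \<otimes>\<^bsub>A.A\<^esub> A.cls x"
    using x z by (simp add: A.mult_cls) (simp add: z_def root_iter_commute)
  have rel3: "adj A.A (A.cls z) = A.cls z"
    using z x_star by (simp add: A.adj_cls) (simp add: z_def[abs_def] root_iter_star)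
  define y where "y n = poly_star (t n) * t n" for n
  have y: "y \<in> B.C" unfolding y_def using t by auto
  have y_star: "poly_star (y n) = y n" for n by (simp add: y_def poly_star_mult)
  have "A.cls x = adj A.A (A.cls s) \<otimes>\<^bsub>A.A\<^esub> A.cls s"
    using s by (simp add: x_def[abs_def] A.adj_cls A.mult_cls A.seqs_star)
  then have hx: "h (A.cls x) = B.cls y"
  proof -
    have "adj A.A (A.cls s) \<in> carrier A.A" using s by (simp add: A.adj_cls A.cls_carrier A.seqs_star)
    then have "h (adj A.A (A.cls s) \<otimes>\<^bsub>A.A\<^esub> A.cls s) = adj B.A (B.cls t) \<otimes>\<^bsub>B.A\<^esub> B.cls t"
      using s t by (simp add: star_homD(4,5)[OF h] A.cls_carrier)
    with \<open>A.cls x = _\<close> t show ?thesis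
      by (simp add: y_def[abs_def] B.adj_cls B.mult_cls B.seqs_star)
  qed
  obtain q0 where q0: "q0 \<in> B.C" "h (A.cls z) = B.cls q0"
    using star_hom_image[OF h z] .
  \<comment> \<open>Only the class of \<open>q0\<close> is known to be self-adjoint; averaging with
    the adjoint yields a representative that is self-adjoint term by term, as
    \<open>approximately_contractive\<close> demands.\<close>
  define q where "q n = poly_scale (1/2) (q0 n + poly_star (q0 n))" for n
  have q: "q \<in> B.C" unfolding q_def by (intro B.seqs_scale B.seqs_add B.seqs_star q0(1))
  have q_star: "poly_star (q n) = q n" for n
    by (simp add: q_def poly_star_scale poly_star_add add.commute)
  have hz: "h (A.cls z) = B.cls q"
  proof -
    have "B.cls (\<lambda>n. poly_star (q0 n)) = B.cls q0"
      using rel3 star_homD(5)[OF h A.cls_carrier[OF z]] q0 by (simp add: B.adj_cls)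
    then have "(\<lambda>n. B.N (poly_star (q0 n) - q0 n)) \<longlonglongrightarrow> 0"
      using q0 by (simp add: B.cls_eq_iff B.seqs_star)
    moreover have "q n - q0 n = poly_scale (1/2) (poly_star (q0 n) - q0 n)" for n
    proof -
      have "q n - q0 n = poly_scale (1/2) (q0 n + poly_star (q0 n)) - poly_scale (1/2) (q0 n + q0 n)"
        by (simp only: q_def poly_scale_half)
      then show ?thesis by (simp flip: poly_scale_diff)
    qed
    ultimately have "(\<lambda>n. B.N (q n - q0 n)) \<longlonglongrightarrow> 0"
      using q0 by (simp add: B.scale B.seqs_polys star_polys_diff star_polys_star tendsto_mult_right_zero)
    then have "B.cls q = B.cls q0" using q q0 by (simp add: B.cls_eq_iff)
    then show ?thesis using q0 by simp
  qed
  have "B.cls q = (1/2) \<odot>\<^bsub>B.A\<^esub> (B.cls y \<otimes>\<^bsub>B.A\<^esub> B.cls y \<oplus>\<^bsub>B.A\<^esub> B.cls q \<otimes>\<^bsub>B.A\<^esub> B.cls q)"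
  proof -
    have "A.cls x \<otimes>\<^bsub>A.A\<^esub> A.cls x \<in> carrier A.A" "A.cls z \<otimes>\<^bsub>A.A\<^esub> A.cls z \<in> carrier A.A"
      "A.cls x \<otimes>\<^bsub>A.A\<^esub> A.cls x \<oplus>\<^bsub>A.A\<^esub> A.cls z \<otimes>\<^bsub>A.A\<^esub> A.cls z \<in> carrier A.A"
      using x z by (simp_all add: A.cls_carrier A.mult_cls A.add_cls A.seqs_mult A.seqs_add)
    then show ?thesis
      using arg_cong[OF rel1, of h] x z by (simp add: star_homD[OF h] A.cls_carrier hx hz)
  qed
  then have "(\<lambda>n. B.N (q n - poly_scale (1/2) (y n * y n + q n * q n))) \<longlonglongrightarrow> 0"
    using y q by (simp add: B.mult_cls B.add_cls B.smult_cls B.seqs_mult B.seqs_add B.seqs_scale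
        B.cls_eq_iff)
  then have "(\<lambda>n. 2 * B.N (q n - poly_scale (1/2) (y n * y n + q n * q n))) \<longlonglongrightarrow> 0"
    by (rule tendsto_mult_right_zero)
  \<comment> \<open>The factor 2 turns the fixed point defect into the defect of the circle
    identity, up to sign.\<close>
  moreover have "2 * B.N (q n - poly_scale (1/2) (y n * y n + q n * q n))
      = B.N (y n * y n + q n * q n - (q n + q n))" for n
  proof -
    have "y n * y n + q n * q n - (q n + q n)
        = poly_scale (-2) (q n - poly_scale (1/2) (y n * y n + q n * q n))"
      by (simp add: poly_scale_diff poly_scale_neg_two)
    then show ?thesis
      using y q by (simp add: B.scale B.seqs_polys star_polys_diff star_polys_scale star_polys_add
          star_polys_mult)
  qed
  moreover have "(\<lambda>n. B.N (y n * q n - q n * y n)) \<longlonglongrightarrow> 0"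
  proof -
    have "B.cls y \<otimes>\<^bsub>B.A\<^esub> B.cls q = B.cls q \<otimes>\<^bsub>B.A\<^esub> B.cls y"
      using arg_cong[OF rel2, of h] x z
      by (simp add: star_homD[OF h] A.cls_carrier hx hz)
    then show ?thesis using y q by (simp add: B.mult_cls B.seqs_mult B.cls_eq_iff)
  qed
  ultimately have "(\<lambda>n. B.N (y n * y n + q n * q n - (q n + q n)) + B.N (y n * q n - q n * y n)) \<longlonglongrightarrow> 0"
    by (auto intro: tendsto_add_zero)
  then have sqrt_lim: "(\<lambda>n. sqrt (1 + (B.N (y n * y n + q n * q n - (q n + q n)) + B.N (y n * q n - q n * y n))))
      \<longlonglongrightarrow> sqrt (1 + 0)"
    by (intro tendsto_intros)
  \<comment> \<open>By the C*-identity the norms of \<open>y\<close> tend to the square of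
    \<open>l\<close>, so bounding them by 1 in the limit bounds \<open>l\<close>.\<close>
  have "(\<lambda>n. B.N (y n)) \<longlonglongrightarrow> l\<^sup>2"
    using tendsto_power[OF l, of 2] t by (simp add: y_def B.cstar B.seqs_polys)
  from this sqrt_lim have "l\<^sup>2 \<le> sqrt (1 + 0)"
    by (rule LIMSEQ_le)
      (use B.approximately_contractive[OF B.seqs_polys[OF y] B.seqs_polys[OF q] y_star q_star] in auto)
  then show ?thesis using power2_le_imp_le[of l 1] by simp
qed

proposition star_hom_contractive:
  assumes h: "star_hom A.A B.A h"
    and s: "s \<in> A.C" "(\<lambda>n. A.N (s n)) \<longlonglongrightarrow> l"
    and t: "t \<in> B.C" "h (A.cls s) = B.cls t" "(\<lambda>n. B.N (t n)) \<longlonglongrightarrow> l'"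
  shows "l' \<le> l"
proof (rule field_le_epsilon)
  fix \<delta> :: real assume \<delta>: "0 < \<delta>"
  \<comment> \<open>\<open>c\<close> exceeds the norm by \<delta> while late terms exceed it by less
    than half of that, so after division by \<open>c\<close> the bound is uniformly below 1.\<close>
  define c where "c = l + \<delta>"
  have l0: "0 \<le> l"
    using s by (intro LIMSEQ_le_const[OF s(2)]) (auto simp: A.nonneg A.seqs_polys)
  with \<delta> have c: "0 < c" by (simp add: c_def)
  obtain M where M: "A.N (s n) < l + \<delta> / 2" if "n \<ge> M" for n
    using order_tendstoD(2)[OF s(2), of "l + \<delta> / 2"] \<delta> by (auto simp: eventually_sequentially)
  define s' where "s' n = poly_scale (1/c) (s (n + M))" for n
  define t' where "t' n = poly_scale (1/c) (t n)" for n
  have "A.cls s' = (1/c) \<odot>\<^bsub>A.A\<^esub> A.cls s"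
    unfolding s'_def using A.smult_cls[of "\<lambda>n. s (n + M)" "1/c"] A.seqs_shift[OF s(1), of M] by simp
  then have "h (A.cls s') = B.cls t'"
    using star_homD(3)[OF h A.cls_carrier[OF s(1)]] t by (simp add: B.smult_cls t'_def[abs_def])
  moreover have "A.N (s' n) \<le> (l + \<delta> / 2) / c" for n
    using M[of "n + M"] c s
    by (simp add: s'_def A.scale A.seqs_polys norm_divide divide_right_mono)
  moreover have "(l + \<delta> / 2) / c < 1" using c \<delta> by (simp add: c_def)
  moreover have "(\<lambda>n. B.N (t' n)) \<longlonglongrightarrow> 1/c * l'"
    using t c by (simp add: t'_def B.scale B.seqs_polys norm_divide tendsto_divide)
  moreover have "s' \<in> A.C" "t' \<in> B.C"
    unfolding s'_def t'_def using A.seqs_shift s t by auto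
  ultimately have "1/c * l' \<le> 1"
    using star_hom_le_1[OF h, of s' _ t'] by blast
  then show "l' \<le> l + \<delta>" using c by (simp add: c_def)
qed

text \<open>Contractivity is applied to \<open>s - a\<close>. Its image is identified by adding
  \<open>a\<close> back, since homomorphisms are given on sums and not on differences.\<close>

lemma star_hom_approx:
  assumes h: "star_hom A.A B.A h"
    and s: "s \<in> A.C" and t: "t \<in> B.C" "h (A.cls s) = B.cls t"
    and a: "a \<in> star_polys X" and w: "w \<in> B.C" "h (A.cst a) = B.cls w"
    and l: "(\<lambda>n. A.N (s n - a)) \<longlonglongrightarrow> l" and l': "(\<lambda>n. B.N (t n - w n)) \<longlonglongrightarrow> l'"
  shows "l' \<le> l"
proof -
  have d: "(\<lambda>n. s n - a) \<in> A.C" using s a by auto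
  obtain u where u: "u \<in> B.C" "h (A.cls (\<lambda>n. s n - a)) = B.cls u"
    using star_hom_image[OF h d] .
  have "A.cls s = A.cls (\<lambda>n. s n - a) \<oplus>\<^bsub>A.A\<^esub> A.cst a"
    using d a by (simp add: cstar_const_def A.add_cls A.seqs_const)
  then have "B.cls t = B.cls u \<oplus>\<^bsub>B.A\<^esub> B.cls w"
    using star_homD(2)[OF h A.cls_carrier[OF d] A.cst_carrier[OF a]] t u w by simp
  then have "(\<lambda>n. B.N (t n - (u n + w n))) \<longlonglongrightarrow> 0"
    using t u w by (simp add: B.add_cls B.cls_eq_iff B.seqs_add)
  then have "B.cls (\<lambda>n. t n - w n) = B.cls u"
    using t u w by (subst B.cls_eq_iff) (auto simp: algebra_simps)
  then show ?thesis
    using star_hom_contractive[OF h d l _ _ l'] t u w by auto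
qed

text \<open>The algebraic operations carry agreement from generators to all constants. These are
  dense, so contractivity of both maps extends it to the completion.\<close>

proposition star_hom_ext:
  assumes h: "star_hom A.A B.A h" and k: "star_hom A.A B.A k"
    and gens: "\<And>x. x \<in> X \<Longrightarrow> h (universal_gen X R x) = k (universal_gen X R x)"
    and a: "a \<in> carrier A.A"
  shows "h a = k a"
proof -
  have const: "h (A.cst b) = k (A.cst b)" if "b \<in> star_polys X" for b
    using that
  proof (induction rule: star_polys_induct)
    case zero
    show ?case
      using star_hom_sum[of X R Y Q h "{}"] star_hom_sum[of X R Y Q k "{}"] h k
      by (simp add: A.cstar_presentation_axioms B.cstar_presentation_axioms)
  next
    case (star b)
    then show ?case
      using star_homD(5)[OF h, of "A.cst b"] star_homD(5)[OF k, of "A.cst b"]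
      by (simp add: A.adj_cst A.cst_carrier)
  next
    case (mult b c)
    then show ?case
      using star_homD(4)[OF h, of "A.cst b" "A.cst c"] star_homD(4)[OF k, of "A.cst b" "A.cst c"]
      by (simp add: A.mult_cst A.cst_carrier)
  next
    case (add b c)
    then show ?case
      using star_homD(2)[OF h, of "A.cst b" "A.cst c"] star_homD(2)[OF k, of "A.cst b" "A.cst c"]
      by (simp add: A.add_cst A.cst_carrier)
  next
    case (scale c b)
    then show ?case
      using star_homD(3)[OF h, of "A.cst b" c] star_homD(3)[OF k, of "A.cst b" c]
      by (simp add: A.smult_cst A.cst_carrier)
  qed (use gens in \<open>simp add: universal_gen_eq_const\<close>)
  obtain s where s: "s \<in> A.C" "a = A.cls s" using a by (rule A.carrierE)
  obtain t where t: "t \<in> B.C" "h a = B.cls t" using star_hom_image[OF h s(1)] s by metis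
  obtain u where u: "u \<in> B.C" "k a = B.cls u" using star_hom_image[OF k s(1)] s by metis
  obtain d where d: "(\<lambda>n. B.N (t n - u n)) \<longlonglongrightarrow> d"
    using B.seqs_norm_convergent[OF B.seqs_diff] t u by blast
  have "d \<le> 0 + \<epsilon>" if \<epsilon>: "0 < \<epsilon>" for \<epsilon>
  proof -
    obtain M where M: "\<forall>m\<ge>M. \<forall>n\<ge>M. A.N (s m - s n) < \<epsilon> / 2"
      using A.seqs_Cauchy[OF s(1), of "\<epsilon> / 2"] \<epsilon> by auto
    have sM: "s M \<in> star_polys X" using s by (simp add: A.seqs_polys)
    obtain l where l: "(\<lambda>n. A.N (s n - s M)) \<longlonglongrightarrow> l"
      using A.seqs_norm_convergent[OF A.seqs_diff[OF s(1) A.seqs_const[OF sM]]] .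
    have "l \<le> \<epsilon> / 2"
      by (rule LIMSEQ_le_const2[OF l]) (use M in \<open>auto intro: less_imp_le\<close>)
    \<comment> \<open>One \<open>w\<close> represents the common image of the constant under
      \<open>h\<close> and \<open>k\<close>; in the limit both \<open>t\<close> and \<open>u\<close>
      are within \<epsilon>/2 of it.\<close>
    obtain w where w: "w \<in> B.C" "h (A.cst (s M)) = B.cls w"
      using star_hom_image[OF h A.seqs_const[OF sM]] by (auto simp: cstar_const_def)
    obtain l1 where l1: "(\<lambda>n. B.N (t n - w n)) \<longlonglongrightarrow> l1"
      using B.seqs_norm_convergent[OF B.seqs_diff[OF t(1) w(1)]] .
    obtain l2 where l2: "(\<lambda>n. B.N (u n - w n)) \<longlonglongrightarrow> l2"
      using B.seqs_norm_convergent[OF B.seqs_diff[OF u(1) w(1)]] .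
    note l12 = l1 l2
    have "l1 \<le> l"
      by (rule star_hom_approx[OF h s(1) t(1) _ sM w l l1]) (use s t in simp)
    moreover have "l2 \<le> l"
      by (rule star_hom_approx[OF k s(1) u(1) _ sM w(1) _ l l2]) (use s u w const[OF sM] in simp_all)
    moreover have "d \<le> l1 + l2"
    proof (rule LIMSEQ_le[OF d tendsto_add[OF l12]])
      have "B.N (t n - u n) \<le> B.N (t n - w n) + B.N (u n - w n)" for n
        using B.triangle_diff[of "t n" "w n" "u n"] B.minus_commute[of "u n" "w n"] t u w
        by (simp add: B.seqs_polys)
      then show "\<exists>M. \<forall>n\<ge>M. B.N (t n - u n) \<le> B.N (t n - w n) + B.N (u n - w n)" by blast
    qed
    ultimately show ?thesis using \<open>l \<le> \<epsilon> / 2\<close> by simp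
  qed
  then have "d \<le> 0" by (rule field_le_epsilon)
  moreover have "0 \<le> d"
    using t u by (intro LIMSEQ_le_const[OF d]) (auto simp: B.nonneg B.seqs_polys star_polys_diff)
  ultimately have "h a = k a"
    using d t u by (simp add: B.cls_eq_iff)
  then show ?thesis .
qed

end

section \<open>Graph C*-algebras\<close>

context star_seminorm
begin

lemma eqv_norm: "a \<approx> b \<Longrightarrow> p a = p b"
  using reverse_triangle[of a b] by (simp add: eqv_def)

lemma eqv_sandwich:
  assumes "b \<approx> b'" "a \<in> star_polys X" "c \<in> star_polys X"
  shows "a * b * c \<approx> a * b' * c"
  using assms by (intro eqv_mult) auto

lemma eqv_sandwich_0:
  assumes "b \<approx> 0" "a \<in> star_polys X" "c \<in> star_polys X"
  shows "a * b * c \<approx> 0"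
  using eqv_sandwich[OF assms] by simp

lemma eqv_sum_single:
  assumes "finite I" "j \<in> I" "a j \<approx> b" "\<And>i. i \<in> I \<Longrightarrow> i \<noteq> j \<Longrightarrow> a i \<approx> 0"
  shows "(\<Sum>i \<in> I. a i) \<approx> b"
proof -
  have "a j + (\<Sum>i \<in> I - {j}. a i) \<approx> b + 0"
    using assms by (intro eqv_add eqv_0_sum) auto
  then show ?thesis using assms by (simp add: sum.remove)
qed

end

abbreviation V :: "'v \<Rightarrow> ('v + 'e) star_poly" where
  "V v \<equiv> gen (Inl v)"

abbreviation D :: "'e \<Rightarrow> ('v + 'e) star_poly" where
  "D e \<equiv> gen (Inr e)"

text \<open>It is used twice: for an arbitrary competitor in the supremum, to bound the generators,
  and afterwards for the universal norm itself.\<close>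

locale graph_seminorm = wf_digraph G + star_seminorm "graph_gens G" p
  for G :: "('v, 'e) pre_digraph" (structure) and p +
  assumes rels: "r \<in> graph_rels G \<Longrightarrow> p r = 0"
begin

notation eqv (infix \<open>\<approx>\<close> 50)

abbreviation "polys \<equiv> star_polys (graph_gens G)"

lemma V_poly [simp, intro]: "v \<in> verts G \<Longrightarrow> V v \<in> polys"
  and D_poly [simp, intro]: "e \<in> arcs G \<Longrightarrow> D e \<in> polys"
  by (auto simp: graph_gens_def)

lemma V_star: "v \<in> verts G \<Longrightarrow> poly_star (V v) \<approx> V v"
  by (rule eqvI) (auto intro!: rels star_polys_star simp: graph_rels_def)

lemma V_idem: "v \<in> verts G \<Longrightarrow> V v * V v \<approx> V v"
  by (rule eqvI) (auto intro!: rels star_polys_mult simp: graph_rels_def)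

lemma V_orth: "v \<in> verts G \<Longrightarrow> w \<in> verts G \<Longrightarrow> v \<noteq> w \<Longrightarrow> V v * V w \<approx> 0"
  by (rule eqvI) (auto intro!: rels star_polys_mult simp: graph_rels_def)

lemma D_star_D: "e \<in> arcs G \<Longrightarrow> poly_star (D e) * D e \<approx> V (head G e)"
  by (rule eqvI) (auto intro!: rels star_polys_mult star_polys_star simp: graph_rels_def)

lemma D_orth: "e \<in> arcs G \<Longrightarrow> e' \<in> arcs G \<Longrightarrow> e \<noteq> e' \<Longrightarrow> poly_star (D e) * D e' \<approx> 0"
  by (rule eqvI) (auto intro!: rels star_polys_mult star_polys_star simp: graph_rels_def)

lemma V_D: "e \<in> arcs G \<Longrightarrow> V (tail G e) * D e \<approx> D e"
  by (rule eqvI) (auto intro!: rels star_polys_mult simp: graph_rels_def)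

lemma V_regular:
  assumes "v \<in> reg G"
  shows "V v \<approx> (\<Sum>e \<in> out_arcs G v. D e * poly_star (D e))"
proof (rule eqvI)
  show "V v \<in> polys" using assms by (simp add: reg_def)
  show "(\<Sum>e \<in> out_arcs G v. D e * poly_star (D e)) \<in> polys"
    by (intro star_polys_sum star_polys_mult star_polys_star D_poly) auto
  have "V v - (\<Sum>e \<in> out_arcs G v. D e * poly_star (D e)) \<in> graph_rels G"
    unfolding graph_rels_def using assms by blast
  then show "p (V v - (\<Sum>e \<in> out_arcs G v. D e * poly_star (D e))) = 0" by (rule rels)
qed

lemma V_D_orth:
  assumes "v \<in> verts G" "e \<in> arcs G" "v \<noteq> tail G e"
  shows "V v * D e \<approx> 0"
proof -
  have "V v * D e \<approx> V v * (V (tail G e) * D e)"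
    using assms by (intro eqv_mult eqv_sym[OF V_D]) auto
  also have "V v * (V (tail G e) * D e) = V v * V (tail G e) * D e" by (simp add: mult.assoc)
  also have "\<dots> \<approx> 0"
    using assms by (intro eqv_mult_0_left V_orth) auto
  finally show ?thesis .
qed

text \<open>
  The defining relations only give \<open>S\<^sub>e\<^sup>* S\<^sub>e = S\<^bsub>t(e)\<^esub>\<close>; that \<open>S\<^bsub>t(e)\<^esub>\<close> acts as a right unit on
  \<open>S\<^sub>e\<close> needs the C*-identity.
\<close>

lemma D_V:
  assumes e: "e \<in> arcs G"
  shows "D e * V (head G e) \<approx> D e"
proof -
  let ?h = "V (head G e)"
  let ?d = "D e * ?h - D e"
  have h: "?h \<in> polys" and d: "?d \<in> polys"
    using e by (auto intro!: star_polys_diff star_polys_mult)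
  have DD: "poly_star (D e) * D e \<approx> ?h" using D_star_D e .
  have hh: "?h * ?h \<approx> ?h" using V_idem e by auto
  have sh: "poly_star ?h \<approx> ?h" using V_star e by auto
  have ss: "poly_star ?h * (poly_star (D e) * D e) \<approx> ?h"
    using eqv_mult[OF sh DD] hh by (rule eqv_trans)
  have sss: "poly_star ?h * (poly_star (D e) * D e) * ?h \<approx> ?h"
    using eqv_mult[OF ss eqv_refl[OF h]] hh by (rule eqv_trans)
  have ds: "poly_star (D e) * D e * ?h \<approx> ?h"
    using eqv_mult[OF DD eqv_refl[OF h]] hh by (rule eqv_trans)
  have neg: "- a \<approx> - b" if "a \<approx> b" for a b
    using that minus[of "a - b"] by (auto simp: eqv_def star_polys_diff minus_diff_commute)
  \<comment> \<open>Each of the four products of the expansion reduces to \<open>?h\<close>, and the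
    signs cancel.\<close>
  have "poly_star ?d * ?d = (poly_star ?h * (poly_star (D e) * D e) * ?h
      + - (poly_star ?h * (poly_star (D e) * D e)))
      + (- (poly_star (D e) * D e * ?h) + poly_star (D e) * D e)"
    by (simp add: poly_star_diff poly_star_mult algebra_simps)
  also have "\<dots> \<approx> (?h + - ?h) + (- ?h + ?h)"
    by (intro eqv_add neg sss ss ds DD)
  finally have "p (poly_star ?d * ?d) = 0"
    using eqv_norm by fastforce
  then show ?thesis
    using cstar[OF d] e by (auto intro!: eqvI)
qed

text \<open>Inserting the target projections puts two orthogonal vertices between the factors. This
  removes the cross terms over a fibre of an admissible map, whose edges have distinct
  targets.\<close>

lemma D_D_star_orth:
  assumes e: "e \<in> arcs G" "e' \<in> arcs G" and ne: "head G e \<noteq> head G e'"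
  shows "D e * poly_star (D e') \<approx> 0"
proof -
  let ?h = "V (head G e)" and ?h' = "V (head G e')"
  have h: "?h \<in> polys" "?h' \<in> polys" using e by auto
  have "D e * poly_star (D e') \<approx> D e * ?h * poly_star (D e' * ?h')"
    using e by (intro eqv_mult eqv_star eqv_sym[OF D_V])
  also have "\<dots> = D e * (?h * poly_star ?h') * poly_star (D e')"
    by (simp add: poly_star_mult mult.assoc)
  also have "\<dots> \<approx> D e * (?h * ?h') * poly_star (D e')"
    using e h by (intro eqv_mult V_star) (auto intro: star_polys_star)
  also have "\<dots> \<approx> 0"
    using e ne by (intro eqv_mult_0_left eqv_mult_0_right V_orth) (auto intro: star_polys_star)
  finally show ?thesis .
qed

lemma norm_V_le_1: "v \<in> verts G \<Longrightarrow> p (V v) \<le> 1"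
proof -
  assume v: "v \<in> verts G"
  have "poly_star (V v) * V v \<approx> V v * V v" using v by (intro eqv_mult V_star) auto
  also have "V v * V v \<approx> V v" using v by (rule V_idem)
  finally have "(p (V v))\<^sup>2 = p (V v)" using eqv_norm cstar v by fastforce
  then have "p (V v) = 0 \<or> p (V v) = 1" by (simp add: power2_eq_square)
  then show ?thesis by auto
qed

lemma norm_D_le_1: "e \<in> arcs G \<Longrightarrow> p (D e) \<le> 1"
proof -
  assume e: "e \<in> arcs G"
  then have "(p (D e))\<^sup>2 = p (V (head G e))" using eqv_norm[OF D_star_D[OF e]] cstar[of "D e"] by auto
  also have "\<dots> \<le> 1" using e norm_V_le_1 by auto
  finally show ?thesis using nonneg[of "D e"] e by (simp add: abs_square_le_1)
qed

end

text \<open>The relations bound all generators by 1 for every competing seminorm at once, and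
  uniform bounds are inherited through adjoints, products, scalars and sums.\<close>

lemma cstar_presentation_graph:
  assumes "wf_digraph E"
  shows "cstar_presentation (graph_gens E) (graph_rels E)"
proof
  let ?K = "{p. cstar_seminorm (graph_gens E) p \<and> (\<forall>r \<in> graph_rels E. p r = 0)}"
  fix a assume "a \<in> star_polys (graph_gens E)"
  then have "\<exists>M. \<forall>p \<in> ?K. p a \<le> M"
  proof (induction rule: star_polys_induct)
    case (gen x)
    have "p (gen x) \<le> 1" if "p \<in> ?K" for p
    proof -
      interpret wf_digraph E by fact
      interpret graph_seminorm E p using that by unfold_locales auto
      show ?thesis using gen norm_V_le_1 norm_D_le_1 by (auto simp: graph_gens_def)
    qed
    then show ?case by blast
  next
    case (star a)
    then obtain M where M: "\<forall>p \<in> ?K. p a \<le> M" by blast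
    have "p (poly_star a) \<le> M" if "p \<in> ?K" for p
      using that M star star_seminorm.star[of "graph_gens E" p a] by (simp add: star_seminorm_def)
    then show ?case by blast
  next
    case (mult a b)
    then obtain M M' where M: "\<forall>p \<in> ?K. p a \<le> M" "\<forall>p \<in> ?K. p b \<le> M'" by blast
    have "p (a * b) \<le> M * M'" if "p \<in> ?K" for p
    proof -
      interpret star_seminorm "graph_gens E" p using that by unfold_locales auto
      have "p (a * b) \<le> p a * p b" using submult mult by blast
      also have "\<dots> \<le> M * M'"
        using M that nonneg mult by (intro mult_mono) (auto intro: order_trans[of 0 "p a" M])
      finally show ?thesis .
    qed
    then show ?case by blast
  next
    case (scale c a)
    then obtain M where M: "\<forall>p \<in> ?K. p a \<le> M" by blast
    have "p (poly_scale c a) \<le> cmod c * M" if "p \<in> ?K" for p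
      using that M scale by (auto simp: star_seminorm.scale[unfolded star_seminorm_def] mult_left_mono)
    then show ?case by blast
  next
    case (add a b)
    then obtain M M' where M: "\<forall>p \<in> ?K. p a \<le> M" "\<forall>p \<in> ?K. p b \<le> M'" by blast
    have "p (a + b) \<le> M + M'" if "p \<in> ?K" for p
      using that M add star_seminorm.triangle[unfolded star_seminorm_def, of "graph_gens E" p a b] by force
    then show ?case by blast
  next
    case zero
    have "p 0 \<le> 0" if "p \<in> ?K" for p
      using that star_seminorm.zero[of "graph_gens E" p] by (simp add: star_seminorm_def)
    then show ?case by blast
  qed
  then show "bdd_above {p a | p. cstar_seminorm (graph_gens E) p \<and> (\<forall>r \<in> graph_rels E. p r = 0)}"
    by (auto intro: bdd_aboveI)
qed

locale cstar_graph = wf_digraph G for G :: "('v, 'e) pre_digraph" (structure)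
begin

sublocale cstar_presentation "graph_gens G" "graph_rels G"
  by (rule cstar_presentation_graph) (rule wf_digraph_axioms)

sublocale graph_seminorm G "universal_norm (graph_gens G) (graph_rels G)"
  by unfold_locales (rule universal_norm_rel)

notation eqv (infix \<open>\<approx>\<close> 50)

lemma S_vert_eq: "S_vert G v = cst (V v)"
  and S_arc_eq: "S_arc G e = cst (D e)"
  by (simp_all add: S_vert_def S_arc_def universal_gen_eq_const)

end

lemma graph_rels_cases [consumes 1, case_names self_adjoint idempotent orthogonal isometry
    orthogonal_arcs source regular]:
  assumes "r \<in> graph_rels E"
  obtains v where "v \<in> verts E" "r = poly_star (V v) - V v"
  | v where "v \<in> verts E" "r = V v * V v - V v"
  | v w where "v \<in> verts E" "w \<in> verts E" "v \<noteq> w" "r = V v * V w"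
  | e where "e \<in> arcs E" "r = poly_star (D e) * D e - V (head E e)"
  | e e' where "e \<in> arcs E" "e' \<in> arcs E" "e \<noteq> e'" "r = poly_star (D e) * D e'"
  | e where "e \<in> arcs E" "r = V (tail E e) * D e - D e"
  | v where "v \<in> reg E" "r = V v - (\<Sum>e \<in> out_arcs E v. D e * poly_star (D e))"
  using assms unfolding graph_rels_def
  by (elim UnE CollectE exE conjE)
    ((rule that(1); assumption), (rule that(2); assumption), (rule that(3); assumption),
      (rule that(4); assumption), (rule that(5); assumption), (rule that(6); assumption),
      (rule that(7); assumption))

section \<open>Pullback along admissible homomorphisms\<close>

text \<open>Finite fibres make the sums legitimate, bijectivity on targets gives the isometry
  relation and kills cross terms, and the condition on regular vertices gives the summation
  relation.\<close>

proposition pullback_exists: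
  fixes H :: "('a, 'b) pre_digraph" and F :: "('c, 'd) pre_digraph"
  assumes F: "wf_digraph F" and H: "wf_digraph H" and adm: "admissible H F gv ge"
  obtains h where "is_pullback H F gv ge h"
proof -
  interpret F: cstar_graph F using F by (simp add: cstar_graph_def)
  interpret H: cstar_graph H using H by (simp add: cstar_graph_def)
  let ?Vf = "vfibre H gv" and ?Df = "afibre H ge"
  have hom: "\<And>e. e \<in> arcs H \<Longrightarrow> gv (tail H e) = tail F (ge e)"
    and gv: "\<And>u. u \<in> verts H \<Longrightarrow> gv u \<in> verts F" and ge: "\<And>e. e \<in> arcs H \<Longrightarrow> ge e \<in> arcs F"
    and finV: "\<And>v. v \<in> verts F \<Longrightarrow> finite (?Vf v)" and finD: "\<And>e. e \<in> arcs F \<Longrightarrow> finite (?Df e)"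
    and bij: "\<And>x. x \<in> arcs F \<Longrightarrow> bij_betw (head H) (?Df x) (?Vf (head F x))"
    and reg: "\<And>u. u \<in> verts H \<Longrightarrow> gv u \<in> reg F \<Longrightarrow> u \<in> reg H"
    using adm by (auto simp: admissible_def graph_hom_def)
  define y where "y = case_sum (\<lambda>v. \<Sum>u \<in> ?Vf v. V u) (\<lambda>e. \<Sum>x \<in> ?Df e. (D x :: ('a + 'b) star_poly))"
  have y_V: "y (Inl v) = (\<Sum>u \<in> ?Vf v. V u)" and y_D: "y (Inr e) = (\<Sum>x \<in> ?Df e. D x)" for v e
    by (simp_all add: y_def)
  note subst_simps = subst_diff subst_mult subst_star subst_sum y_V y_D poly_star_sum sum_product
  have "H.N (subst y r) = 0" if "r \<in> graph_rels F" for r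
    using that
  proof (cases rule: graph_rels_cases)
    case (self_adjoint v)
    then show ?thesis
      by (auto simp: subst_simps intro!: H.eqv_diff_0 H.eqv_sum H.V_star)
  next
    case (idempotent v)
    have "H.eqv (\<Sum>u \<in> ?Vf v. \<Sum>u' \<in> ?Vf v. V u * V u') (\<Sum>u \<in> ?Vf v. V u)"
    proof (rule H.eqv_sum)
      fix u assume "u \<in> ?Vf v"
      then show "H.eqv (\<Sum>u' \<in> ?Vf v. V u * V u') (V u)"
        using finV[OF idempotent(1)] by (intro H.eqv_sum_single[of _ u] H.V_idem H.V_orth) auto
    qed
    then show ?thesis
      using idempotent by (simp add: subst_simps H.eqv_diff_0)
  next
    case (orthogonal v w)
    have "H.eqv (\<Sum>u \<in> ?Vf v. \<Sum>u' \<in> ?Vf w. V u * V u') 0"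
      using orthogonal by (intro H.eqv_0_sum H.V_orth) auto
    then show ?thesis
      using orthogonal H.eqv_norm by (force simp: subst_simps)
  next
    case (isometry e)
    have "H.eqv (\<Sum>x \<in> ?Df e. \<Sum>x' \<in> ?Df e. poly_star (D x) * D x') (\<Sum>x \<in> ?Df e. V (head H x))"
    proof (rule H.eqv_sum)
      fix x assume "x \<in> ?Df e"
      then show "H.eqv (\<Sum>x' \<in> ?Df e. poly_star (D x) * D x') (V (head H x))"
        using finD[OF isometry(1)] by (intro H.eqv_sum_single[of _ x] H.D_star_D H.D_orth) auto
    qed
    also have "(\<Sum>x \<in> ?Df e. V (head H x)) = (\<Sum>u \<in> ?Vf (head F e). V u)"
      by (rule sum.reindex_bij_betw[OF bij[OF isometry(1)]])
    finally show ?thesis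
      using isometry by (simp add: subst_simps H.eqv_diff_0)
  next
    case (orthogonal_arcs e e')
    have "H.eqv (\<Sum>x \<in> ?Df e. \<Sum>x' \<in> ?Df e'. poly_star (D x) * D x') 0"
      using orthogonal_arcs by (intro H.eqv_0_sum H.D_orth) auto
    then show ?thesis
      using orthogonal_arcs H.eqv_norm by (force simp: subst_simps)
  next
    case (source e)
    have "H.eqv (\<Sum>x \<in> ?Df e. \<Sum>u \<in> ?Vf (tail F e). V u * D x) (\<Sum>x \<in> ?Df e. D x)"
    proof (rule H.eqv_sum)
      fix x assume "x \<in> ?Df e"
      then show "H.eqv (\<Sum>u \<in> ?Vf (tail F e). V u * D x) (D x)"
        using finV[OF F.tail_in_verts[OF source(1)]] hom[of x]
        by (intro H.eqv_sum_single[of _ "tail H x"] H.V_D H.V_D_orth) auto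
    qed
    then show ?thesis
      using source sum.swap[of "\<lambda>u x. V u * D x" "?Df e" "?Vf (tail F e)"]
      by (simp add: subst_simps H.eqv_diff_0)
  next
    case (regular v)
    then have v: "v \<in> verts F" and fin: "finite (out_arcs F v)" by (auto simp: reg_def)
    let ?D = "\<lambda>x. D x * poly_star (D x)"
    \<comment> \<open>The edges emitted over \<open>v\<close>, to be grouped once by their source in
      \<open>H\<close> and once by their image in \<open>F\<close>.\<close>
    define U where "U = {x \<in> arcs H. gv (tail H x) = v}"
    have U_eq: "U = (\<Union>e \<in> out_arcs F v. ?Df e)" using hom ge by (auto simp: U_def)
    have finU: "finite U" unfolding U_eq using fin finD by auto
    have "H.eqv (\<Sum>u \<in> ?Vf v. V u) (\<Sum>u \<in> ?Vf v. \<Sum>x \<in> out_arcs H u. ?D x)"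
      using reg regular by (intro H.eqv_sum H.V_regular) auto
    also have "(\<Sum>u \<in> ?Vf v. \<Sum>x \<in> out_arcs H u. ?D x) = (\<Sum>u \<in> ?Vf v. \<Sum>x \<in> {x \<in> U. tail H x = u}. ?D x)"
      by (intro sum.cong) (auto simp: U_def)
    also have "\<dots> = (\<Sum>x \<in> U. ?D x)"
      by (rule sum.group[OF finU finV[OF v]]) (auto simp: U_def)
    also have "\<dots> = (\<Sum>e \<in> out_arcs F v. \<Sum>x \<in> {x \<in> U. ge x = e}. ?D x)"
      by (rule sum.group[OF finU fin, symmetric]) (auto simp: U_eq)
    also have "\<dots> = (\<Sum>e \<in> out_arcs F v. \<Sum>x \<in> ?Df e. ?D x)"
      by (intro sum.cong) (auto simp: U_eq)
    finally have 1: "H.eqv (\<Sum>u \<in> ?Vf v. V u) (\<Sum>e \<in> out_arcs F v. \<Sum>x \<in> ?Df e. ?D x)" .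
    have "H.eqv (\<Sum>e \<in> out_arcs F v. \<Sum>x \<in> ?Df e. \<Sum>x' \<in> ?Df e. D x * poly_star (D x'))
        (\<Sum>e \<in> out_arcs F v. \<Sum>x \<in> ?Df e. ?D x)"
    proof (intro H.eqv_sum)
      fix e x assume e: "e \<in> out_arcs F v" and x: "x \<in> ?Df e"
      show "H.eqv (\<Sum>x' \<in> ?Df e. D x * poly_star (D x')) (?D x)"
      proof (rule H.eqv_sum_single[of _ x])
        fix x' assume x': "x' \<in> ?Df e" "x' \<noteq> x"
        have "head H x \<noteq> head H x'"
          using bij[of e] e x x' by (auto simp: bij_betw_def inj_on_def)
        then show "H.eqv (D x * poly_star (D x')) 0"
          using x x' by (intro H.D_D_star_orth) auto
      qed (use e x finD in \<open>auto intro!: star_polys_mult star_polys_star\<close>)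
    qed
    from H.eqv_trans[OF 1 H.eqv_sym[OF this]] show ?thesis
      using regular by (simp add: subst_simps H.eqv_diff_0)
  qed
  moreover have "y x \<in> star_polys (graph_gens H)" if "x \<in> graph_gens F" for x
    using that by (auto simp: graph_gens_def[of F] y_def intro!: star_polys_sum H.V_poly H.D_poly)
  ultimately obtain h where h: "star_hom F.A H.A h"
      "\<And>a. a \<in> F.polys \<Longrightarrow> h (F.cst a) = H.cst (subst y a)"
    using star_hom_subst[OF F.cstar_presentation_axioms H.cstar_presentation_axioms] by blast
  have "h (S_vert F v) = (\<Oplus>\<^bsub>H.A\<^esub> u \<in> ?Vf v. S_vert H u)" if "v \<in> verts F" for v
    using that finV by (simp add: F.S_vert_eq H.S_vert_eq h y_V) (rule H.finsum_cst[symmetric], auto)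
  moreover have "h (S_arc F e) = (\<Oplus>\<^bsub>H.A\<^esub> x \<in> ?Df e. S_arc H x)" if "e \<in> arcs F" for e
    using that finD by (simp add: F.S_arc_eq H.S_arc_eq h y_D) (rule H.finsum_cst[symmetric], auto)
  ultimately have "is_pullback H F gv ge h"
    using h(1) by (simp add: is_pullback_def graph_cstar_def)
  then show ?thesis by (rule that)
qed

section \<open>Paths\<close>

context wf_digraph
begin

lemma FP_Nil [simp]: "(u, []) \<in> FP G \<longleftrightarrow> u \<in> verts G"
  by (simp add: FP_def path_target_def awalk_def)

lemma FP_Cons [simp]: "(u, e # es) \<in> FP G \<longleftrightarrow> e \<in> arcs G \<and> tail G e = u \<and> (head G e, es) \<in> FP G"
  by (auto simp: FP_def path_target_def awalk_def)

lemma path_target_Nil [simp]: "path_target G (u, []) = u"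
  and path_target_Cons [simp]: "path_target G (u, e # es) = path_target G (head G e, es)"
  by (simp_all add: path_target_def)

lemma path_target_append: "path_target G (u, es @ es') = path_target G (path_target G (u, es), es')"
  by (induction es arbitrary: u) simp_all

lemma FP_append: "(u, es @ es') \<in> FP G \<longleftrightarrow> (u, es) \<in> FP G \<and> (path_target G (u, es), es') \<in> FP G"
proof (induction es arbitrary: u)
  case Nil
  then show ?case by (cases es') auto
qed auto

lemma path_target_in_verts: "(u, es) \<in> FP G \<Longrightarrow> path_target G (u, es) \<in> verts G"
  by (induction es arbitrary: u) auto

lemma FP_start_in_verts: "(u, es) \<in> FP G \<Longrightarrow> u \<in> verts G"
  by (cases es) auto

end

section \<open>Path monomials and their orthogonality\<close>

fun path_poly :: "('v, 'e) pre_digraph \<Rightarrow> ('v, 'e) fpath \<Rightarrow> ('v + 'e) star_poly" where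
  "path_poly E (u, []) = V u"
| "path_poly E (u, [e]) = D e"
| "path_poly E (u, e # e' # es) = D e * path_poly E (head E e, e' # es)"

text \<open>Read at the two inner paths, this is the condition for a product in the graph inverse
  semigroup to be nonzero.\<close>

definition fp_comparable :: "('v, 'e) fpath \<Rightarrow> ('v, 'e) fpath \<Rightarrow> bool" where
  "fp_comparable \<alpha> \<beta> \<longleftrightarrow> fst \<alpha> = fst \<beta> \<and> \<not> (snd \<alpha> \<parallel> snd \<beta>)"

context cstar_graph
begin

abbreviation "P \<equiv> path_poly G"

lemma path_poly_poly: "\<alpha> \<in> FP G \<Longrightarrow> P \<alpha> \<in> polys"
proof (induction "snd \<alpha>" arbitrary: \<alpha>)
  case (Cons e es)
  then show ?case by (cases \<alpha>; cases es) (auto intro!: star_polys_mult)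
qed (cases \<alpha>, auto)

lemma S_path_eq: "\<alpha> \<in> FP G \<Longrightarrow> S_path G \<alpha> = cst (P \<alpha>)"
proof (induction "snd \<alpha>" arbitrary: \<alpha>)
  case (Cons e es)
  then show ?case
    by (cases \<alpha>; cases es) (auto simp: S_arc_eq graph_cstar_def mult_cst path_poly_poly)
qed (cases \<alpha>, auto simp: S_vert_eq)

lemma S_gis_eq:
  "\<alpha> \<in> FP G \<Longrightarrow> \<beta> \<in> FP G \<Longrightarrow> S_gis G (Some (\<alpha>, \<beta>)) = cst (P \<alpha> * poly_star (P \<beta>))"
  by (simp add: S_path_eq graph_cstar_def mult_cst adj_cst path_poly_poly star_polys_star)

text \<open>A monomial carries no vertex letter after its last edge; for a single edge the identity
  is therefore \<open>D_V\<close>.\<close>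

lemma path_poly_Cons:
  assumes "(u, e # es) \<in> FP G"
  shows "P (u, e # es) \<approx> D e * P (head G e, es)"
proof (cases es)
  case Nil
  then show ?thesis using assms eqv_sym[OF D_V] by simp
next
  case (Cons e' es')
  then show ?thesis
    using path_poly_poly[OF assms] by simp
qed

lemma V_path_poly:
  assumes "(u, es) \<in> FP G"
  shows "V u * P (u, es) \<approx> P (u, es)"
proof (cases es)
  case Nil
  then show ?thesis using assms V_idem by simp
next
  case (Cons e es')
  then have e: "e \<in> arcs G" "tail G e = u" "(head G e, es') \<in> FP G" using assms by auto
  have u: "u \<in> verts G" using e by auto
  have P: "P (u, es) \<approx> D e * P (head G e, es')" unfolding Cons by (rule path_poly_Cons) (use assms Cons in simp)
  have "V u * P (u, es) \<approx> V u * (D e * P (head G e, es'))"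
    using P u by (intro eqv_mult) auto
  also have "V u * (D e * P (head G e, es')) = V u * D e * P (head G e, es')" by (simp add: mult.assoc)
  also have "\<dots> \<approx> D e * P (head G e, es')"
    using V_D[OF e(1)] e by (intro eqv_mult) (auto simp: path_poly_poly)
  also have "\<dots> \<approx> P (u, es)" using P by (rule eqv_sym)
  finally show ?thesis .
qed

lemma path_poly_append:
  assumes "(u, es @ es') \<in> FP G"
  shows "P (u, es @ es') \<approx> P (u, es) * P (path_target G (u, es), es')"
  using assms
proof (induction es arbitrary: u)
  case Nil
  then show ?case using eqv_sym[OF V_path_poly] by simp
next
  case (Cons e es)
  then have e: "e \<in> arcs G" "(head G e, es @ es') \<in> FP G" by auto
  have "P (u, (e # es) @ es') \<approx> D e * P (head G e, es @ es')"
    using path_poly_Cons[of u e "es @ es'"] Cons.prems by simp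
  also have "\<dots> \<approx> D e * (P (head G e, es) * P (path_target G (head G e, es), es'))"
    using Cons e by (intro eqv_mult) auto
  also have "\<dots> = D e * P (head G e, es) * P (path_target G (u, e # es), es')"
    by (simp add: mult.assoc)
  also have "\<dots> \<approx> P (u, e # es) * P (path_target G (u, e # es), es')"
    using Cons.prems by (intro eqv_mult eqv_sym[OF path_poly_Cons])
      (auto simp: FP_append path_poly_poly)
  finally show ?case .
qed

lemma path_poly_V:
  assumes "\<alpha> \<in> FP G"
  shows "P \<alpha> * V (path_target G \<alpha>) \<approx> P \<alpha>"
proof (cases \<alpha>)
  case (Pair u es)
  then show ?thesis using eqv_sym[OF path_poly_append[of u es "[]"]] assms by simp
qed

text \<open>The common edge collapses to its target projection, which acts as a left unit on the
  remaining monomial.\<close>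

lemma path_poly_cancel:
  assumes "(u, e # es) \<in> FP G" "(u, e # es') \<in> FP G"
  shows "poly_star (P (u, e # es)) * P (u, e # es') \<approx>
    poly_star (P (head G e, es)) * P (head G e, es')"
proof -
  let ?p = "P (head G e, es)" and ?q = "P (head G e, es')"
  have e: "e \<in> arcs G" and pq: "?p \<in> polys" "?q \<in> polys" using assms by (auto simp: path_poly_poly)
  have "poly_star (P (u, e # es)) * P (u, e # es') \<approx> poly_star (D e * ?p) * (D e * ?q)"
    using assms by (intro eqv_mult eqv_star path_poly_Cons)
  also have "\<dots> = poly_star ?p * (poly_star (D e) * D e * ?q)"
    by (simp add: poly_star_mult mult.assoc)
  also have "\<dots> \<approx> poly_star ?p * (V (head G e) * ?q)"
    using pq e by (intro eqv_mult D_star_D) (auto intro: star_polys_star)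
  also have "\<dots> \<approx> poly_star ?p * ?q"
    using pq assms by (intro eqv_mult V_path_poly) (auto intro: star_polys_star)
  finally show ?thesis .
qed

lemma path_poly_isometry:
  assumes "(u, es) \<in> FP G"
  shows "poly_star (P (u, es)) * P (u, es) \<approx> V (path_target G (u, es))"
  using assms
proof (induction es arbitrary: u)
  case Nil
  then have "poly_star (V u) * V u \<approx> V u * V u" by (intro eqv_mult V_star) auto
  also have "\<dots> \<approx> V u" using Nil by (simp add: V_idem)
  finally show ?case by simp
next
  case (Cons e es)
  then show ?case
    using eqv_trans[OF path_poly_cancel[OF Cons.prems Cons.prems]] by auto
qed

text \<open>Different initial vertices are separated by their projections. With a common one, shared
  edges cancel until two distinct edges meet.\<close>

lemma path_poly_orth:
  assumes "\<alpha> \<in> FP G" "\<beta> \<in> FP G" "\<not> fp_comparable \<alpha> \<beta>"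
  shows "poly_star (P \<alpha>) * P \<beta> \<approx> 0"
proof -
  obtain u es u' es' where \<alpha>: "\<alpha> = (u, es)" and \<beta>: "\<beta> = (u', es')" by force
  show ?thesis
  proof (cases "u = u'")
    case False
    have FP: "(u, es) \<in> FP G" "(u', es') \<in> FP G" and u: "u \<in> verts G" "u' \<in> verts G"
      using assms \<alpha> \<beta> FP_start_in_verts by auto
    have "poly_star (P \<alpha>) * P \<beta> \<approx> poly_star (V u * P \<alpha>) * (V u' * P \<beta>)"
      using FP unfolding \<alpha> \<beta> by (intro eqv_mult eqv_star eqv_sym[OF V_path_poly])
    also have "\<dots> = poly_star (P \<alpha>) * (poly_star (V u) * (V u' * P \<beta>))"
      by (simp add: poly_star_mult mult.assoc)
    also have "\<dots> \<approx> poly_star (P \<alpha>) * (V u * (V u' * P \<beta>))"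
      using u assms by (intro eqv_mult V_star) (auto simp: path_poly_poly intro!: star_polys_star star_polys_mult)
    also have "\<dots> = poly_star (P \<alpha>) * ((V u * V u') * P \<beta>)" by (simp add: mult.assoc)
    also have "\<dots> \<approx> 0"
      using u assms False by (intro eqv_mult_0_right eqv_mult_0_left V_orth)
        (auto simp: path_poly_poly intro!: star_polys_star)
    finally show ?thesis .
  next
    case True
    have "es \<parallel> es'" using assms True by (simp add: fp_comparable_def \<alpha> \<beta>)
    then have "poly_star (P (u, es)) * P (u, es') \<approx> 0" if "(u, es) \<in> FP G" "(u, es') \<in> FP G"
      using that
    proof (induction es arbitrary: u es')
      case (Cons e es)
      then obtain f fs where es': "es' = f # fs" by (cases es') auto
      show ?case
      proof (cases "e = f")
        case True
        then have "es \<parallel> fs" using Cons.prems(1) es' by (auto simp: parallel_def)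
        then show ?thesis
          using Cons.IH[of fs "head G e"] path_poly_cancel[of u e es fs] Cons.prems True es'
          by (auto intro: eqv_trans)
      next
        case False
        have e: "e \<in> arcs G" "f \<in> arcs G" and FP: "(head G e, es) \<in> FP G" "(head G f, fs) \<in> FP G"
          using Cons.prems es' by auto
        have "poly_star (P (u, e # es)) * P (u, f # fs)
            \<approx> poly_star (D e * P (head G e, es)) * (D f * P (head G f, fs))"
          using Cons.prems es' by (intro eqv_mult eqv_star path_poly_Cons) auto
        also have "\<dots> = poly_star (P (head G e, es)) * (poly_star (D e) * D f * P (head G f, fs))"
          by (simp add: poly_star_mult mult.assoc)
        also have "\<dots> \<approx> 0"
          using e FP False by (intro eqv_mult_0_right eqv_mult_0_left D_orth)
            (auto simp: path_poly_poly intro!: star_polys_star)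
        finally show ?thesis by (simp add: es')
      qed
    qed simp
    then show ?thesis using assms True by (simp add: \<alpha> \<beta>)
  qed
qed

end

section \<open>Extended path homomorphisms from path labellings\<close>

lemma not_parallel_append: "\<not> (xs @ xs') \<parallel> (ys @ ys') \<Longrightarrow> \<not> xs \<parallel> ys"
  using parallel_append by blast

lemma fp_comparable_append:
  "fp_comparable (u, p @ p') (u', q @ q') \<Longrightarrow> fp_comparable (u, p) (u', q)"
  using not_parallel_append by (fastforce simp: fp_comparable_def)

lemma gis_mult_eq_None: "gis_mult (Some (\<alpha>, \<beta>)) (Some (\<gamma>, \<delta>)) = None \<longleftrightarrow> \<not> fp_comparable \<beta> \<gamma>"
  by (auto simp: fp_comparable_def parallel_def)

text \<open>The order makes the smaller element the product of \<open>(\<alpha>, \<alpha>)\<close>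
  and \<open>(\<tau>, \<tau>)\<close>; a nonzero such product is again idempotent, with the longer
  path in both places.\<close>

lemma gis_le_idempotent:
  assumes "gis_le (Some (\<alpha>, \<beta>)) (Some (\<tau>, \<tau>))"
  shows "\<beta> = \<alpha> \<and> fst \<alpha> = fst \<tau> \<and> prefix (snd \<tau>) (snd \<alpha>)"
  using assms by (cases \<alpha>; cases \<beta>; cases \<tau>) (auto simp: gis_le_def split: if_splits elim!: prefixE)

text \<open>
  A vertex \<open>z\<close> of \<open>G\<close> is sent to the path \<open>(start z, vlabel z)\<close> of \<open>E\<close>. The edge \<open>e\<close> of \<open>G\<close> is sent to
  the path \<open>\<mu>(e)\<close> that extends the path of its source by \<open>elabel e\<close>, and which ends where the path of
  its target ends. As the element \<open>(e, t(e))\<close> of \<open>S(G)\<close> goes to \<open>(\<mu>(e), \<mu>(t(e)))\<close>, concatenating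
  edges of \<open>G\<close> amounts to concatenating their labels.
\<close>

locale path_labelling = G: wf_digraph G + E: cstar_graph E
  for G :: "('a, 'b) pre_digraph" and E :: "('v, 'e) pre_digraph" +
  fixes start :: "'a \<Rightarrow> 'v" and vlabel :: "'a \<Rightarrow> 'e list" and elabel :: "'b \<Rightarrow> 'e list"
  assumes vlabel: "z \<in> verts G \<Longrightarrow> (start z, vlabel z) \<in> FP E"
    and elabel: "e \<in> arcs G \<Longrightarrow>
      (path_target E (start (tail G e), vlabel (tail G e)), elabel e) \<in> FP E"
    and elabel_target: "e \<in> arcs G \<Longrightarrow>
      path_target E (start (tail G e), vlabel (tail G e) @ elabel e)
        = path_target E (start (head G e), vlabel (head G e))"
    and incomparable: "y \<in> verts G \<Longrightarrow> z \<in> verts G \<Longrightarrow> y \<noteq> z \<Longrightarrow>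
      \<not> fp_comparable (start y, vlabel y) (start z, vlabel z)"
    and parallel: "d \<in> arcs G \<Longrightarrow> e \<in> arcs G \<Longrightarrow> tail G d = tail G e \<Longrightarrow> d \<noteq> e \<Longrightarrow>
      elabel d \<parallel> elabel e"
begin

definition labels :: "'b list \<Rightarrow> 'e list" where
  "labels es = concat (map elabel es)"

definition path_map :: "('a, 'b) fpath \<Rightarrow> ('v, 'e) fpath" where
  "path_map \<alpha> = (start (fst \<alpha>), vlabel (fst \<alpha>) @ labels (snd \<alpha>))"

definition gis_map :: "('a, 'b) gis \<Rightarrow> ('v, 'e) gis" where
  "gis_map = map_option (map_prod path_map path_map)"

lemma labels_simps [simp]:
  "labels [] = []" "labels (e # es) = elabel e @ labels es" "labels (es @ es') = labels es @ labels es'"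
  by (simp_all add: labels_def)

lemma labels_FP:
  assumes "(z, es) \<in> FP G"
  shows "(path_target E (start z, vlabel z), labels es) \<in> FP E \<and>
    path_target E (path_target E (start z, vlabel z), labels es)
      = path_target E (start (path_target G (z, es)), vlabel (path_target G (z, es)))"
  using assms
proof (induction es arbitrary: z)
  case Nil
  then show ?case using vlabel[of z] E.path_target_in_verts by auto
next
  case (Cons e es)
  then show ?case
    using elabel[of e] elabel_target[of e]
    by (auto simp: E.FP_append E.path_target_append)
qed

lemma path_map_FP:
  assumes "\<alpha> \<in> FP G"
  shows "path_map \<alpha> \<in> FP E"
    and "path_target E (path_map \<alpha>) = path_target E (start (path_target G \<alpha>), vlabel (path_target G \<alpha>))"
proof -
  obtain z es where \<alpha>: "\<alpha> = (z, es)" by force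
  then have "z \<in> verts G" using assms G.FP_start_in_verts by auto
  then show "path_map \<alpha> \<in> FP E"
    and "path_target E (path_map \<alpha>) = path_target E (start (path_target G \<alpha>), vlabel (path_target G \<alpha>))"
    using labels_FP[of z es] vlabel[of z] assms
    by (auto simp: \<alpha> path_map_def E.FP_append E.path_target_append)
qed

text \<open>A label may be empty, so lengths are of no help. At the first distinct edges, however,
  the labels are parallel, and extensions of parallel lists stay parallel.\<close>

lemma labels_comparable:
  assumes "(z, p) \<in> FP G" "(z, q) \<in> FP G" "\<not> labels p \<parallel> labels q"
  shows "\<not> p \<parallel> q"
  using assms
proof (induction p arbitrary: z q)
  case (Cons e p)
  show ?case
  proof (cases q)
    case (Cons f q')
    show ?thesis
    proof (cases "e = f")
      case True
      then show ?thesis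
        using Cons.IH[of "head G e" q'] Cons.prems Cons by (auto simp: parallel_def)
    next
      case False
      then have "elabel e \<parallel> elabel f" using parallel[of e f] Cons.prems Cons by auto
      then show ?thesis using Cons.prems(3) Cons not_parallel_append by fastforce
    qed
  qed simp
qed simp

text \<open>Vanishing products must be preserved as well as nonzero ones, so comparability has to be
  reflected too: \<open>incomparable\<close> handles distinct initial vertices and
  \<open>parallel\<close> distinct edges.\<close>

lemma path_map_comparable_iff:
  assumes "\<beta> \<in> FP G" "\<gamma> \<in> FP G"
  shows "fp_comparable (path_map \<beta>) (path_map \<gamma>) \<longleftrightarrow> fp_comparable \<beta> \<gamma>"
proof -
  obtain y p z q where *: "\<beta> = (y, p)" "\<gamma> = (z, q)" by force
  then have FP: "(y, p) \<in> FP G" "(z, q) \<in> FP G" using assms by auto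
  then have yz: "y \<in> verts G" "z \<in> verts G" using G.FP_start_in_verts by auto
  show ?thesis
  proof (cases "y = z")
    case False
    then show ?thesis
      using incomparable[OF yz] fp_comparable_append by (auto simp: * path_map_def fp_comparable_def)
  next
    case True
    have "\<not> p \<parallel> q \<Longrightarrow> \<not> labels p \<parallel> labels q"
      by (auto simp: parallel_def elim!: prefixE)
    then have "labels p \<parallel> labels q \<longleftrightarrow> p \<parallel> q"
      using labels_comparable[of z p q] FP True by auto
    then show ?thesis
      using True by (simp add: * path_map_def fp_comparable_def parallel_def)
  qed
qed

lemma gis_map_mult:
  assumes "s \<in> gis G" "t \<in> gis G"
  shows "gis_map (gis_mult s t) = gis_mult (gis_map s) (gis_map t)"
proof (cases "s = None \<or> t = None")
  case True
  then show ?thesis by (cases s; cases t) (auto simp: gis_map_def)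
next
  case False
  then obtain \<alpha> \<beta> \<gamma> \<delta> where s: "s = Some (\<alpha>, \<beta>)" and t: "t = Some (\<gamma>, \<delta>)"
    and FP: "\<beta> \<in> FP G" "\<gamma> \<in> FP G"
    using assms by (auto simp: gis_def)
  have maps: "gis_map s = Some (path_map \<alpha>, path_map \<beta>)" "gis_map t = Some (path_map \<gamma>, path_map \<delta>)"
    by (simp_all add: s t gis_map_def)
  show ?thesis
  proof (cases "fp_comparable \<beta> \<gamma>")
    case False
    then have "gis_mult s t = None"
      by (simp only: s t gis_mult_eq_None not_False_eq_True)
    moreover have "gis_mult (gis_map s) (gis_map t) = None"
      using False by (simp only: maps gis_mult_eq_None path_map_comparable_iff[OF FP] not_False_eq_True)
    ultimately show ?thesis by (simp add: gis_map_def)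
  next
    case True
    then have eq: "fst \<beta> = fst \<gamma>" and cmp: "prefix (snd \<beta>) (snd \<gamma>) \<or> prefix (snd \<gamma>) (snd \<beta>)"
      by (auto simp: fp_comparable_def parallel_def)
    show ?thesis
    proof (cases "prefix (snd \<beta>) (snd \<gamma>)")
      case True
      then obtain r where r: "snd \<gamma> = snd \<beta> @ r" by (rule prefixE)
      show ?thesis using eq r unfolding maps by (simp add: s t gis_map_def path_map_def)
    next
      case False
      then obtain r where r: "snd \<beta> = snd \<gamma> @ r" using cmp by (auto elim: prefixE)
      \<comment> \<open>If all labels on \<open>r\<close> are empty, the images fall under the first
        clause of \<open>gis_mult\<close> although the originals fall under the second; both clauses
        then agree.\<close>
      show ?thesis using eq r False unfolding maps by (auto simp: s t gis_map_def path_map_def)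
    qed
  qed
qed

lemma gis_map_ext_path_hom: "ext_path_hom G E gis_map"
  unfolding ext_path_hom_def
proof (intro conjI ballI gis_map_mult funcsetI)
  show "gis_map s \<in> gis E" if s: "s \<in> gis G" for s
  proof (cases s)
    case (Some \<alpha>\<beta>)
    then obtain \<alpha> \<beta> where "s = Some (\<alpha>, \<beta>)" "\<alpha> \<in> FP G" "\<beta> \<in> FP G"
      "path_target G \<alpha> = path_target G \<beta>"
      using s by (auto simp: gis_def)
    then show ?thesis
      using path_map_FP[of \<alpha>] path_map_FP[of \<beta>] 
      by (cases "path_map \<alpha>"; cases "path_map \<beta>") (simp add: gis_def gis_map_def)
  qed (simp add: gis_def gis_map_def)
qed (simp_all add: gis_map_def)

text \<open>A nonzero element below the image of \<open>z\<close> is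
  \<open>(\<alpha>, \<alpha>)\<close>, where \<alpha> extends the path of \<open>z\<close> by some
  \<open>q\<close>. Its product with the image of an edge at \<open>z\<close> survives if
  \<open>q\<close> is comparable with the label of that edge.\<close>

lemma gis_map_regular:
  assumes "\<And>z q. z \<in> reg G \<Longrightarrow> (start z, vlabel z @ q) \<in> FP E \<Longrightarrow>
    \<exists>e \<in> out_arcs G z. \<not> q \<parallel> elabel e"
  shows "regular_ext_path_hom G E gis_map"
  unfolding regular_ext_path_hom_def
proof (intro conjI ballI impI gis_map_ext_path_hom)
  fix z t assume z: "z \<in> reg G" and t: "t \<in> gis E" "t \<noteq> None \<and> gis_le t (gis_map (Some (vpath z, vpath z)))"
  then obtain \<alpha> \<beta> where \<alpha>: "t = Some (\<alpha>, \<beta>)" "\<alpha> \<in> FP E" by (auto simp: gis_def)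
  with t have "\<beta> = \<alpha> \<and> fst \<alpha> = start z \<and> prefix (vlabel z) (snd \<alpha>)"
    using gis_le_idempotent[of \<alpha> \<beta> "path_map (vpath z)"] by (simp add: gis_map_def path_map_def)
  then obtain q where q: "\<beta> = \<alpha>" "\<alpha> = (start z, vlabel z @ q)"
    by (metis prefixE prod.collapse)
  then obtain e where e: "e \<in> out_arcs G z" "\<not> q \<parallel> elabel e" using assms[OF z] \<alpha> by blast
  then have "fp_comparable \<alpha> (path_map (epath G e))"
    by (auto simp: q path_map_def fp_comparable_def parallel_def)
  then have "gis_mult t (gis_map (Some (epath G e, epath G e))) \<noteq> None"
    using gis_mult_eq_None[of \<alpha> \<beta>] by (simp add: \<alpha>(1) q(1) gis_map_def del: gis_mult.simps)
  with e(1) show "\<exists>e \<in> out_arcs G z. gis_mult t (gis_map (Some (epath G e, epath G e))) \<noteq> None" ..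
qed

section \<open>The pushforward of a path labelling\<close>

abbreviation "Q \<equiv> \<lambda>z. E.P (path_map (vpath z))"
abbreviation "M \<equiv> \<lambda>e. E.P (path_map (epath G e))"

text \<open>All relations but the summation at regular vertices follow from the labelling;
  \<open>complete\<close> supplies that one.\<close>

proposition pushforward_exists:
  assumes complete: "\<And>z. z \<in> reg G \<Longrightarrow>
    E.eqv (Q z * poly_star (Q z)) (\<Sum>e \<in> out_arcs G z. M e * poly_star (M e))"
  obtains h where "is_pushforward G E gis_map h"
proof -
  interpret GC: cstar_graph G by (simp add: cstar_graph_def G.wf_digraph_axioms)
  define y where "y = case_sum (\<lambda>z. Q z * poly_star (Q z)) (\<lambda>e. M e * poly_star (Q (head G e)))"
  have y_V: "y (Inl z) = Q z * poly_star (Q z)" and y_D: "y (Inr e) = M e * poly_star (Q (head G e))" for z e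
    by (simp_all add: y_def)
  have QFP: "path_map (vpath z) \<in> FP E" if "z \<in> verts G" for z using that path_map_FP(1) by simp
  have MFP: "path_map (epath G e) \<in> FP E" if "e \<in> arcs G" for e using that path_map_FP(1) by simp
  have Qp: "Q z \<in> E.polys" "poly_star (Q z) \<in> E.polys" if "z \<in> verts G" for z
    using E.path_poly_poly[OF QFP[OF that]] star_polys_star by auto
  have Mp: "M e \<in> E.polys" "poly_star (M e) \<in> E.polys" if "e \<in> arcs G" for e
    using E.path_poly_poly[OF MFP[OF that]] star_polys_star by auto
  \<comment> \<open>The path of \<open>z\<close> and the paths of all edges into \<open>z\<close>
    end at one vertex. Its projection \<open>T z\<close> is their common initial projection, to
    which the inner products collapse.\<close>
  define T :: "'a \<Rightarrow> ('v + 'e) star_poly" where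
    "T z = V (path_target E (path_map (vpath z)))" for z
  have isometry: "E.eqv (poly_star (E.P \<alpha>) * E.P \<alpha>) (V (path_target E \<alpha>))" if "\<alpha> \<in> FP E" for \<alpha>
    using E.path_poly_isometry that by (cases \<alpha>) simp
  have QQ: "E.eqv (poly_star (Q z) * Q z) (T z)" if "z \<in> verts G" for z
    using isometry[OF QFP[OF that]] by (simp add: T_def)
  have target: "path_target E (path_map (epath G e)) = path_target E (path_map (vpath (head G e)))"
    if "e \<in> arcs G" for e
    using path_map_FP(2)[of "epath G e"] path_map_FP(2)[of "vpath (head G e)"] that by simp
  have MM: "E.eqv (poly_star (M e) * M e) (T (head G e))" if "e \<in> arcs G" for e
    using isometry[OF MFP[OF that]] target[OF that] by (simp add: T_def)
  have QT: "E.eqv (Q z * T z) (Q z)" if "z \<in> verts G" for z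
    using E.path_poly_V[OF QFP[OF that]] by (simp add: T_def)
  have MT: "E.eqv (M e * T (head G e)) (M e)" if "e \<in> arcs G" for e
    using E.path_poly_V[OF MFP[OF that]] target[OF that] by (simp add: T_def)
  have QTQ: "E.eqv (Q z * T z * poly_star (Q z)) (Q z * poly_star (Q z))" if "z \<in> verts G" for z
    using that by (intro E.eqv_mult QT E.eqv_refl Qp)
  note subst_simps = subst_diff subst_mult subst_star subst_sum y_V y_D poly_star_mult
  have "E.N (subst y r) = 0" if "r \<in> graph_rels G" for r
    using that
  proof (cases rule: graph_rels_cases)
    case (self_adjoint z)
    then show ?thesis by (simp add: subst_simps)
  next
    case (idempotent z)
    have "E.eqv (Q z * (poly_star (Q z) * Q z) * poly_star (Q z)) (Q z * poly_star (Q z))"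
      using E.eqv_trans[OF E.eqv_sandwich[OF QQ Qp] QTQ] idempotent by simp
    then show ?thesis
      using idempotent by (simp add: subst_simps E.eqv_diff_0 mult.assoc)
  next
    case (orthogonal z z')
    have "E.eqv (poly_star (Q z) * Q z') 0"
      using orthogonal incomparable[of z z'] QFP
      by (intro E.path_poly_orth) (auto simp: path_map_def)
    then have "E.eqv (Q z * (poly_star (Q z) * Q z') * poly_star (Q z')) 0"
      using orthogonal Qp by (intro E.eqv_sandwich_0) auto
    then show ?thesis
      using orthogonal E.eqv_norm[of _ 0] by (simp add: subst_simps mult.assoc)
  next
    case (isometry e)
    then have h: "head G e \<in> verts G" by simp
    have "E.eqv (Q (head G e) * (poly_star (M e) * M e) * poly_star (Q (head G e)))
        (Q (head G e) * poly_star (Q (head G e)))"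
      using E.eqv_trans[OF E.eqv_sandwich[OF MM Qp] QTQ] isometry h by simp
    then show ?thesis
      using isometry by (simp add: subst_simps E.eqv_diff_0 mult.assoc)
  next
    case (orthogonal_arcs d e)
    then have "\<not> fp_comparable (epath G d) (epath G e)"
      by (auto simp: fp_comparable_def parallel_def)
    then have "E.eqv (poly_star (M d) * M e) 0"
      using orthogonal_arcs MFP path_map_comparable_iff[of "epath G d" "epath G e"]
      by (intro E.path_poly_orth) auto
    then have "E.eqv (Q (head G d) * (poly_star (M d) * M e) * poly_star (Q (head G e))) 0"
      using orthogonal_arcs Qp by (intro E.eqv_sandwich_0) auto
    then show ?thesis
      using orthogonal_arcs E.eqv_norm[of _ 0] by (simp add: subst_simps mult.assoc)
  next
    case (source e)
    let ?t = "tail G e"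
    \<comment> \<open>\<open>L\<close> is the part that \<open>e\<close> adds to the path of its
      source; the image of the source acts as a left unit on \<open>M e\<close> because
      \<open>Q\<close> is a partial isometry.\<close>
    define L where "L = E.P (path_target E (path_map (vpath ?t)), elabel e)"
    have t: "?t \<in> verts G" and h: "head G e \<in> verts G" using source by auto
    have LFP: "(path_target E (path_map (vpath ?t)), elabel e) \<in> FP E"
      using elabel[OF source(1)] by (simp add: path_map_def)
    then have Lp: "L \<in> E.polys" unfolding L_def by (rule E.path_poly_poly)
    have TL: "E.eqv (T ?t * L) L"
      unfolding T_def L_def using LFP by (rule E.V_path_poly)
    have M: "E.eqv (M e) (Q ?t * L)"
      using E.path_poly_append[of "start ?t" "vlabel ?t" "elabel e"] MFP[OF source(1)]
      by (simp add: L_def path_map_def)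
    have "E.eqv (Q ?t * poly_star (Q ?t) * M e) (Q ?t * poly_star (Q ?t) * (Q ?t * L))"
      using Qp[OF t] by (intro E.eqv_mult M E.eqv_refl star_polys_mult)
    also have "\<dots> = Q ?t * (poly_star (Q ?t) * Q ?t) * L" by (simp add: mult.assoc)
    also have "E.eqv \<dots> (Q ?t * T ?t * L)"
      using Qp[OF t] Lp by (intro E.eqv_sandwich QQ t)
    also have "E.eqv \<dots> (Q ?t * L)"
      using Lp by (intro E.eqv_mult QT t E.eqv_refl)
    also have "E.eqv \<dots> (M e)" using M by (rule E.eqv_sym)
    finally have "E.eqv (Q ?t * poly_star (Q ?t) * M e * poly_star (Q (head G e)))
        (M e * poly_star (Q (head G e)))"
      using Qp[OF h] by (intro E.eqv_mult E.eqv_refl)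
    then show ?thesis
      using source by (simp add: subst_simps E.eqv_diff_0 mult.assoc)
  next
    case (regular z)
    have "E.eqv (\<Sum>e \<in> out_arcs G z. M e * (poly_star (Q (head G e)) * Q (head G e)) * poly_star (M e))
        (\<Sum>e \<in> out_arcs G z. M e * poly_star (M e))"
    proof (rule E.eqv_sum)
      fix e assume "e \<in> out_arcs G z"
      then have e: "e \<in> arcs G" and h: "head G e \<in> verts G" by auto
      have "E.eqv (M e * T (head G e) * poly_star (M e)) (M e * poly_star (M e))"
        using Mp[OF e] by (intro E.eqv_mult MT e E.eqv_refl)
      then show "E.eqv (M e * (poly_star (Q (head G e)) * Q (head G e)) * poly_star (M e))
          (M e * poly_star (M e))"
        by (rule E.eqv_trans[OF E.eqv_sandwich[OF QQ[OF h] Mp[OF e]]])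
    qed
    from E.eqv_trans[OF complete[OF regular(1)] E.eqv_sym[OF this]] show ?thesis
      using regular by (simp add: subst_simps E.eqv_diff_0 mult.assoc)
  qed
  moreover have "y x \<in> E.polys" if "x \<in> graph_gens G" for x
    using that Qp Mp by (auto simp: graph_gens_def[of G] y_V y_D intro!: star_polys_mult)
  ultimately obtain h where h: "star_hom GC.A E.A h"
      "\<And>a. a \<in> GC.polys \<Longrightarrow> h (GC.cst a) = E.cst (subst y a)"
    using star_hom_subst[OF GC.cstar_presentation_axioms E.cstar_presentation_axioms] by blast
  have "h (S_vert G z) = S_gis E (gis_map (Some (vpath z, vpath z)))" if "z \<in> verts G" for z
    using that QFP by (simp add: GC.S_vert_eq h y_V gis_map_def E.S_gis_eq del: S_gis.simps)
  moreover have "h (S_arc G e) = S_gis E (gis_map (Some (epath G e, vpath (head G e))))"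
    if "e \<in> arcs G" for e
    using that QFP MFP by (simp add: GC.S_arc_eq h y_D gis_map_def E.S_gis_eq del: S_gis.simps)
  ultimately have "is_pushforward G E gis_map h"
    using h(1) by (simp add: is_pushforward_def graph_cstar_def)
  then show ?thesis by (rule that)
qed

end

section \<open>Inverting the shift isomorphism\<close>

context cstar_presentation
begin

lemma cstar_closed:
  assumes "x \<in> carrier A" "y \<in> carrier A"
  shows "x \<oplus>\<^bsub>A\<^esub> y \<in> carrier A" "x \<otimes>\<^bsub>A\<^esub> y \<in> carrier A" "c \<odot>\<^bsub>A\<^esub> x \<in> carrier A" "adj A x \<in> carrier A"
  using assms by (auto elim!: carrierE simp: add_cls mult_cls smult_cls adj_cls cls_carrier
      seqs_add seqs_mult seqs_scale seqs_star)

lemma star_iso_inv: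
  assumes "star_iso A B f"
  shows "star_hom B A (inv_into (carrier A) f)" (is "star_hom B A ?k")
proof -
  have f: "star_hom A B f" and bij: "bij_betw f (carrier A) (carrier B)"
    using assms by (auto simp: star_iso_def)
  have k: "?k b \<in> carrier A" "f (?k b) = b" if "b \<in> carrier B" for b
    using bij that by (auto simp: bij_betw_def inv_into_into f_inv_into_f)
  have k_eq: "?k b = a" if "a \<in> carrier A" "f a = b" for a b
    using that bij by (auto simp: bij_betw_def)
  show ?thesis
    unfolding star_hom_def
    by (intro conjI funcsetI ballI allI k_eq k cstar_closed) (auto simp: k star_homD[OF f])
qed

end

section \<open>The split graph and its map to the shifted graph\<close>

abbreviation tag_list :: "'e option \<Rightarrow> 'e list" where
  "tag_list t \<equiv> case_option [] (\<lambda>y. [y]) t"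

text \<open>An index set for the copies of \<open>u\<close>. It also indexes the lifts of an edge
  ending at \<open>u\<close>, since targets must be bijective on fibres.\<close>

definition arc_tags :: "('v, 'e) pre_digraph \<Rightarrow> 'v \<Rightarrow> 'v \<Rightarrow> 'e option set" where
  "arc_tags E v u = (if u = v then Some ` out_arcs E v else {None})"

text \<open>
  The copy \<open>v\<^sub>y\<close> of \<open>v\<close> is \<open>(v, Some y)\<close>, and every other vertex \<open>u\<close> is \<open>(u, None)\<close>. The tag of an
  edge is the tag of the vertex at which it ends. An edge of the shifted graph that starts at \<open>v\<close>
  is of the form \<open>Some y\<close>, so it is itself the tag of \<open>v\<^sub>y\<close>.
\<close>

definition split_graph ::
    "('v, 'e) pre_digraph \<Rightarrow> 'v \<Rightarrow> 'v \<Rightarrow> ('e \<Rightarrow> 'e) \<Rightarrow>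
      ('v \<times> 'e option, 'e option \<times> 'e option) pre_digraph" where
  "split_graph E v w \<theta> = (let E' = shift_graph E v w \<theta> in
    \<lparr> verts = {(u, t). u \<in> verts E' \<and> t \<in> arc_tags E v u},
      arcs = {(e, t). e \<in> arcs E' \<and> t \<in> arc_tags E v (head E' e)},
      tail = (\<lambda>(e, t). (tail E' e, if tail E' e = v then e else None)),
      head = (\<lambda>(e, t). (head E' e, t)) \<rparr>)"

locale graph_shift = E: cstar_graph E
  for E :: "('v, 'e) pre_digraph" and v w :: 'v and \<theta> :: "'e \<Rightarrow> 'e" +
  assumes w: "w \<in> verts E" and vw: "v \<noteq> w" and v_reg: "v \<in> reg E"
    and no_loop: "\<And>e. e \<in> arcs E \<Longrightarrow> tail E e = v \<Longrightarrow> head E e \<noteq> v"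
    and \<theta>: "\<And>y. y \<in> arcs E \<Longrightarrow> tail E y = v \<Longrightarrow> \<theta> y \<in> arcs E \<and> tail E (\<theta> y) = w"
    and inj: "inj_on \<theta> (out_arcs E v)"
    and head_\<theta>: "\<And>y. y \<in> arcs E \<Longrightarrow> tail E y = v \<Longrightarrow> head E (\<theta> y) = head E y"
begin

abbreviation "E' \<equiv> shift_graph E v w \<theta>"
abbreviation "G \<equiv> split_graph E v w \<theta>"
abbreviation "out \<equiv> out_arcs E v"

lemma v: "v \<in> verts E" and finite_out: "finite out" and out_nonempty: "out \<noteq> {}"
  using v_reg by (auto simp: reg_def)

lemma shift_simps [simp]:
  "verts E' = verts E" "tail E' (Some e) = tail E e" "head E' (Some e) = head E e"
  "tail E' None = w" "head E' None = v"
  "None \<in> arcs E'" "Some e \<in> arcs E' \<longleftrightarrow> e \<in> arcs E \<and> e \<notin> \<theta> ` out"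
  by (auto simp: shift_graph_def)

lemma split_simps [simp]:
  "(u, t) \<in> verts G \<longleftrightarrow> u \<in> verts E \<and> t \<in> arc_tags E v u"
  "(e, t) \<in> arcs G \<longleftrightarrow> e \<in> arcs E' \<and> t \<in> arc_tags E v (head E' e)"
  "head G (e, t) = (head E' e, t)"
  by (simp_all add: split_graph_def Let_def)

lemma tail_split [simp]: "tail G (e, t) = (tail E' e, if tail E' e = v then e else None)"
  by (simp add: split_graph_def Let_def)

lemma arc_tags_simps [simp]:
  "arc_tags E v v = Some ` out" "u \<noteq> v \<Longrightarrow> arc_tags E v u = {None}"
  by (simp_all add: arc_tags_def)

lemma finite_arc_tags: "finite (arc_tags E v u)" and arc_tags_nonempty: "arc_tags E v u \<noteq> {}"
  using finite_out out_nonempty by (simp_all add: arc_tags_def)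

text \<open>The removed edges start at \<open>w\<close>, so all edges emitted by \<open>v\<close>
  survive the shift.\<close>

lemma out_not_shifted: "y \<in> out \<Longrightarrow> y \<notin> \<theta> ` out"
  using \<theta> vw by force

lemma wf_shift: "wf_digraph E'"
proof
  fix e assume "e \<in> arcs E'"
  then show "tail E' e \<in> verts E'" "head E' e \<in> verts E'"
    using v w by (cases e; auto)+
qed

text \<open>No edge is affected by the splitting at both ends: one ending at \<open>v\<close> starts
  elsewhere, because \<open>v\<close> emits no loop and the new edge starts at
  \<open>w\<close>.\<close>

lemma arc_cases [case_names old old_v new]:
  assumes "(e, t) \<in> arcs G"
  obtains d where "e = Some d" "t = None" "d \<in> arcs E" "d \<notin> \<theta> ` out" "head E d \<noteq> v"
  | d y where "e = Some d" "t = Some y" "d \<in> arcs E" "d \<notin> \<theta> ` out" "head E d = v" "tail E d \<noteq> v" "y \<in> out"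
  | y where "e = None" "t = Some y" "y \<in> out"
proof (cases e)
  case None
  then show ?thesis using assms that(3) by auto
next
  case (Some d)
  then have d: "d \<in> arcs E" "d \<notin> \<theta> ` out" using assms by auto
  show ?thesis
  proof (cases "head E d = v")
    case True
    then obtain y where "t = Some y" "y \<in> out"
      using assms Some by (auto simp del: in_out_arcs_conv)
    then show ?thesis using that(2) Some d True no_loop by blast
  next
    case False
    then show ?thesis using that(1) Some d assms by simp
  qed
qed

lemma wf_split: "wf_digraph G"
proof
  fix x assume x: "x \<in> arcs G"
  obtain e t where xe: "x = (e, t)" by force
  show "tail G x \<in> verts G" "head G x \<in> verts G"
    using x v w vw unfolding xe
    by (cases rule: arc_cases; auto simp: arc_tags_def)+
qed

lemma vfibre_fst: "vfibre G fst u = (if u \<in> verts E then {u} \<times> arc_tags E v u else {})"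
  by auto

lemma afibre_fst: "e \<in> arcs E' \<Longrightarrow> afibre G fst e = {e} \<times> arc_tags E v (head E' e)"
  by auto

lemma finite_vfibre: "finite (vfibre G fst u)"
  using finite_arc_tags by (simp add: vfibre_fst)

lemma finite_afibre: "e \<in> arcs E' \<Longrightarrow> finite (afibre G fst e)"
  using finite_arc_tags by (simp add: afibre_fst)

text \<open>The edge \<open>y\<close> ends away from \<open>v\<close> and so has a single
  lift.\<close>

lemma out_arcs_split:
  "u \<noteq> v \<Longrightarrow> out_arcs G (u, None) = Sigma (out_arcs E' u) (\<lambda>e. arc_tags E v (head E' e))"
  "y \<in> out \<Longrightarrow> out_arcs G (v, Some y) = {(Some y, None)}"
proof -
  show "u \<noteq> v \<Longrightarrow> out_arcs G (u, None) = Sigma (out_arcs E' u) (\<lambda>e. arc_tags E v (head E' e))"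
    by auto
  assume y: "y \<in> out"
  then have y': "y \<in> arcs E" "tail E y = v" "head E y \<noteq> v" using no_loop by auto
  show "out_arcs G (v, Some y) = {(Some y, None)}"
  proof (intro Set.set_eqI iffI)
    fix x :: "'e option \<times> 'e option" assume "x \<in> {(Some y, None)}"
    then show "x \<in> out_arcs G (v, Some y)" using y' out_not_shifted[OF y] by simp
  next
    fix x assume x: "x \<in> out_arcs G (v, Some y)"
    obtain e t where xe: "x = (e, t)" by force
    then have "e = Some y" using x by (simp split: if_splits)
    then show "x \<in> {(Some y, None)}" using x y' by (simp add: xe)
  qed
qed

lemma admissible_split: "admissible G E' fst fst"
  unfolding admissible_def graph_hom_def
proof (intro conjI ballI impI)
  fix e assume e: "e \<in> arcs E'"
  show "finite (afibre G fst e)" using e finite_arc_tags by (simp add: afibre_fst)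
  have "head E' e \<in> verts E" using wf_shift e by (auto dest: wf_digraph.head_in_verts)
  then show "bij_betw (head G) (afibre G fst e) (vfibre G fst (head E' e))"
    by (auto simp: afibre_fst[OF e] vfibre_fst bij_betw_def inj_on_def image_iff)
next
  fix z assume z: "z \<in> verts G" "fst z \<in> reg E'"
  obtain u t where ut: "z = (u, t)" by force
  show "z \<in> reg G"
  proof (cases "u = v")
    case True
    then obtain y where "y \<in> out" "t = Some y" using z ut by auto
    then show ?thesis using z ut True out_arcs_split(2) by (simp add: reg_def)
  next
    case False
    then show ?thesis
      using z ut finite_arc_tags arc_tags_nonempty
      by (auto simp: reg_def out_arcs_split(1) Sigma_empty_iff simp del: in_out_arcs_conv)
  qed
qed (use finite_arc_tags wf_digraph.tail_in_verts[OF wf_split] in \<open>auto simp: vfibre_fst\<close>)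

definition vlabel :: "'v \<times> 'e option \<Rightarrow> 'e list" where
  "vlabel = (\<lambda>(u, t). tag_list t)"

text \<open>The path of the copy indexed by \<open>y\<close> is already \<open>y\<close>, so the
  lift of \<open>y\<close> adds nothing. A lift of the new edge adds \<open>\<theta> y\<close>, and
  a lift of an old edge into \<open>v\<close> appends its tag to end where the path of its target
  ends.\<close>

definition elabel :: "'e option \<times> 'e option \<Rightarrow> 'e list" where
  "elabel = (\<lambda>(e, t). if tail E' e = v then [] else
    case e of None \<Rightarrow> map \<theta> (tag_list t) | Some d \<Rightarrow> d # tag_list t)"

lemma vlabel_simps [simp]: "vlabel (u, None) = []" "vlabel (u, Some y) = [y]"
  by (simp_all add: vlabel_def)

lemma elabel_simps [simp]:
  "tail E d = v \<Longrightarrow> elabel (Some d, t) = []"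
  "tail E d \<noteq> v \<Longrightarrow> elabel (Some d, None) = [d]"
  "tail E d \<noteq> v \<Longrightarrow> elabel (Some d, Some y) = [d, y]"
  "elabel (None, Some y) = [\<theta> y]"
  using vw by (simp_all add: elabel_def)

text \<open>For the new edges the ends match because \<open>y\<close> and \<open>\<theta> y\<close>
  have the same target. At \<open>w\<close>, removal of the image of \<open>\<theta>\<close>
  separates old labels from new ones, and injectivity separates the new ones from each
  other.\<close>

sublocale path_labelling G E fst vlabel elabel
proof (intro path_labelling.intro wf_split E.cstar_graph_axioms path_labelling_axioms.intro)
  show "(fst z, vlabel z) \<in> FP E" if "z \<in> verts G" for z
    using that by (cases z; cases "fst z = v") auto
  fix x assume x: "x \<in> arcs G"
  obtain e t where xe: "x = (e, t)" by force
  from x show "(path_target E (fst (tail G x), vlabel (tail G x)), elabel x) \<in> FP E"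
    unfolding xe by (cases rule: arc_cases) (use \<theta> v vw in auto)
  from x show "path_target E (fst (tail G x), vlabel (tail G x) @ elabel x)
      = path_target E (fst (head G x), vlabel (head G x))"
    unfolding xe by (cases rule: arc_cases) (use head_\<theta> vw in auto)
next
  show "\<not> fp_comparable (fst y, vlabel y) (fst z, vlabel z)"
    if "y \<in> verts G" "z \<in> verts G" "y \<noteq> z" for y z
    using that by (cases y; cases z; cases "fst y = v") (auto simp: fp_comparable_def parallel_def)
next
  fix x x' assume x: "x \<in> arcs G" "x' \<in> arcs G" "tail G x = tail G x'" "x \<noteq> x'"
  obtain e t e' t' where xe: "x = (e, t)" "x' = (e', t')" by force
  have \<theta>_eq: "y = y'" if "\<theta> y = \<theta> y'" "y \<in> out" "y' \<in> out" for y y'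
    using inj that by (auto dest: inj_onD)
  from x(1)[unfolded xe(1)] show "elabel x \<parallel> elabel x'"
  proof (cases rule: arc_cases)
    case (old d)
    from x(2)[unfolded xe(2)] show ?thesis
      by (cases rule: arc_cases) (use x old vw in \<open>auto simp: xe parallel_def split: if_splits\<close>)
  next
    case (old_v d y)
    from x(2)[unfolded xe(2)] show ?thesis
      by (cases rule: arc_cases) (use x old_v vw in \<open>auto simp: xe parallel_def split: if_splits\<close>)
  next
    case (new y)
    have x_new: "elabel x = [\<theta> y]" and tail: "tail G x' = (w, None)"
      using x(3) vw new by (simp_all add: xe)
    from x(2)[unfolded xe(2)] show ?thesis
    proof (cases rule: arc_cases)
      case (old d)
      then have "elabel x' = [d]" "d \<noteq> \<theta> y" using tail vw new(3) by (auto simp: xe simp del: in_out_arcs_conv)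
      then show ?thesis by (simp add: x_new parallel_def)
    next
      case (old_v d y')
      then have "elabel x' = [d, y']" "d \<noteq> \<theta> y" using new(3) by (auto simp: xe simp del: in_out_arcs_conv)
      then show ?thesis by (simp add: x_new parallel_def)
    next
      case (new y')
      then have "elabel x' = [\<theta> y']" "y \<noteq> y'" using x(4) \<open>e = None\<close> \<open>t = Some y\<close> by (auto simp: xe)
      then show ?thesis using \<theta>_eq \<open>y \<in> out\<close> new(3) by (auto simp: x_new parallel_def)
    qed
  qed
qed

lemma Q_simps: "u \<noteq> v \<Longrightarrow> Q (u, None) = V u" "Q (v, Some y) = D y"
  by (simp_all add: path_map_def)

lemma M_simps:
  "M (Some d, None) = D d"
  "tail E d \<noteq> v \<Longrightarrow> M (Some d, Some y) = D d * D y"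
  "M (None, Some y) = D (\<theta> y)"
  using vw by (simp_all add: path_map_def)

text \<open>The first edge \<open>d\<close> of \<open>q\<close> chooses the edge: a lift of the new
  edge if \<open>d\<close> is \<open>\<theta> y\<close>, the only lift of \<open>d\<close> if it
  ends away from \<open>v\<close>, and otherwise the lift of \<open>d\<close> tagged by the next
  edge of \<open>q\<close>. At a copy of \<open>v\<close> the only label is empty and comparable
  with everything.\<close>

lemma gis_map_regular_split: "regular_ext_path_hom G E gis_map"
proof (rule gis_map_regular)
  fix z q assume z: "z \<in> reg G" and FP: "(fst z, vlabel z @ q) \<in> FP E"
  have zG: "z \<in> verts G" "out_arcs G z \<noteq> {}" using z by (auto simp: reg_def)
  obtain u t where ut: "z = (u, t)" by force
  show "\<exists>e \<in> out_arcs G z. \<not> q \<parallel> elabel e"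
  proof (cases "u = v")
    case True
    then obtain y where "y \<in> out" "t = Some y" using zG(1) ut by (auto simp del: in_out_arcs_conv)
    then show ?thesis using True ut out_arcs_split(2)[of y] by (simp add: parallel_def)
  next
    case False
    then have t: "t = None" using zG ut by auto
    show ?thesis
    proof (cases q)
      case Nil
      obtain e where "e \<in> out_arcs G z" using zG(2) by blast
      then show ?thesis by (rule bexI[rotated]) (simp add: Nil parallel_def)
    next
      case (Cons d q')
      then have d: "d \<in> arcs E" "tail E d = u" and FP': "(head E d, q') \<in> FP E"
        using FP ut t by auto
      have goal: "?thesis" if "(e, t') \<in> arcs G" "tail E' e = u" "\<not> q \<parallel> elabel (e, t')" for e t'
        using that ut t False by (intro bexI[of _ "(e, t')"]) auto
      consider y where "y \<in> out" "d = \<theta> y" | "d \<notin> \<theta> ` out" "head E d \<noteq> v"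
        | "d \<notin> \<theta> ` out" "head E d = v" by blast
      then show ?thesis
      proof cases
        case 1
        then have "u = w" using \<theta> d by auto
        with 1 show ?thesis by (intro goal[of None "Some y"]) (auto simp: Cons parallel_def)
      next
        case 2
        then show ?thesis using d False by (intro goal[of "Some d" None]) (auto simp: Cons parallel_def)
      next
        case 3
        \<comment> \<open>If \<open>q\<close> stops at \<open>v\<close>, any edge emitted by
          \<open>v\<close> serves as the tag.\<close>
        obtain y where "y \<in> out" "\<not> q' \<parallel> [y]"
        proof (cases q')
          case Nil
          obtain y where "y \<in> out" using out_nonempty by blast
          then show ?thesis by (rule that) (simp add: Nil parallel_def)
        next
          case (Cons y q'')
          then show ?thesis using that[of y] FP' 3 by (auto simp: parallel_def)
        qed
        then show ?thesis
          using 3 d False by (intro goal[of "Some d" "Some y"]) (auto simp: Cons parallel_def)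
      qed
    qed
  qed
qed

section \<open>Summation relations and comparison on the generators\<close>

abbreviation "DD e \<equiv> D e * poly_star (D e)"

text \<open>\<open>D d\<close> absorbs \<open>V v\<close> on the right, and \<open>V v\<close>
  expands over the edges emitted by the regular vertex \<open>v\<close>.\<close>

lemma D_split:
  assumes "d \<in> arcs E" "head E d = v"
  shows "E.eqv (\<Sum>y \<in> out. D d * D y * poly_star (D y)) (D d)"
proof -
  have "E.eqv (D d * (\<Sum>y \<in> out. DD y)) (D d * V v)"
    using assms v_reg by (intro E.eqv_mult E.eqv_sym[OF E.V_regular]) auto
  also have "E.eqv (D d * V v) (D d)" using E.D_V[of d] assms by simp
  finally show ?thesis by (simp add: sum_distrib_left mult.assoc)
qed

lemma inner_sum:
  assumes "Some d \<in> arcs E'" "tail E d \<noteq> v"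
  shows "E.eqv (DD d) (\<Sum>t \<in> arc_tags E v (head E d). M (Some d, t) * poly_star (M (Some d, t)))"
proof (cases "head E d = v")
  case False
  then show ?thesis
    using assms by (auto simp: M_simps simp del: tail_split
        intro!: E.eqv_refl star_polys_mult star_polys_star)
next
  case True
  have d: "d \<in> arcs E" using assms by simp
  have "E.eqv ((\<Sum>y \<in> out. D d * D y * poly_star (D y)) * poly_star (D d)) (DD d)"
    using D_split[OF d True] d by (intro E.eqv_mult) (auto intro: star_polys_star)
  then show ?thesis
    using assms True
    by (simp add: M_simps sum.reindex poly_star_mult mult.assoc sum_distrib_right E.eqv_sym
        del: tail_split)
qed

text \<open>At a copy of \<open>v\<close> both sides are \<open>DD y\<close> for its tag
  \<open>y\<close>. Elsewhere the summation relation of \<open>E\<close> is regrouped along lifts: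
  surviving edges by \<open>inner_sum\<close>, edges \<open>\<theta> y\<close> by the lifts of the
  new edge.\<close>

lemma complete_split:
  assumes z: "z \<in> reg G"
  shows "E.eqv (Q z * poly_star (Q z)) (\<Sum>e \<in> out_arcs G z. M e * poly_star (M e))"
proof -
  obtain u t where ut: "z = (u, t)" by force
  have zG: "z \<in> verts G" "out_arcs G z \<noteq> {}" "finite (out_arcs G z)" using z by (auto simp: reg_def)
  show ?thesis
  proof (cases "u = v")
    case True
    then obtain y where y: "y \<in> out" "t = Some y" using zG(1) ut by (auto simp del: in_out_arcs_conv)
    then have "D y * poly_star (D y) \<in> E.polys" by (auto intro!: star_polys_mult star_polys_star)
    then show ?thesis
      using y(1) by (simp add: y(2) True ut Q_simps M_simps out_arcs_split(2)
          del: tail_split in_out_arcs_conv)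
  next
    case False
    then have t: "t = None" and u: "u \<in> verts E" using zG ut by auto
    let ?new = "if u = w then {None} else {}" and ?shifted = "if u = w then \<theta> ` out else {}"
    let ?old = "out_arcs E u - \<theta> ` out"
    let ?I = "\<lambda>e. \<Sum>t \<in> arc_tags E v (head E' e). M (e, t) * poly_star (M (e, t))"
    have out_E': "out_arcs E' u = Some ` ?old \<union> ?new"
    proof (rule Set.set_eqI)
      show "e \<in> out_arcs E' u \<longleftrightarrow> e \<in> Some ` ?old \<union> ?new" for e by (cases e) auto
    qed
    have out_E: "out_arcs E u = ?old \<union> ?shifted"
      using \<theta> by auto
    \<comment> \<open>Regularity is given for \<open>z\<close> in \<open>G\<close> only. Projecting
      its edges and exchanging the new edge for the image of \<open>\<theta>\<close> recovers it for
      \<open>u\<close> in \<open>E\<close>.\<close>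
    have "finite (fst ` out_arcs G (u, None))" using zG ut t by simp
    moreover have "fst ` out_arcs G (u, None) = out_arcs E' u"
      using arc_tags_nonempty by (force simp: out_arcs_split(1)[OF False] simp del: in_out_arcs_conv)
    ultimately have "finite (out_arcs E' u)" by simp
    then have fin: "finite ?old" unfolding out_E' by (auto dest: finite_imageD)
    have "out_arcs E' u \<noteq> {}" using zG ut t False by (auto simp: out_arcs_split(1) simp del: in_out_arcs_conv)
    then have "out_arcs E u \<noteq> {}"
      using out_nonempty unfolding out_E' by (subst out_E) (auto split: if_splits)
    moreover have "finite (out_arcs E u)"
      by (subst out_E) (use fin finite_out in auto)
    ultimately have u_reg: "u \<in> reg E" using u by (simp add: reg_def)
    have "E.eqv (V u * poly_star (V u)) (V u * V u)"
      using u by (intro E.eqv_mult E.V_star) auto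
    also have "E.eqv (V u * V u) (V u)" using u by (rule E.V_idem)
    also have "E.eqv (V u) (\<Sum>d \<in> out_arcs E u. DD d)" using u_reg by (rule E.V_regular)
    also have "(\<Sum>d \<in> out_arcs E u. DD d) = (\<Sum>d \<in> ?old. DD d) + (\<Sum>d \<in> ?shifted. DD d)"
      by (subst out_E, rule sum.union_disjoint) (use fin finite_out in auto)
    \<comment> \<open>Each lift of the new edge contributes exactly the term of its
      \<open>\<theta> y\<close>.\<close>
    also have "(\<Sum>d \<in> ?shifted. DD d) = (\<Sum>e \<in> ?new. ?I e)"
      using inj by (simp add: sum.reindex M_simps del: tail_split)
    also have "E.eqv ((\<Sum>d \<in> ?old. DD d) + (\<Sum>e \<in> ?new. ?I e)) ((\<Sum>d \<in> ?old. ?I (Some d)) + (\<Sum>e \<in> ?new. ?I e))"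
    proof (rule E.eqv_add; rule E.eqv_sum)
      show "E.eqv (DD d) (?I (Some d))" if "d \<in> ?old" for d
        using inner_sum[of d] that False by simp
      show "E.eqv (?I e) (?I e)" if "e \<in> ?new" for e
        using that \<theta> by (auto simp: sum.reindex M_simps simp del: tail_split split: if_splits
            intro!: E.eqv_refl star_polys_sum star_polys_mult star_polys_star)
    qed
    also have "(\<Sum>d \<in> ?old. ?I (Some d)) + (\<Sum>e \<in> ?new. ?I e) = (\<Sum>e \<in> out_arcs E' u. ?I e)"
      unfolding out_E' by (subst sum.union_disjoint) (use fin in \<open>auto simp: sum.reindex\<close>)
    also have "\<dots> = (\<Sum>e \<in> out_arcs G z. M e * poly_star (M e))"
      using \<open>finite (out_arcs E' u)\<close> finite_arc_tags
      by (simp add: ut t out_arcs_split(1)[OF False] sum.Sigma case_prod_beta del: in_out_arcs_conv tail_split)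
    finally show ?thesis using False by (simp add: ut t Q_simps del: tail_split)
  qed
qed

text \<open>As \<open>f\<close> is injective, it suffices to evaluate it on the claimed preimages.
  For the new edge this gives its generator times the sum of the range projections of the edges at
  \<open>v\<close>, which is the projection of \<open>v\<close> because \<open>v\<close> stays
  regular after the shift.\<close>

lemma inverse_shift:
  assumes f: "star_iso (graph_cstar E) (graph_cstar E') f"
    and f_V: "\<And>u. u \<in> verts E \<Longrightarrow> f (S_vert E u) = S_vert E' u"
    and f_D: "\<And>e. e \<in> arcs E - \<theta> ` out \<Longrightarrow> f (S_arc E e) = S_arc E' (Some e)"
    and f_\<theta>: "\<And>y. y \<in> out \<Longrightarrow>
      f (S_arc E (\<theta> y)) = S_arc E' None \<otimes>\<^bsub>graph_cstar E'\<^esub> S_arc E' (Some y)"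
  defines "k \<equiv> inv_into (carrier (graph_cstar E)) f"
  shows "u \<in> verts E' \<Longrightarrow> k (S_vert E' u) = S_vert E u"
    and "Some e \<in> arcs E' \<Longrightarrow> k (S_arc E' (Some e)) = S_arc E e"
    and "k (S_arc E' None) = E.cst (\<Sum>y \<in> out. D (\<theta> y) * poly_star (D y))"
proof -
  interpret E': cstar_graph E' using wf_shift by (simp add: cstar_graph_def)
  have hom: "star_hom E.A E'.A f" and bij: "inj_on f (carrier E.A)"
    using f by (auto simp: star_iso_def graph_cstar_def bij_betw_def)
  have k: "k b = a" if "a \<in> carrier E.A" "f a = b" for a b
    using that bij by (auto simp: k_def graph_cstar_def)
  show "u \<in> verts E' \<Longrightarrow> k (S_vert E' u) = S_vert E u"
    using f_V by (intro k) (auto simp: E.S_vert_eq)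
  show "Some e \<in> arcs E' \<Longrightarrow> k (S_arc E' (Some e)) = S_arc E e"
    using f_D by (intro k) (auto simp: E.S_arc_eq)
  show "k (S_arc E' None) = E.cst (\<Sum>y \<in> out. D (\<theta> y) * poly_star (D y))"
  proof (rule k)
    have polys: "D (\<theta> y) * poly_star (D y) \<in> E.polys" if "y \<in> out" for y
      using that \<theta> by (auto intro!: star_polys_mult star_polys_star)
    then show "E.cst (\<Sum>y \<in> out. D (\<theta> y) * poly_star (D y)) \<in> carrier E.A"
      by (intro E.cst_carrier star_polys_sum)
    let ?b = "\<lambda>y. D None * D (Some y) * poly_star (D (Some y))"
    have "f (E.cst (D (\<theta> y) * poly_star (D y))) = E'.cst (?b y)" if y: "y \<in> out" for y
    proof -
      have "E.cst (D (\<theta> y) * poly_star (D y)) = S_arc E (\<theta> y) \<otimes>\<^bsub>E.A\<^esub> adj E.A (S_arc E y)"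
        using y \<theta> by (simp add: E.S_arc_eq E.adj_cst E.mult_cst star_polys_star)
      moreover have "S_arc E (\<theta> y) \<in> carrier E.A" "S_arc E y \<in> carrier E.A"
        using y \<theta> by (auto simp: E.S_arc_eq)
      ultimately have "f (E.cst (D (\<theta> y) * poly_star (D y)))
          = f (S_arc E (\<theta> y)) \<otimes>\<^bsub>E'.A\<^esub> adj E'.A (f (S_arc E y))"
        by (simp add: star_homD[OF hom] E.cstar_closed)
      then show ?thesis
        using y out_not_shifted[OF y] f_D[of y] f_\<theta>[OF y]
        by (simp add: graph_cstar_def E'.S_arc_eq E'.adj_cst E'.mult_cst star_polys_star star_polys_mult)
    qed
    moreover have polys': "?b y \<in> E'.polys" if "y \<in> out" for y
      using that out_not_shifted by (intro star_polys_mult star_polys_star E'.D_poly) simp_all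
    ultimately have "f (E.cst (\<Sum>y \<in> out. D (\<theta> y) * poly_star (D y))) = E'.cst (\<Sum>y \<in> out. ?b y)"
      by (intro star_hom_sum[OF E.cstar_presentation_axioms E'.cstar_presentation_axioms hom]
          finite_out polys polys')
    also have "E'.cst (\<Sum>y \<in> out. ?b y) = E'.cst (D None)"
    proof (rule E'.cst_eq)
      have out: "out_arcs E' v = Some ` out"
      proof (rule Set.set_eqI)
        show "e \<in> out_arcs E' v \<longleftrightarrow> e \<in> Some ` out" for e
          using vw out_not_shifted[of "the e"] by (cases e) auto
      qed
      then have reg: "v \<in> reg E'" using v finite_out out_nonempty by (simp add: reg_def)
      have "E'.eqv (D None * (\<Sum>y \<in> out_arcs E' v. DD y)) (D None * V v)"
        by (intro E'.eqv_mult E'.eqv_sym[OF E'.V_regular] reg) auto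
      also have "E'.eqv (D None * V v) (D None)" using E'.D_V[of None] by simp
      finally show "E'.eqv (\<Sum>y \<in> out. ?b y) (D None)"
        by (simp add: out sum.reindex sum_distrib_left mult.assoc del: in_out_arcs_conv)
    qed
    finally show "f (E.cst (\<Sum>y \<in> out. D (\<theta> y) * poly_star (D y))) = S_arc E' None"
      by (simp add: E'.S_arc_eq)
  qed
qed

text \<open>Over \<open>v\<close> the fibre sum is the summation relation at \<open>v\<close>; over
  an old edge ending at \<open>v\<close> it is \<open>D_split\<close>; over the new edge it is
  literally the expression found in \<open>inverse_shift\<close>.\<close>

lemma pushforward_pullback_gens:
  assumes g: "is_pullback G E' fst fst g" and h: "is_pushforward G E gis_map h"
  shows "u \<in> verts E' \<Longrightarrow> h (g (S_vert E' u)) = S_vert E u"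
    and "Some d \<in> arcs E' \<Longrightarrow> h (g (S_arc E' (Some d))) = S_arc E d"
    and "h (g (S_arc E' None)) = E.cst (\<Sum>y \<in> out. D (\<theta> y) * poly_star (D y))"
proof -
  interpret GC: cstar_graph G using wf_split by (simp add: cstar_graph_def)
  have QFP: "path_map (vpath z) \<in> FP E" if "z \<in> verts G" for z using that path_map_FP(1) by simp
  have MFP: "path_map (epath G e) \<in> FP E" if "e \<in> arcs G" for e using that path_map_FP(1) by simp
  note polys = E.path_poly_poly[OF QFP] E.path_poly_poly[OF MFP]
  have hom: "star_hom GC.A E.A h" using h by (simp add: is_pushforward_def graph_cstar_def)
  have h_V: "h (GC.cst (V z)) = E.cst (Q z * poly_star (Q z))" if "z \<in> verts G" for z
    using that h QFP[OF that]
    by (simp add: is_pushforward_def GC.S_vert_eq gis_map_def E.S_gis_eq del: S_gis.simps)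
  have h_D: "h (GC.cst (D e)) = E.cst (M e * poly_star (Q (head G e)))" if "e \<in> arcs G" for e
    using that h MFP[OF that] QFP[of "head G e"]
    by (simp add: is_pushforward_def GC.S_arc_eq gis_map_def E.S_gis_eq del: S_gis.simps)
  note sum = star_hom_sum[OF GC.cstar_presentation_axioms E.cstar_presentation_axioms hom]
  show "h (g (S_vert E' u)) = S_vert E u" if "u \<in> verts E'"
  proof -
    have u: "u \<in> verts E" using that by simp
    have "g (S_vert E' u) = (\<Oplus>\<^bsub>GC.A\<^esub> z \<in> vfibre G fst u. GC.cst (V z))"
      using g u by (simp add: is_pullback_def graph_cstar_def GC.S_vert_eq)
    also have "\<dots> = GC.cst (\<Sum>z \<in> vfibre G fst u. V z)"
      by (intro GC.finsum_cst finite_vfibre GC.V_poly) auto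
    also have "h \<dots> = E.cst (\<Sum>z \<in> vfibre G fst u. Q z * poly_star (Q z))"
      using h_V polys(1) by (intro sum finite_vfibre GC.V_poly star_polys_mult star_polys_star) auto
    also have "\<dots> = E.cst (V u)"
    proof (rule E.cst_eq)
      show "E.eqv (\<Sum>z \<in> vfibre G fst u. Q z * poly_star (Q z)) (V u)"
      proof (cases "u = v")
        case True
        have "vfibre G fst u = Pair v ` Some ` out" using v by (auto simp: vfibre_fst True)
        then show ?thesis
          using E.eqv_sym[OF E.V_regular[OF v_reg]]
          by (simp add: True sum.reindex inj_on_def Q_simps)
      next
        case False
        have "E.eqv (V u * poly_star (V u)) (V u * V u)" using u by (intro E.eqv_mult E.V_star) auto
        also have "E.eqv (V u * V u) (V u)" using u by (rule E.V_idem)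
        finally show ?thesis using u False by (simp add: vfibre_fst Q_simps)
      qed
    qed
    finally show ?thesis by (simp add: E.S_vert_eq)
  qed
  \<comment> \<open>An edge and its tag determine the lift, so one computation over tags serves old
    and new edges alike.\<close>
  have arc: "h (g (S_arc E' e)) = E.cst (\<Sum>t \<in> arc_tags E v (head E' e). M (e, t) * poly_star (Q (head E' e, t)))"
    if e: "e \<in> arcs E'" for e
  proof -
    have hd: "head E' e \<in> verts E" using wf_shift e by (auto dest: wf_digraph.head_in_verts)
    have "g (S_arc E' e) = (\<Oplus>\<^bsub>GC.A\<^esub> x \<in> afibre G fst e. GC.cst (D x))"
      using g e by (simp add: is_pullback_def graph_cstar_def GC.S_arc_eq)
    also have "\<dots> = GC.cst (\<Sum>x \<in> afibre G fst e. D x)"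
      using finite_afibre[OF e] by (intro GC.finsum_cst GC.D_poly) auto
    also have "h \<dots> = E.cst (\<Sum>x \<in> afibre G fst e. M x * poly_star (Q (head G x)))"
    proof (intro sum)
      fix x assume "x \<in> afibre G fst e"
      then have x: "x \<in> arcs G" and hx: "head G x \<in> verts G" by (auto simp: wf_digraph.head_in_verts[OF wf_split])
      show "M x * poly_star (Q (head G x)) \<in> E.polys"
        using polys(1)[OF hx] polys(2)[OF x] by (intro star_polys_mult star_polys_star)
      show "h (GC.cst (D x)) = E.cst (M x * poly_star (Q (head G x)))" using x by (rule h_D)
      show "D x \<in> GC.polys" using x by simp
    qed (rule finite_afibre[OF e])
    also have "afibre G fst e = Pair e ` arc_tags E v (head E' e)"
      using e by (auto simp: afibre_fst)
    finally show ?thesis by (simp add: sum.reindex inj_on_def)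
  qed
  show "h (g (S_arc E' None)) = E.cst (\<Sum>y \<in> out. D (\<theta> y) * poly_star (D y))"
    by (simp add: arc sum.reindex M_simps Q_simps del: tail_split)
  show "h (g (S_arc E' (Some d))) = S_arc E d" if "Some d \<in> arcs E'"
  proof -
    have d: "d \<in> arcs E" "d \<notin> \<theta> ` out" using that by auto
    have "E.eqv (\<Sum>t \<in> arc_tags E v (head E d). M (Some d, t) * poly_star (Q (head E d, t))) (D d)"
    proof (cases "head E d = v")
      case True
      then have "tail E d \<noteq> v" using no_loop d by auto
      then show ?thesis
        using D_split[OF d(1) True] True by (simp add: sum.reindex M_simps Q_simps del: tail_split)
    next
      case False
      have "E.eqv (D d * poly_star (V (head E d))) (D d * V (head E d))"
        using d by (intro E.eqv_mult E.V_star) auto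
      also have "E.eqv \<dots> (D d)" using d(1) by (rule E.D_V)
      finally show ?thesis using False d by (simp add: M_simps Q_simps del: tail_split)
    qed
    then show ?thesis
      using arc[OF that] by (simp add: E.S_arc_eq E.cst_eq)
  qed
qed

end

theorem corollary5p17:
  fixes E :: "('v, 'e) pre_digraph"
    and v w :: 'v
    and \<theta> :: "'e \<Rightarrow> 'e"
    and f :: "('v + 'e) cstar_elem \<Rightarrow> ('v + 'e option) cstar_elem"
  defines "E' \<equiv> shift_graph E v w \<theta>"
  assumes "wf_digraph E"
    and "v \<in> verts E" and "w \<in> verts E" and "v \<noteq> w"
    and "v \<in> reg E"
    and "\<forall>e \<in> out_arcs E v. head E e \<noteq> tail E e"
    and "\<theta> \<in> out_arcs E v \<rightarrow> out_arcs E w" and "inj_on \<theta> (out_arcs E v)"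
    and "\<forall>e \<in> out_arcs E v. head E e = head E (\<theta> e)"
    and "star_iso (graph_cstar E) (graph_cstar E') f"
    and "\<forall>u \<in> verts E. f (S_vert E u) = S_vert E' u"
    and "\<forall>e \<in> arcs E - \<theta> ` out_arcs E v. f (S_arc E e) = S_arc E' (Some e)"
    and "\<forall>e \<in> \<theta> ` out_arcs E v.
           f (S_arc E e) =
             S_arc E' None \<otimes>\<^bsub>graph_cstar E'\<^esub> S_arc E' (Some (inv_into (out_arcs E v) \<theta> e))"
  shows "(\<forall>u \<in> verts E'. inv_into (carrier (graph_cstar E)) f (S_vert E' u) = S_vert E u) \<and>
    (\<forall>e. Some e \<in> arcs E' \<longrightarrow>
       inv_into (carrier (graph_cstar E)) f (S_arc E' (Some e)) = S_arc E e) \<and>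
    inv_into (carrier (graph_cstar E)) f (S_arc E' None) =
      (\<Oplus>\<^bsub>graph_cstar E\<^esub> y \<in> out_arcs E v.
         S_arc E (\<theta> y) \<otimes>\<^bsub>graph_cstar E\<^esub> adj (graph_cstar E) (S_arc E y)) \<and>
    (\<exists>(G :: ('v \<times> 'e option, 'e option \<times> 'e option) pre_digraph) gv ge \<phi> g_star \<phi>_star.
       wf_digraph G \<and>
       admissible G E' gv ge \<and> is_pullback G E' gv ge g_star \<and>
       regular_ext_path_hom G E \<phi> \<and> is_pushforward G E \<phi> \<phi>_star \<and>
       (\<forall>a \<in> carrier (graph_cstar E').
          inv_into (carrier (graph_cstar E)) f a = (\<phi>_star \<circ> g_star) a))"
proof -
  interpret wf_digraph E by fact
  interpret graph_shift E v w \<theta>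
    using assms(2-10) by unfold_locales (auto simp: Pi_iff)
  interpret E': cstar_graph "shift_graph E v w \<theta>" using wf_shift by (simp add: cstar_graph_def)
  interpret pair: cstar_presentation_pair "graph_gens (shift_graph E v w \<theta>)" "graph_rels (shift_graph E v w \<theta>)"
    "graph_gens E" "graph_rels E" ..
  let ?k = "inv_into (carrier (graph_cstar E)) f"
  \<comment> \<open>The assumption is indexed by the image of \<open>\<theta>\<close>; injectivity
    rewrites it in terms of \<open>y\<close>.\<close>
  have f_\<theta>: "f (S_arc E (\<theta> y)) = S_arc E' None \<otimes>\<^bsub>graph_cstar E'\<^esub> S_arc E' (Some y)" if "y \<in> out" for y
    using assms(14) inv_into_f_f[OF assms(9) that] that by (metis imageI)
  note k = inverse_shift[OF assms(11)[unfolded E'_def] assms(12)[unfolded E'_def, rule_format]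
      assms(13)[unfolded E'_def, rule_format] f_\<theta>[unfolded E'_def]]
  have k_None: "?k (S_arc E' None) = (\<Oplus>\<^bsub>graph_cstar E\<^esub> y \<in> out_arcs E v.
      S_arc E (\<theta> y) \<otimes>\<^bsub>graph_cstar E\<^esub> adj (graph_cstar E) (S_arc E y))"
  proof -
    have polys: "D (\<theta> y) * poly_star (D y) \<in> E.polys" if "y \<in> out" for y
      using that \<theta> by (auto intro!: star_polys_mult star_polys_star)
    have "?k (S_arc E' None) = E.cst (\<Sum>y \<in> out. D (\<theta> y) * poly_star (D y))"
      using k(3) by (simp add: E'_def)
    also have "\<dots> = (\<Oplus>\<^bsub>E.A\<^esub> y \<in> out. E.cst (D (\<theta> y) * poly_star (D y)))"
      by (rule E.finsum_cst[OF finite_out polys, symmetric])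
    also have "\<dots> = (\<Oplus>\<^bsub>E.A\<^esub> y \<in> out. S_arc E (\<theta> y) \<otimes>\<^bsub>E.A\<^esub> adj E.A (S_arc E y))"
    proof (rule E.cstar.finsum_cong'[OF refl])
      have eq: "E.cst (D (\<theta> y) * poly_star (D y)) = S_arc E (\<theta> y) \<otimes>\<^bsub>E.A\<^esub> adj E.A (S_arc E y)"
        if "y \<in> out" for y
        using that \<theta> by (simp add: E.S_arc_eq E.adj_cst E.mult_cst star_polys_star)
      then show "\<And>y. y \<in> out \<Longrightarrow>
        E.cst (D (\<theta> y) * poly_star (D y)) = S_arc E (\<theta> y) \<otimes>\<^bsub>E.A\<^esub> adj E.A (S_arc E y)" .
      show "(\<lambda>y. S_arc E (\<theta> y) \<otimes>\<^bsub>E.A\<^esub> adj E.A (S_arc E y)) \<in> out \<rightarrow> carrier E.A"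
        using E.cst_carrier[OF polys] by (intro funcsetI) (simp only: eq)
    qed
    finally show ?thesis by (simp add: graph_cstar_def)
  qed
  obtain g where g: "is_pullback G E' fst fst g"
    using pullback_exists[OF wf_shift wf_split admissible_split] by (auto simp: E'_def)
  obtain h where h: "is_pushforward G E gis_map h"
    using pushforward_exists complete_split by blast
  note gh = pushforward_pullback_gens[OF g[unfolded E'_def] h]
  have k_hom: "star_hom E'.A E.A ?k"
    using E.star_iso_inv assms(11) by (simp add: graph_cstar_def E'_def)
  have gh_hom: "star_hom E'.A E.A (h \<circ> g)"
    using star_hom_comp g h by (auto simp: is_pullback_def is_pushforward_def graph_cstar_def E'_def)
  \<comment> \<open>Both sides are star homomorphisms, so by \<open>star_hom_ext\<close> only the
    generators have to be compared.\<close>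
  have "?k a = (h \<circ> g) a" if "a \<in> carrier (graph_cstar E')" for a
  proof (rule pair.star_hom_ext[OF k_hom gh_hom])
    show "?k (universal_gen (graph_gens (shift_graph E v w \<theta>)) (graph_rels (shift_graph E v w \<theta>)) x)
        = (h \<circ> g) (universal_gen (graph_gens (shift_graph E v w \<theta>)) (graph_rels (shift_graph E v w \<theta>)) x)"
      if x: "x \<in> graph_gens (shift_graph E v w \<theta>)" for x
    proof (cases x)
      case (Inl u)
      then show ?thesis
        using x k(1)[of u] gh(1)[of u] by (auto simp: graph_gens_def S_vert_def)
    next
      case (Inr e)
      then show ?thesis
        using x k(2,3) gh(2,3) by (cases e) (auto simp: graph_gens_def S_arc_def)
    qed
    show "a \<in> carrier E'.A" using that by (simp add: graph_cstar_def E'_def)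
  qed
  moreover have "admissible G E' fst fst" using admissible_split by (simp add: E'_def)
  ultimately show ?thesis
    using k(1,2) k_None wf_split g gis_map_regular_split h unfolding E'_def by blast
qed

end
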